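(* Let $0<p<1$, $p\ne\frac12$, $q=1-p$, and let $\Delta_\mu$ be the fractal (Neumann) Laplacian on $[0,1]$ with parameter $p$, with spectral dimension $d_s$ and spectral zeta function $\zeta_{\Delta_\mu}$ (see the context). Let $$R(z)=\frac{z(z^2-3z+2+pq)}{pq},\qquad c=R'(0)=1+\frac{2}{pq},\qquad z_1,z_2=1\pm q,$$ let $\zeta_{R,z_0}$ be the zeta function of the polynomial $R$ with base point $z_0$, and let $d_R=\frac{2\log 3}{\log c}$. Then $d_s=d_R<1$ and $$\zeta_{\Delta_\mu}(s)=\frac{c^{s}}{1-c^{-s/2}}\Big(\zeta_{R,z_1}(s)+\zeta_{R,z_2}(s)\Big).$$ Moreover, $\zeta_{\Delta_\mu}(s)$ has a meromorphic continuation to $\operatorname{Re}(s)>-\varepsilon_p$ for some $\varepsilon_p>0$, and $\liminf_{p\to0}\varepsilon_p\ge2$, $\liminf_{p\to1}\varepsilon_p\ge2$.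
   Context: **Fractal Laplacian on the interval.** For $0<p<1$, $q=1-p$, put $r_1=r_3=\frac{p+pq}{2+pq}$, $r_2=\frac{2q-pq}{2+pq}$ and $m_1=m_3=\frac{q}{1+q}$, $m_2=\frac{p}{1+q}$ (so $\sum r_j=\sum m_j=1$). Let $F_{p,j}(x)=r_jx+(1-r_j)x_j$ with $x_1=0$, $x_2=\frac12$, $x_3=1$; then $[0,1]=\bigcup_jF_{p,j}([0,1])$. Put $V_{p,0}=\{0,1\}$ and $V_{p,n}=\bigcup_jF_{p,j}(V_{p,n-1})$. Define $\mathcal E_{p,0}(f,f)=(f(1)-f(0))^2$ and $\mathcal E_{p,n}(f,f)=\sum_{j=1}^3\frac1{r_j}\mathcal E_{p,n-1}(f\circ F_{p,j},f\circ F_{p,j})$; these are nondecreasing in $n$, and $\mathcal E_p(f,f)=\lim_n\mathcal E_{p,n}(f,f)$ is a local regular Dirichlet form, whose domain consists of continuous functions. Let $\mu$ be the unique self-similar probability measure on $[0,1]$ with weights $m_1,m_2,m_3$, i.e. $\mu=\sum_jm_j\,\mu\circ F_{p,j}^{-1}$. $\Delta_\mu$ is the densely defined self-adjoint operator on $L^2([0,1],\mu)$ satisfying the Gauss–Green formula $\mathcal E_p(f,f)=-C\int_0^1f\,\Delta_\mu f\,d\mu+ff'\big|_0^1$ with a constant $C>0$ (the boundary term vanishes under Neumann boundary conditions), normalized so that $\Delta_\mu f(x)=\lim_{n\to\infty}\big(1+\frac2{pq}\big)^n\Delta_{p,n}f(x)$. Here $\Delta_{p,n}$ is the generator of the nearest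 neighbor random walk on $V_{p,n}$ which at an interior point steps to the left or right neighbor with probabilities proportional to the $\mu$-measures of the adjacent level-$n$ intervals (these probabilities are $p$ and $q$ in some order), and at the endpoints $0,1$ steps to the unique neighbor with probability 1. $-\Delta_\mu$ is nonnegative with discrete spectrum. Its spectral zeta function is $\zeta_{\Delta_\mu}(s)=\sum_j\lambda_j^{-s/2}$, where $\lambda_j$ runs over the nonzero eigenvalues of $-\Delta_\mu$ counted with multiplicity. The spectral dimension $d_s$ is the exponent such that the eigenvalue counting function $\rho(\lambda)=\#\{j:\lambda_j<\lambda\}$ satisfies $0<\liminf_{\lambda\to\infty}\rho(\lambda)\lambda^{-d_s/2}\le\limsup_{\lambda\to\infty}\rho(\lambda)\lambda^{-d_s/2}<\infty$. **Zeta function of $R$.** For $z_0\in\{z_1,z_2\}$ and $\operatorname{Re}(s)>d_R$, $$\zeta_{R,z_0}(s)=\lim_{n\to\infty}\sum_{z\in R^{-n}\{z_0\}}(c^nz)^{-s/2},$$ where $R^{-n}\{z_0\}$ denotes the $3^n$ preimages of $z_0$ under the $n$-th iterate of $R$, counted with multiplicity. The Julia set of $R$ is contained in $[0,2]$; the limit exists and is analytic in $s$ for $\operatorname{Re}(s)>d_R$.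
   Formalization: The prefactor c^s/(1-c^{-s/2}) is replaced by c^{-s/2}/(1-c^{-s/2}), since the printed identity is false: for real s>d_R both zeta functions of R are positive and the nonzero eigenvalues give the series of c^{-js/2} over j≥1. *)

theory Defs
  imports
    "HOL-Probability.Probability"
    "HOL-Complex_Analysis.Complex_Analysis"
    "HOL-Computational_Algebra.Computational_Algebra"
    "HOL-Library.Function_Algebras"
begin

subsection \<open>The self-similar interval\<close>

text \<open>The index \<open>j\<close> ranges over \<open>{1, 2, 3}\<close> throughout.\<close>

definition resist :: "real \<Rightarrow> nat \<Rightarrow> real" where
  "resist p j = (let q = 1 - p in
     if j = 2 then (2 * q - p * q) / (2 + p * q) else (p + p * q) / (2 + p * q))"

definition weight :: "real \<Rightarrow> nat \<Rightarrow> real" where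
  "weight p j = (let q = 1 - p in if j = 2 then p / (1 + q) else q / (1 + q))"

definition fixpt :: "nat \<Rightarrow> real" where
  "fixpt j = (real j - 1) / 2"

definition F :: "real \<Rightarrow> nat \<Rightarrow> real \<Rightarrow> real" where
  "F p j x = resist p j * x + (1 - resist p j) * fixpt j"

fun V :: "real \<Rightarrow> nat \<Rightarrow> real set" where
  "V p 0 = {0, 1}"
| "V p (Suc n) = (\<Union>j\<in>{1..3}. F p j ` V p n)"

definition self_similar_measure :: "real \<Rightarrow> real measure" where
  "self_similar_measure p = (THE M. prob_space M \<and> sets M = sets borel \<and>
     measure M {0..1} = 1 \<and>
     (\<forall>A\<in>sets borel. measure M A = (\<Sum>j=1..3. weight p j * measure M (F p j -` A))))"


subsection \<open>The Dirichlet form\<close>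

text \<open>The bilinear forms obtained from the quadratic forms \<open>f \<mapsto> energy_approx p n f f\<close> by
  polarization; the recursion is the same.\<close>

fun energy_approx :: "real \<Rightarrow> nat \<Rightarrow> (real \<Rightarrow> real) \<Rightarrow> (real \<Rightarrow> real) \<Rightarrow> real" where
  "energy_approx p 0 f g = (f 1 - f 0) * (g 1 - g 0)"
| "energy_approx p (Suc n) f g =
     (\<Sum>j=1..3. 1 / resist p j * energy_approx p n (f \<circ> F p j) (g \<circ> F p j))"

definition energy :: "real \<Rightarrow> (real \<Rightarrow> real) \<Rightarrow> (real \<Rightarrow> real) \<Rightarrow> real" where
  "energy p f g = lim (\<lambda>n. energy_approx p n f g)"

text \<open>Functions on \<open>[0,1]\<close> are represented by their extension by \<open>0\<close> to the real line. The
  measure has full support in \<open>[0,1]\<close>, so distinct elements of the domain are distinct in the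
  \<open>L\<^sup>2\<close> space of the measure.\<close>

definition energy_domain :: "real \<Rightarrow> (real \<Rightarrow> real) set" where
  "energy_domain p = {f. continuous_on {0..1} f \<and> (\<forall>x. x \<notin> {0..1} \<longrightarrow> f x = 0) \<and>
     convergent (\<lambda>n. energy_approx p n f f)}"


subsection \<open>The Laplacian\<close>

text \<open>The scaling factor; see \<open>scaling_eq_deriv_R\<close> below.\<close>

definition scaling :: "real \<Rightarrow> real" where
  "scaling p = 1 + 2 / (p * (1 - p))"

definition left_nbr :: "real \<Rightarrow> nat \<Rightarrow> real \<Rightarrow> real" where
  "left_nbr p n x = Max {y \<in> V p n. y < x}"

definition right_nbr :: "real \<Rightarrow> nat \<Rightarrow> real \<Rightarrow> real" where
  "right_nbr p n x = Min {y \<in> V p n. x < y}"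

definition walk_generator :: "real \<Rightarrow> nat \<Rightarrow> (real \<Rightarrow> real) \<Rightarrow> real \<Rightarrow> real" where
  "walk_generator p n f x =
     (let l = left_nbr p n x; r = right_nbr p n x;
          ml = measure (self_similar_measure p) {l..x};
          mr = measure (self_similar_measure p) {x..r}
      in if x = 0 then f r - f x
         else if x = 1 then f l - f x
         else ml / (ml + mr) * f l + mr / (ml + mr) * f r - f x)"

text \<open>The operator \<open>f \<mapsto> u\<close> of the Dirichlet form on \<open>L\<^sup>2\<close>, as a relation: the Gauss--Green
  formula, polarized and without boundary term, tested against the whole domain of the form.
  Testing against functions that do not vanish at \<open>0\<close> and \<open>1\<close> is what imposes the Neumann
  boundary conditions on \<open>f\<close>.\<close>

definition gauss_green :: "real \<Rightarrow> real \<Rightarrow> (real \<Rightarrow> real) \<Rightarrow> (real \<Rightarrow> real) \<Rightarrow> bool" where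
  "gauss_green p C f u \<longleftrightarrow>
     f \<in> energy_domain p \<and>
     u \<in> borel_measurable borel \<and> integrable (self_similar_measure p) (\<lambda>x. (u x)\<^sup>2) \<and>
     (\<forall>h\<in>energy_domain p. energy p f h = - C * (\<integral>x. h x * u x \<partial>self_similar_measure p))"

text \<open>The constant is fixed by the pointwise limit of the rescaled random walk generators. The
  limit is required at the vertices, where these are defined for all large \<open>n\<close>, and for \<open>f\<close> whose
  Laplacian is continuous, so that its value at a point makes sense.\<close>

definition gauss_green_const :: "real \<Rightarrow> real" where
  "gauss_green_const p = (THE C. C > 0 \<and>
     (\<forall>f u. gauss_green p C f u \<and> continuous_on {0..1} u \<longrightarrow>
        (\<forall>k. \<forall>x\<in>V p k. (\<lambda>n. scaling p ^ n * walk_generator p n f x) \<longlonglongrightarrow> u x)))"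

definition laplacian :: "real \<Rightarrow> (real \<Rightarrow> real) \<Rightarrow> (real \<Rightarrow> real) \<Rightarrow> bool" where
  "laplacian p f u \<longleftrightarrow> gauss_green p (gauss_green_const p) f u"


subsection \<open>Eigenvalues, spectral dimension and spectral zeta function\<close>

definition eigenspace :: "real \<Rightarrow> real \<Rightarrow> (real \<Rightarrow> real) set" where
  "eigenspace p \<kappa> = {f. laplacian p f (\<lambda>x. - (\<kappa> * f x))}"

definition multiplicity_ev :: "real \<Rightarrow> real \<Rightarrow> nat" where
  "multiplicity_ev p \<kappa> =
     vector_space.dim (\<lambda>(a::real) (f::real \<Rightarrow> real) x. a * f x) (eigenspace p \<kappa>)"

lemma vector_space_real_fun: "vector_space (\<lambda>(a::real) (f::real \<Rightarrow> real) x. a * f x)"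
  by unfold_locales (auto simp: fun_eq_iff algebra_simps)

definition nonzero_eigenvalues :: "real \<Rightarrow> real set" where
  "nonzero_eigenvalues p = {\<kappa>. \<kappa> \<noteq> 0 \<and> (\<exists>f\<in>eigenspace p \<kappa>. f \<noteq> (\<lambda>x. 0))}"

definition eigenvalue_count :: "real \<Rightarrow> real \<Rightarrow> real" where
  "eigenvalue_count p t = (\<Sum>\<kappa>\<in>{\<kappa>\<in>nonzero_eigenvalues p. \<kappa> < t}. real (multiplicity_ev p \<kappa>))"

definition is_spectral_dimension :: "real \<Rightarrow> real \<Rightarrow> bool" where
  "is_spectral_dimension p d \<longleftrightarrow>
     0 < Liminf at_top (\<lambda>t. ereal (eigenvalue_count p t * t powr (- d / 2))) \<and>
     Limsup at_top (\<lambda>t. ereal (eigenvalue_count p t * t powr (- d / 2))) < \<infinity>"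

definition spectral_dimension :: "real \<Rightarrow> real" where
  "spectral_dimension p = (THE d. is_spectral_dimension p d)"

definition zeta_term :: "real \<Rightarrow> complex \<Rightarrow> real \<Rightarrow> complex" where
  "zeta_term p s \<kappa> = of_nat (multiplicity_ev p \<kappa>) * complex_of_real \<kappa> powr (- s / 2)"

definition spectral_zeta :: "real \<Rightarrow> complex \<Rightarrow> complex" where
  "spectral_zeta p s = (\<Sum>\<^sub>\<infinity>\<kappa>\<in>nonzero_eigenvalues p. zeta_term p s \<kappa>)"


subsection \<open>The polynomial and its zeta function\<close>

text \<open>\<open>z (z\<^sup>2 - 3 z + 2 + p q) / (p q)\<close> with \<open>q = 1 - p\<close>\<close>

definition R :: "real \<Rightarrow> complex poly" where
  "R p = smult (1 / of_real (p * (1 - p))) [:0, 2 + of_real (p * (1 - p)), -3, 1:]"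

lemma poly_R:
  "poly (R p) z = z * (z\<^sup>2 - 3 * z + 2 + of_real (p * (1 - p))) / of_real (p * (1 - p))"
proof -
  define a where "a = complex_of_real (p * (1 - p))"
  have "poly (R p) z = 1 / a * (z * (2 + a + z * (-3 + z)))"
    unfolding R_def a_def[symmetric] poly_smult poly_pCons poly_0
    by (rule arg_cong[where f = "(*) (1 / a)"]) simp
  also have "z * (2 + a + z * (-3 + z)) = z * (z\<^sup>2 - 3 * z + 2 + a)"
    by (simp add: power2_eq_square algebra_simps)
  finally show ?thesis unfolding a_def[symmetric] by simp
qed

lemma scaling_eq_deriv_R:
  assumes "0 < p" "p < 1"
  shows "complex_of_real (scaling p) = poly (pderiv (R p)) 0"
proof -
  define a where "a = p * (1 - p)"
  have "a \<noteq> 0" using assms by (simp add: a_def)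
  have "poly (pderiv (R p)) 0 = (1 / of_real a) * (2 + of_real a)"
    unfolding R_def a_def[symmetric] by (simp add: pderiv_smult pderiv_pCons)
  also have "\<dots> = complex_of_real (1 + 2 / a)"
    using \<open>a \<noteq> 0\<close> by (simp add: add_divide_distrib)
  finally show ?thesis by (simp only: scaling_def a_def)
qed

definition R_iter :: "real \<Rightarrow> nat \<Rightarrow> complex poly" where
  "R_iter p n = (pcompose (R p) ^^ n) [:0, 1:]"

lemma poly_R_iter: "poly (R_iter p n) z = (poly (R p) ^^ n) z"
  by (induction n) (simp_all add: R_iter_def poly_pcompose)

definition R_zeta_approx :: "real \<Rightarrow> complex \<Rightarrow> complex \<Rightarrow> nat \<Rightarrow> complex" where
  "R_zeta_approx p z0 s n =
     (\<Sum>z\<in>#proots (R_iter p n - [:z0:]). (of_real (scaling p) ^ n * z) powr (- s / 2))"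

definition R_zeta :: "real \<Rightarrow> complex \<Rightarrow> complex \<Rightarrow> complex" where
  "R_zeta p z0 s = lim (R_zeta_approx p z0 s)"

text \<open>With \<open>c = scaling p\<close>, the spectrum of minus the level-\<open>n\<close> walk generator is \<open>{0, 2}\<close> together with
  the preimages of \<open>1 \<plusminus> q\<close> under the \<open>m\<close>-th iterates of \<open>R\<close> for \<open>m < n\<close>. Rescaled by \<open>c\<^sup>n\<close>, the
  \<open>m\<close>-th generation contributes with the factor \<open>c powr (- (n - m) s / 2)\<close>, where \<open>n - m \<ge> 1\<close>.
  The prefactor relating the two zeta functions is therefore
  \<open>c powr (- s / 2) / (1 - c powr (- s / 2))\<close>; the numerator \<open>c powr s\<close> found in print is a
  misprint and gives a false identity (at \<open>s = 2\<close>, already off by a factor \<open>c\<^sup>3\<close>).\<close>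

definition R_dimension :: "real \<Rightarrow> real" where
  "R_dimension p = 2 * ln 3 / ln (scaling p)"

end

theory Submission
  imports Defs
begin

text \<open>
  Put \<open>\<phi>\<^sub>l\<close> for the solution of \<open>f'' = - l f \<mu>\<close> with \<open>f 0 = 1\<close>, \<open>f' 0 = 0\<close>. Self-similarity factors
  the monodromy matrix at \<open>c l\<close> into three rescaled copies of the one at \<open>l\<close>. Both its
  asymmetry and its determinant defect obey multiplicative recursions that contract towards
  \<open>l = 0\<close>, hence vanish, and what remains is the Poincare equation \<open>Z (c k) = R (Z k)\<close> for the
  entire function \<open>Z k = 1 - \<phi>\<^bsub>2 k\<^esub> 1\<close>, together with the fact that \<open>k\<close> is a nonzero
  eigenvalue iff \<open>Z (k / c ^ j) = 1 \<plusminus> q\<close> for some \<open>j \<ge> 1\<close>, always with multiplicity \<open>1\<close>.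

  For \<open>p \<noteq> 1/2\<close> the function \<open>Z\<close> is increasing from \<open>0\<close> to \<open>2\<close> on an interval \<open>[0, kap]\<close>, so
  the solutions of \<open>Z k = z\<^sub>0\<close> up to \<open>c ^ n kap\<close> correspond to the \<open>3 ^ n\<close> preimages of \<open>z\<^sub>0\<close>
  under the iterate \<open>R ^ n\<close>, all real and simple. This gives the counting function, and by
  dominated convergence the zeta function of \<open>R\<close> is \<open>\<Sum> k powr (- s / 2)\<close> over these solutions.

  For the continuation, the Mellin transform of \<open>x \<mapsto> ln (1 + x)\<close> times this Dirichlet series is
  the Mellin transform of \<open>x \<mapsto> ln (1 - Z (- x) / z\<^sub>0) = \<Sum> ln (1 + x / k)\<close>. The Poincare
  equation says that the latter function is multiplied by \<open>3\<close> under \<open>x \<mapsto> c x\<close> up to a constant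
  and an error \<open>O(1 / x)\<close>, so its Mellin transform is meromorphic one unit beyond its natural
  boundary \<open>Re s = 0\<close>. With exponent \<open>s / 2\<close> this yields \<open>\<epsilon> = 2\<close> for every \<open>p\<close>.
\<close>

text \<open>The eigenvalue equation can be solved outright because, for a vertex \<open>x\<close>,
  the function \<open>ramp x\<close> lies in the form domain and its approximate energy against any
  \<open>f\<close> is eventually \<open>f 0 - f x\<close>. The weak Gauss--Green formula thus
  becomes a Volterra equation plus a mean-zero condition, which carries the Neumann conditions. Its
  constant is \<open>2\<close> because \<open>mu\<close> has mean \<open>1 / 2\<close>, so that a
  linear hat on a cell carries half the mass of the cell; hence the \<open>2 k\<close> in
  \<open>Z\<close>, which also gives \<open>Z' 0 = 1\<close>.

  Resistance times mass is \<open>1 / c\<close> on every cell, so one parameter serves all three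
  copies. Near \<open>0\<close> the recursions multiply the defects by about \<open>3\<close>, while
  their linear bounds allow growth by \<open>c \<ge> 9\<close> per step.

  The condition \<open>p \<noteq> 1 / 2\<close> makes \<open>9 < c\<close>, so
  \<open>rho < 1 / 2\<close>, and opens gaps between the three branches of \<open>RR\<close> over
  \<open>(0, 2)\<close>.

  The continuation works on the negative axis: all zeros of \<open>Z - z0\<close> are positive, so
  each factor \<open>1 + x / k\<close> exceeds \<open>1\<close> and real logarithms suffice, and
  \<open>- Z (- x) \<ge> x\<close> is large, so the cubic \<open>RR\<close> acts like its leading
  term.\<close>

lemma sum_one_to_three: "(\<Sum>j=1..3. f j) = f 1 + f 2 + f (3::nat)"
  by (simp add: eval_nat_numeral)

lemma one_to_three: "j \<in> {1..3} \<longleftrightarrow> j = 1 \<or> j = 2 \<or> j = (3::nat)"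
  by auto

lemma one_to_three_cases:
  assumes "j \<in> {1..3}"
  obtains "j = 1" | "j = 2" | "j = (3::nat)"
  using assms unfolding one_to_three by blast

section \<open>Parameters, contractions and their order on the interval\<close>

locale self_similar_interval =
  fixes p :: real
  assumes p_pos: "0 < p" and p_less_1: "p < 1"
begin

abbreviation "r \<equiv> resist p"
abbreviation "m \<equiv> weight p"
abbreviation "c \<equiv> scaling p"

declare One_nat_def [simp del]

lemma pq_pos: "0 < p * (1 - p)"
  using p_pos p_less_1 by simp

lemma resist_simps:
  "r 1 = (p + p * (1 - p)) / (2 + p * (1 - p))"
  "r 3 = r 1"
  "r 2 = (2 * (1 - p) - p * (1 - p)) / (2 + p * (1 - p))"
  by (simp_all add: resist_def Let_def)

lemma weight_simps:
  "m 1 = (1 - p) / (2 - p)" "m 3 = m 1" "m 2 = p / (2 - p)"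
  by (simp_all add: weight_def Let_def)

lemma fixpt_simps: "fixpt 1 = 0" "fixpt 2 = 1/2" "fixpt 3 = 1"
  by (simp_all add: fixpt_def)

lemma resist_12_pos: "0 < r 1" "0 < r 2"
proof -
  have "0 < (1 - p) * (2 - p)" using p_pos p_less_1 by simp
  hence "0 < 2 * (1 - p) - p * (1 - p)" by (simp add: algebra_simps)
  thus "0 < r 1" "0 < r 2"
    using p_pos p_less_1 pq_pos by (simp_all add: resist_simps add_pos_pos)
qed

lemma resist_sum: "2 * r 1 + r 2 = 1"
proof -
  have "2 * (p + p * (1 - p)) / (2 + p * (1 - p)) + (2 * (1 - p) - p * (1 - p)) / (2 + p * (1 - p))
      = (2 + p * (1 - p)) / (2 + p * (1 - p))"
    unfolding add_divide_distrib[symmetric] by (simp add: algebra_simps)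
  thus ?thesis using pq_pos by (simp add: resist_simps)
qed

lemma weight_12_pos: "0 < m 1" "0 < m 2"
  using p_pos p_less_1 by (simp_all add: weight_simps)

lemma weight_sum: "2 * m 1 + m 2 = 1"
proof -
  have "2 * (1 - p) / (2 - p) + p / (2 - p) = (2 - p) / (2 - p)"
    unfolding add_divide_distrib[symmetric] by (simp add: algebra_simps)
  thus ?thesis using p_less_1 by (simp add: weight_simps)
qed

lemma scaling_pos: "0 < c" and scaling_gt_1: "1 < c"
  using pq_pos by (simp_all add: scaling_def add_pos_pos)

lemma inverse_scaling: "1 / c = p * (1 - p) / (2 + p * (1 - p))"
  using pq_pos p_pos p_less_1 by (simp add: scaling_def field_simps)

text \<open>Time scales uniformly over the cells although lengths and masses do not. This is why a
  single \<open>c\<close> rescales the Laplacian and why a solution with parameter \<open>l\<close>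
  has parameter \<open>l / c\<close> on every cell.\<close>

lemma resist_weight: 
  assumes "j \<in> {1..3}" shows "r j * m j = 1 / c"
proof -
  have "r 1 * m 1 = 1 / c"
  proof -
    have "p + p * (1 - p) = p * (2 - p)" by (simp add: algebra_simps)
    thus ?thesis using p_less_1 pq_pos unfolding inverse_scaling resist_simps weight_simps
      by (simp add: divide_simps)
  qed
  moreover have "r 2 * m 2 = 1 / c"
  proof -
    have "2 * (1 - p) - p * (1 - p) = (1 - p) * (2 - p)" by (simp add: algebra_simps)
    thus ?thesis using p_less_1 pq_pos unfolding inverse_scaling resist_simps weight_simps
      by (simp add: divide_simps)
  qed
  ultimately show ?thesis using assms
    by (elim one_to_three_cases) (simp_all add: resist_simps(2) weight_simps(2))
qed

lemma resist_pos: "j \<in> {1..3} \<Longrightarrow> 0 < r j"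
  using resist_12_pos by (elim one_to_three_cases) (simp_all add: resist_simps(2))

lemma weight_pos: "j \<in> {1..3} \<Longrightarrow> 0 < m j"
  using weight_12_pos by (elim one_to_three_cases) (simp_all add: weight_simps(2))

lemma resist_less_1: "j \<in> {1..3} \<Longrightarrow> r j < 1"
  using resist_12_pos resist_sum by (elim one_to_three_cases) (simp_all add: resist_simps(2))

lemma weight_less_1: "j \<in> {1..3} \<Longrightarrow> m j < 1"
  using weight_12_pos weight_sum by (elim one_to_three_cases) (simp_all add: weight_simps(2))

lemma F_simps:
  "F p 1 x = r 1 * x" "F p 2 x = r 1 + r 2 * x" "F p 3 x = r 1 + r 2 + r 1 * x"
proof -
  have *: "r 2 = 1 - 2 * r 1" using resist_sum by simp
  show "F p 1 x = r 1 * x" "F p 2 x = r 1 + r 2 * x" "F p 3 x = r 1 + r 2 + r 1 * x"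
    unfolding F_def by (simp_all add: fixpt_simps resist_simps(2) * algebra_simps)
qed

lemma F_affine: "F p j x = F p j 0 + r j * x"
  by (simp add: F_def algebra_simps)

lemma F_endpoints: "F p 1 0 = 0" "F p 1 1 = F p 2 0" "F p 2 1 = F p 3 0" "F p 3 1 = 1"
  using resist_sum by (simp_all add: F_simps)

lemma F_endpoints_order: "0 < F p 2 0" "F p 2 0 < F p 3 0" "F p 3 0 < 1"
  using resist_12_pos resist_sum by (auto simp: F_simps)

lemma F_cells_order: "i < j \<Longrightarrow> i \<in> {1..3} \<Longrightarrow> j \<in> {1..3} \<Longrightarrow> F p i 1 \<le> F p j 0"
  using F_endpoints F_endpoints_order by (elim one_to_three_cases) simp_all

lemma F_less_iff: "j \<in> {1..3} \<Longrightarrow> F p j x < F p j y \<longleftrightarrow> x < y"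
  and F_le_iff: "j \<in> {1..3} \<Longrightarrow> F p j x \<le> F p j y \<longleftrightarrow> x \<le> y"
  using resist_pos[of j] by (auto simp: F_affine[of j x] F_affine[of j y])

lemma F_range_endpoints: "j \<in> {1..3} \<Longrightarrow> 0 \<le> F p j 0 \<and> F p j 1 \<le> 1"
  using resist_12_pos resist_sum by (elim one_to_three_cases) (simp_all add: F_simps)

lemma F_in_unit: "j \<in> {1..3} \<Longrightarrow> x \<in> {0..1} \<Longrightarrow> F p j x \<in> {0..1}"
  using F_range_endpoints[of j] F_le_iff[of j 0 x] F_le_iff[of j x 1] by auto

lemma F_measurable [measurable]: "F p j \<in> borel_measurable borel"
  unfolding F_def by measurable

definition Finv :: "nat \<Rightarrow> real \<Rightarrow> real" where
  "Finv j x = (x - F p j 0) / r j"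

lemma F_vimage_Iic: "j \<in> {1..3} \<Longrightarrow> F p j -` {..x} = {..Finv j x}"
proof (intro set_eqI)
  fix y assume "j \<in> {1..3}"
  thus "y \<in> F p j -` {..x} \<longleftrightarrow> y \<in> {..Finv j x}"
    using resist_pos[of j] F_affine[of j y] by (simp add: Finv_def pos_le_divide_eq algebra_simps)
qed

lemma Finv_mono: "j \<in> {1..3} \<Longrightarrow> x \<le> y \<Longrightarrow> Finv j x \<le> Finv j y"
  using resist_pos[of j] by (auto simp: Finv_def divide_simps)

lemma Finv_nonpos: "j \<in> {1..3} \<Longrightarrow> x \<le> F p j 0 \<Longrightarrow> Finv j x \<le> 0"
  using resist_pos[of j] by (auto simp: Finv_def divide_simps)

lemma Finv_ge_1: "j \<in> {1..3} \<Longrightarrow> F p j 1 \<le> x \<Longrightarrow> 1 \<le> Finv j x"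
  using resist_pos[of j] F_affine[of j 1] by (auto simp: Finv_def divide_simps)

subsection \<open>The self-similar measure\<close>

text \<open>Self-similarity tested on half-lines: the distribution function of a self-similar
  measure is a fixed point of this operator.\<close>

definition cdf_step :: "(real \<Rightarrow> real) \<Rightarrow> real \<Rightarrow> real" where
  "cdf_step D x = m 1 * D (Finv 1 x) + m 2 * D (Finv 2 x) + m 3 * D (Finv 3 x)"

definition cdf_like :: "(real \<Rightarrow> real) \<Rightarrow> bool" where
  "cdf_like D \<longleftrightarrow> (\<forall>x\<le>0. D x = 0) \<and> (\<forall>x\<ge>1. D x = 1)"

definition max_weight :: real where "max_weight = max (m 1) (m 2)"

lemma max_weight: "0 < max_weight" "max_weight < 1" "m 1 \<le> max_weight" "m 2 \<le> max_weight"
  using weight_12_pos weight_less_1[of 1] weight_less_1[of 2] by (auto simp: max_weight_def)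

lemma cdf_step_like:
  assumes "cdf_like D" shows "cdf_like (cdf_step D)"
proof -
  have e: "Finv j x \<le> 0" if "x \<le> 0" "j \<in> {1..3}" for x j
    using that F_range_endpoints[of j] by (intro Finv_nonpos) auto
  have f: "1 \<le> Finv j x" if "1 \<le> x" "j \<in> {1..3}" for x j
    using that F_range_endpoints[of j] by (intro Finv_ge_1) auto
  show ?thesis using assms e f weight_sum weight_simps(2)
    by (auto simp: cdf_like_def cdf_step_def)
qed

text \<open>Off the \<open>j\<close>-th cell the \<open>j\<close>-th term does not depend on the function.\<close>

lemma cdf_step_contraction:
  assumes D: "cdf_like D" and E: "cdf_like E" and B: "\<And>x. \<bar>D x - E x\<bar> \<le> B"
  shows "\<bar>cdf_step D x - cdf_step E x\<bar> \<le> max_weight * B"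
proof -
  have eq: "D y = E y" if "y \<le> 0 \<or> 1 \<le> y" for y
    using D E that by (auto simp: cdf_like_def)
  have "0 \<le> B" using B[of 0] by simp
  have "m j \<le> max_weight" if "j \<in> {1..3}" for j
    using that max_weight weight_simps(2) by (elim one_to_three_cases) simp_all
  hence bd: "m j * \<bar>D y - E y\<bar> \<le> max_weight * B" if "j \<in> {1..3}" for j y
    using that B[of y] max_weight(1) by (intro mult_mono) auto
  have n: "0 < m j" if "j \<in> {1..3}" for j using weight_pos[OF that] .
  consider "x \<le> F p 2 0" | "F p 2 0 \<le> x" "x \<le> F p 3 0" | "F p 3 0 \<le> x" by linarith
  thus ?thesis
  proof cases
    case 1
    hence "D (Finv 2 x) = E (Finv 2 x)" "D (Finv 3 x) = E (Finv 3 x)"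
      using F_endpoints_order by (intro eq disjI1[OF Finv_nonpos], auto)+
    hence "cdf_step D x - cdf_step E x = m 1 * (D (Finv 1 x) - E (Finv 1 x))"
      by (simp add: cdf_step_def algebra_simps)
    thus ?thesis using bd[of 1 "Finv 1 x"] n[of 1] by (simp add: abs_mult)
  next
    case 2
    hence "D (Finv 1 x) = E (Finv 1 x)" "D (Finv 3 x) = E (Finv 3 x)"
      using F_endpoints(2) by (intro eq disjI1[OF Finv_nonpos] disjI2[OF Finv_ge_1], auto)+
    hence "cdf_step D x - cdf_step E x = m 2 * (D (Finv 2 x) - E (Finv 2 x))"
      by (simp add: cdf_step_def algebra_simps)
    thus ?thesis using bd[of 2 "Finv 2 x"] n[of 2] by (simp add: abs_mult)
  next
    case 3
    hence "D (Finv 1 x) = E (Finv 1 x)" "D (Finv 2 x) = E (Finv 2 x)"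
      using F_endpoints F_endpoints_order by (intro eq disjI2[OF Finv_ge_1], auto)+
    hence "cdf_step D x - cdf_step E x = m 3 * (D (Finv 3 x) - E (Finv 3 x))"
      by (simp add: cdf_step_def algebra_simps)
    thus ?thesis using bd[of 3 "Finv 3 x"] n[of 3] by (simp add: abs_mult)
  qed
qed

lemma cdf_step_fixed_unique:
  assumes D: "cdf_like D" and E: "cdf_like E"
    and "\<And>x. cdf_step D x = D x" "\<And>x. cdf_step E x = E x"
    and B: "\<And>x. \<bar>D x - E x\<bar> \<le> 1"
  shows "D = E"
proof -
  have *: "\<bar>D x - E x\<bar> \<le> max_weight ^ n" for x n
  proof (induction n arbitrary: x)
    case 0 thus ?case using B by simp
  next
    case (Suc n)
    show ?case using cdf_step_contraction[OF D E Suc, of x] assms by simp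
  qed
  show ?thesis
  proof
    fix x
    have "(\<lambda>n. max_weight ^ n) \<longlonglongrightarrow> 0" using max_weight by (intro LIMSEQ_realpow_zero) auto
    hence "\<bar>D x - E x\<bar> \<le> 0" using * by (intro LIMSEQ_le_const) auto
    thus "D x = E x" by simp
  qed
qed

text \<open>The construction of a Cantor function: iterate from the uniform distribution, with
  differences bounded by powers of \<open>max_weight\<close>. Uniform convergence preserves
  continuity, which later excludes atoms of the measure.\<close>

lemma ex_cdf:
  "\<exists>\<Phi>. cdf_like \<Phi> \<and> continuous_on UNIV \<Phi> \<and> mono \<Phi> \<and> (\<forall>x. cdf_step \<Phi> x = \<Phi> x)"
proof -
  define g :: "nat \<Rightarrow> real \<Rightarrow> real" where "g n = (cdf_step ^^ n) (\<lambda>x. max 0 (min 1 x))" for n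
  have g0: "g 0 = (\<lambda>x. max 0 (min 1 x))" and gS: "g (Suc n) = cdf_step (g n)" for n
    by (simp_all add: g_def)
  have like: "cdf_like (g n)" for n
    by (induction n) (simp_all add: gS cdf_step_like, simp add: g0 cdf_like_def)
  have cont: "continuous_on UNIV (g n)" for n
  proof (induction n)
    case 0 show ?case unfolding g0 by (intro continuous_intros)
  next
    case (Suc n)
    have "continuous_on UNIV (\<lambda>x. g n (Finv j x))" for j
      using resist_pos[of j] unfolding Finv_def divide_inverse
      by (intro continuous_on_compose2[OF Suc] continuous_intros) auto
    thus ?case unfolding gS cdf_step_def by (intro continuous_intros)
  qed
  have mono: "mono (g n)" for n
  proof (induction n)
    case 0 show ?case unfolding g0 by (auto intro!: monoI)
  next
    case (Suc n)
    show ?case unfolding gS cdf_step_def using weight_pos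
      by (intro monoI add_mono mult_left_mono monoD[OF Suc] Finv_mono) (auto simp: less_imp_le)
  qed
  have g01: "0 \<le> g n x \<and> g n x \<le> 1" for n x
    using like[of n] monoD[OF mono[of n], of "min 0 x" x] monoD[OF mono[of n], of x "max 1 x"]
    by (auto simp: cdf_like_def)
  have diff: "\<bar>g (Suc n) x - g n x\<bar> \<le> max_weight ^ n" for n x
  proof (induction n arbitrary: x)
    case 0 show ?case using g01[of 0 x] g01[of "Suc 0" x] unfolding power_0 by linarith
  next
    case (Suc n) show ?case
      using cdf_step_contraction[OF like like Suc, of x] by (simp add: gS)
  qed
  have "uniform_limit UNIV (\<lambda>n x. \<Sum>i<n. g (Suc i) x - g i x) (\<lambda>x. \<Sum>i. g (Suc i) x - g i x) sequentially"
    using diff max_weight by (intro Weierstrass_m_test[where M = "\<lambda>n. max_weight ^ n"] summable_geometric) auto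
  hence "uniform_limit UNIV (\<lambda>n x. g n x - g 0 x) (\<lambda>x. \<Sum>i. g (Suc i) x - g i x) sequentially"
    by (subst (asm) sum_lessThan_telescope)
  from uniform_limit_add[OF this uniform_limit_const[where c="g 0"]]
  obtain \<Phi> where lim: "uniform_limit UNIV g \<Phi> sequentially" by auto
  have pw: "(\<lambda>n. g n x) \<longlonglongrightarrow> \<Phi> x" for x by (rule tendsto_uniform_limitI[OF lim]) simp
  have "continuous_on UNIV \<Phi>" by (rule uniform_limit_theorem[OF _ lim]) (simp_all add: cont)
  moreover have "mono \<Phi>"
    by (rule monoI, rule LIMSEQ_le[OF pw pw]) (auto intro: monoD[OF mono])
  moreover have "cdf_like \<Phi>"
    unfolding cdf_like_def
  proof safe
    fix x :: real
    show "\<Phi> x = 0" if "x \<le> 0"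
      using pw[of x] like that by (simp add: cdf_like_def LIMSEQ_const_iff)
    show "\<Phi> x = 1" if "1 \<le> x"
      using pw[of x] like that by (simp add: cdf_like_def LIMSEQ_const_iff)
  qed
  moreover have "cdf_step \<Phi> x = \<Phi> x" for x
  proof -
    have "(\<lambda>n. g (Suc n) x) \<longlonglongrightarrow> cdf_step \<Phi> x"
      unfolding gS cdf_step_def by (intro tendsto_intros pw)
    moreover have "(\<lambda>n. g (Suc n) x) \<longlonglongrightarrow> \<Phi> x" using pw[of x] by (rule LIMSEQ_Suc)
    ultimately show ?thesis by (rule LIMSEQ_unique)
  qed
  ultimately show ?thesis by blast
qed

definition self_similar :: "real measure \<Rightarrow> bool" where
  "self_similar M \<longleftrightarrow> prob_space M \<and> sets M = sets borel \<and> measure M {0..1} = 1 \<and>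
     (\<forall>A\<in>sets borel. measure M A = (\<Sum>j=1..3. m j * measure M (F p j -` A)))"

lemma self_similarD:
  assumes "self_similar M"
  shows "prob_space M" "sets M = sets borel" "measure M {0..1} = 1"
    "A \<in> sets borel \<Longrightarrow> measure M A = (\<Sum>j=1..3. m j * measure M (F p j -` A))"
proof -
  note * = assms[unfolded self_similar_def]
  show "prob_space M" "sets M = sets borel" "measure M {0..1} = 1"
    by (rule *[THEN conjunct1] *[THEN conjunct2, THEN conjunct1]
        *[THEN conjunct2, THEN conjunct2, THEN conjunct1])+
  show "A \<in> sets borel \<Longrightarrow> measure M A = (\<Sum>j=1..3. m j * measure M (F p j -` A))"
    by (rule *[THEN conjunct2, THEN conjunct2, THEN conjunct2, rule_format])
qed

lemma self_similar_real_distribution: "self_similar M \<Longrightarrow> real_distribution M"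
  unfolding real_distribution_def real_distribution_axioms_def using self_similarD(1,2) by blast

lemma self_similar_cdf:
  assumes M: "self_similar M"
  shows "cdf_step (cdf M) x = cdf M x" "cdf_like (cdf M)"
proof -
  interpret M: real_distribution M by (rule self_similar_real_distribution[OF M])
  note one = self_similarD(3)[OF M]
  have vim: "F p 1 -` {..x} = {..Finv 1 x}" "F p 2 -` {..x} = {..Finv 2 x}"
    "F p 3 -` {..x} = {..Finv 3 x}" for x
    by (rule F_vimage_Iic; simp)+
  have "measure M {..x} = (\<Sum>j=1..3. m j * measure M (F p j -` {..x}))" for x
    by (rule self_similarD(4)[OF M]) simp
  thus step: "cdf_step (cdf M) x = cdf M x" for x
    unfolding sum_one_to_three vim cdf_def2 cdf_step_def by (rule sym)
  have neg: "cdf M x = 0" if "x < 0" for x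
  proof -
    have "measure M {..x} + measure M {0..1} = measure M ({..x} \<union> {0..1})"
      using that by (subst M.finite_measure_Union) auto
    also have "\<dots> \<le> 1" by (rule M.prob_le_1)
    finally show ?thesis using one measure_nonneg[of M "{..x}"] by (simp add: cdf_def)
  qed
  \<comment> \<open>Full mass on \<open>{0..1}\<close> does not exclude an atom at \<open>0\<close>.
    The fixed point equation does: at \<open>0\<close> only the first cell contributes, and its
    weight is below \<open>1\<close>.\<close>
  have "Finv 1 0 = 0" "Finv 2 0 < 0" "Finv 3 0 < 0"
    using resist_12_pos by (auto simp: Finv_def F_simps resist_simps(2) divide_simps)
  hence "cdf M 0 = m 1 * cdf M 0" using step[of 0] neg by (simp add: cdf_step_def)
  hence "cdf M 0 = 0" using weight_less_1[of 1] by simp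
  moreover have "cdf M x = 1" if "1 \<le> x" for x
  proof -
    have "measure M {0..1} \<le> measure M {..x}" using that by (intro M.finite_measure_mono) auto
    thus ?thesis using one M.prob_le_1[of "{..x}"] by (simp add: cdf_def)
  qed
  ultimately show "cdf_like (cdf M)" using neg by (auto simp: cdf_like_def less_le)
qed

lemma self_similar_unique:
  assumes M: "self_similar M" and N: "self_similar N"
  shows "M = N"
proof -
  interpret M: real_distribution M by (rule self_similar_real_distribution[OF M])
  interpret N: real_distribution N by (rule self_similar_real_distribution[OF N])
  have "cdf M = cdf N"
  proof (rule cdf_step_fixed_unique)
    show "\<bar>cdf M x - cdf N x\<bar> \<le> 1" for x
      using M.cdf_nonneg[of x] N.cdf_nonneg[of x] M.cdf_bounded_prob[of x] N.cdf_bounded_prob[of x]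
      by linarith
  qed (rule self_similar_cdf(2)[OF M] self_similar_cdf(2)[OF N] self_similar_cdf(1)[OF M]
      self_similar_cdf(1)[OF N])+
  thus ?thesis by (rule cdf_unique[OF M.real_distribution_axioms N.real_distribution_axioms])
qed

text \<open>On half-lines the self-similarity identity is the fixed point equation. The sets
  satisfying it are closed under complements and disjoint unions, and half-lines are stable under
  intersection, so it extends to all Borel sets.\<close>

lemma self_similar_from_cdf:
  assumes like: "cdf_like \<Phi>" and cont: "continuous_on UNIV \<Phi>" and mono: "mono \<Phi>"
    and step: "\<And>x. cdf_step \<Phi> x = \<Phi> x"
  shows "self_similar (interval_measure \<Phi>)" "measure (interval_measure \<Phi>) {x} = 0"
proof -
  let ?M = "interval_measure \<Phi>"
  have nd: "\<And>x y. x \<le> y \<Longrightarrow> \<Phi> x \<le> \<Phi> y" using mono by (rule monoD)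
  have rc: "\<And>a. continuous (at_right a) \<Phi>"
    using cont by (meson UNIV_I continuous_on_eq_continuous_within continuous_within_subset subset_UNIV)
  have bot: "(\<Phi> \<longlongrightarrow> 0) at_bot"
    using like by (intro tendsto_eventually) (auto simp: cdf_like_def eventually_at_bot_linorder)
  have top: "(\<Phi> \<longlongrightarrow> 1) at_top"
    using like by (intro tendsto_eventually) (auto simp: cdf_like_def eventually_at_top_linorder)
  interpret M: real_distribution ?M
    by (rule real_distribution_interval_measure[OF nd rc bot top])
  have cdf: "cdf ?M = \<Phi>" by (rule cdf_interval_measure[OF nd rc bot])
  have Icc: "measure ?M {a..b} = \<Phi> b - \<Phi> a" if "a \<le> b" for a b
    using emeasure_interval_measure_Icc[OF that nd cont] nd[OF that] by (simp add: measure_def)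
  show "measure ?M {x} = 0" using Icc[of x x] by simp
  have "measure ?M {0..1} = 1" using Icc[of 0 1] like by (simp add: cdf_like_def)
  moreover have "measure ?M A = (\<Sum>j=1..3. m j * measure ?M (F p j -` A))" if A: "A \<in> sets borel" for A
  proof -
    have vim: "F p j -` B \<in> sets ?M" if "B \<in> sets borel" for j B
      using measurable_sets[OF F_measurable that, of j] by simp
    have "Int_stable (range (\<lambda>a. {..a::real}))" by (auto simp: Int_stable_def)
    moreover have "range (\<lambda>a. {..a::real}) \<subseteq> Pow UNIV" by simp
    moreover have "A \<in> sigma_sets UNIV (range (\<lambda>a. {..a::real}))"
      using A by (subst (asm) borel_eq_atMost) simp
    ultimately show ?thesis
    proof (induction A rule: sigma_sets_induct_disjoint)
      case (basic A)
      then obtain x where "A = {..x}" by auto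
      moreover have "measure ?M {..y} = \<Phi> y" for y using cdf by (metis cdf_def2)
      ultimately show ?case using step[of x] by (simp add: sum_one_to_three cdf_step_def F_vimage_Iic)
    next
      case (compl A)
      hence A: "A \<in> sets ?M" by (subst sets_interval_measure, subst borel_eq_atMost) simp
      hence "measure ?M (UNIV - A) = 1 - measure ?M A"
        using M.prob_compl[OF A] by simp
      moreover have "measure ?M (F p j -` (UNIV - A)) = 1 - measure ?M (F p j -` A)" for j
        using M.prob_compl[of "F p j -` A"] vim[of A j] A by (simp add: vimage_Diff)
      moreover have "(\<Sum>j=1..3. m j) = 1"
        using weight_sum by (simp add: sum_one_to_three weight_simps(2))
      ultimately show ?case using compl.IH
        by (simp add: right_diff_distrib sum_subtractf)
    next
      case (union A)
      have A: "A i \<in> sets borel" for i using union by (subst borel_eq_atMost) auto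
      have *: "(\<lambda>i. m j * measure ?M (F p j -` A i)) sums (m j * measure ?M (F p j -` (\<Union>i. A i)))" for j
        unfolding vimage_UN
      proof (intro sums_mult M.finite_measure_UNION)
        show "range (\<lambda>i. F p j -` A i) \<subseteq> sets ?M" using vim[OF A] by auto
        show "disjoint_family (\<lambda>i. F p j -` A i)"
          using union(1) by (fastforce simp: disjoint_family_on_def)
      qed
      have "(\<lambda>i. \<Sum>j=1..3. m j * measure ?M (F p j -` A i)) sums
          (\<Sum>j=1..3. m j * measure ?M (F p j -` (\<Union>i. A i)))"
        by (intro sums_sum *)
      moreover have "(\<lambda>i. measure ?M (A i)) sums (measure ?M (\<Union>i. A i))"
        using A union(1) by (intro M.finite_measure_UNION) auto
      ultimately show ?case using union(3) by (simp add: sums_unique2)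
    next
      case empty show ?case by simp
    qed
  qed
  ultimately show "self_similar ?M"
    using M.prob_space_axioms by (simp add: self_similar_def)
qed

abbreviation mu :: "real measure" where "mu \<equiv> self_similar_measure p"

text \<open>Existence and uniqueness make the definite description denote the constructed measure;
  the absence of atoms is read off this representative.\<close>

lemma mu_self_similar: "self_similar mu" and mu_singleton: "measure mu {x} = 0"
proof -
  obtain \<Phi> where "cdf_like \<Phi>" "continuous_on UNIV \<Phi>" "mono \<Phi>" "\<And>x. cdf_step \<Phi> x = \<Phi> x"
    using ex_cdf by auto
  note * = self_similar_from_cdf[OF this]
  have "mu = (THE M. self_similar M)" by (simp add: self_similar_measure_def self_similar_def)
  also have "\<dots> = interval_measure \<Phi>"
    using * self_similar_unique by (intro the_equality) auto
  finally show "self_similar mu" "measure mu {x} = 0" using * by auto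
qed

sublocale mu: real_distribution mu
  by (rule self_similar_real_distribution[OF mu_self_similar])

lemma sets_mu [simp, measurable_cong]: "sets mu = sets borel"
  by (rule self_similarD(2)[OF mu_self_similar])

text \<open>Half-open cells tile \<open>{0<..1}\<close> without overlap. Since \<open>0\<close> is
  no atom, this set replaces the closed interval in the integrals over cells.\<close>

lemma mu_Ioc: "measure mu {0<..1} = 1"
proof -
  have "{0..1} = {0} \<union> {0<..1::real}" by auto
  hence "measure mu {0..1} = measure mu {0} + measure mu {0<..1}"
    using mu.finite_measure_Union[of "{0}" "{0<..1}"] by simp
  thus ?thesis using self_similarD(3)[OF mu_self_similar] mu_singleton by simp
qed

lemma AE_mu_Ioc: "AE x in mu. x \<in> {0<..1}"
  by (rule mu.AE_prob_1[OF mu_Ioc])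

lemma AE_mu_unit: "AE x in mu. x \<in> {0..1}"
  using AE_mu_Ioc by eventually_elim auto

lemma measure_mu_eq:
  assumes "A \<in> sets borel" "B \<in> sets borel" "A \<inter> {0<..1} = B \<inter> {0<..1}"
  shows "measure mu A = measure mu B"
proof (rule measure_eq_AE)
  show "AE x in mu. x \<in> A \<longleftrightarrow> x \<in> B"
    using AE_mu_Ioc by eventually_elim (use assms in blast)
  show "A \<in> sets mu" "B \<in> sets mu" using assms(1,2) by simp_all
qed

lemma mu_F_image:
  assumes j: "j \<in> {1..3}" and A: "A \<in> sets borel" and sub: "A \<subseteq> {F p j 0<..F p j 1}"
  shows "measure mu A = m j * measure mu (F p j -` A)"
proof -
  have vim: "F p i -` A \<in> sets borel" for i
    using measurable_sets[OF F_measurable A, of i] by simp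
  have "measure mu (F p i -` A) = 0" if i: "i \<in> {1..3}" "i \<noteq> j" for i
  proof -
    have "F p i x \<notin> {F p j 0<..F p j 1}" if "x \<in> {0<..1}" for x
    proof -
      have "F p i x \<in> {F p i 0<..F p i 1}" using that F_less_iff[of i 0 x] F_le_iff[of i x 1] i by auto
      thus ?thesis using F_cells_order[of i j] F_cells_order[of j i] i j by (cases "i < j") auto
    qed
    hence "F p i -` A \<inter> {0<..1} = {} \<inter> {0<..1}" using sub by blast
    from measure_mu_eq[OF vim _ this] show ?thesis by simp
  qed
  hence "(\<Sum>i=1..3. m i * measure mu (F p i -` A)) = (\<Sum>i\<in>{j}. m i * measure mu (F p i -` A))"
    using j by (intro sum.mono_neutral_right) auto
  moreover have "measure mu A = (\<Sum>j=1..3. m j * measure mu (F p j -` A))"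
    by (rule self_similarD(4)[OF mu_self_similar A])
  ultimately show ?thesis by simp
qed

text \<open>The other two maps send \<open>{0<..1}\<close> off the \<open>j\<close>-th cell, so only
  one summand of the self-similarity identity survives there. As an equality of measures it yields
  the change of variables for integrals at once.\<close>

lemma mu_cell_density:
  assumes j: "j \<in> {1..3}"
  shows "density mu (indicator {F p j 0<..F p j 1}) = density (distr mu borel (F p j)) (\<lambda>_. ennreal (m j))"
proof (rule measure_eqI)
  fix A assume "A \<in> sets (density mu (indicator {F p j 0<..F p j 1}))"
  hence A: "A \<in> sets borel" by simp
  let ?C = "{F p j 0<..F p j 1}"
  have vim: "F p j -` B \<in> sets borel" if "B \<in> sets borel" for B
    using measurable_sets[OF F_measurable that, of j] by simp
  have "x \<in> {0<..1} \<Longrightarrow> F p j x \<in> ?C" for x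
    using F_less_iff[of j 0 x] F_le_iff[of j x 1] j by auto
  hence "measure mu (F p j -` (?C \<inter> A)) = measure mu (F p j -` A)"
    using A by (intro measure_mu_eq vim) auto
  hence "measure mu (?C \<inter> A) = m j * measure mu (F p j -` A)"
    using mu_F_image[OF j, of "?C \<inter> A"] A by simp
  moreover have "emeasure (density mu (indicator ?C)) A = emeasure mu (?C \<inter> A)"
    using A by (subst emeasure_density) (auto simp: indicator_inter_arith[symmetric])
  moreover have "emeasure (density (distr mu borel (F p j)) (\<lambda>_. ennreal (m j))) A =
      ennreal (m j) * emeasure mu (F p j -` A)"
    using A by (subst emeasure_density_const) (auto simp: emeasure_distr)
  ultimately show "emeasure (density mu (indicator ?C)) A =
      emeasure (density (distr mu borel (F p j)) (\<lambda>_. ennreal (m j))) A"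
    using weight_pos[OF j] by (simp add: mu.emeasure_eq_measure ennreal_mult less_imp_le)
qed simp

lemma mu_cell_integral:
  fixes g :: "real \<Rightarrow> real"
  assumes j: "j \<in> {1..3}" and g [measurable]: "g \<in> borel_measurable borel"
    and st: "0 \<le> s" "t \<le> 1"
  shows "(\<integral>y. indicator {F p j s<..F p j t} y * g y \<partial>mu) =
    m j * (\<integral>x. indicator {s<..t} x * g (F p j x) \<partial>mu)"
proof -
  let ?C = "{F p j 0<..F p j 1}" and ?g = "\<lambda>y. indicator {F p j s<..F p j t} y * g y"
  have "F p j 0 \<le> F p j s" "F p j t \<le> F p j 1" using st j F_le_iff by auto
  hence "(\<integral>y. ?g y \<partial>mu) = (\<integral>y. indicator ?C y *\<^sub>R ?g y \<partial>mu)"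
    by (intro Bochner_Integration.integral_cong) (auto simp: indicator_def)
  also have "\<dots> = integral\<^sup>L (density mu (indicator ?C)) ?g"
    using integral_density[of ?g mu "indicator ?C"] by (simp add: ennreal_indicator)
  also have "\<dots> = integral\<^sup>L (density (distr mu borel (F p j)) (\<lambda>_. ennreal (m j))) ?g"
    by (simp only: mu_cell_density[OF j])
  also have "\<dots> = m j * (\<integral>x. ?g (F p j x) \<partial>mu)"
    using weight_pos[OF j] by (subst integral_density) (auto simp: integral_distr)
  also have "(\<integral>x. ?g (F p j x) \<partial>mu) = (\<integral>x. indicator {s<..t} x * g (F p j x) \<partial>mu)"
    using F_less_iff[OF j] F_le_iff[OF j] by (intro Bochner_Integration.integral_cong) (auto simp: indicator_def)
  finally show ?thesis .
qed

end

section \<open>Vertices, cells and cell masses of level n\<close>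

lemma sum_lessThan_add: "sum f {..<a + b} = sum f {..<a} + (\<Sum>k<b. f (a + k))" for f :: "nat \<Rightarrow> 'a::comm_monoid_add"
  by (induction b) (simp_all add: add.assoc)

lemma sum_lessThan_triple:
  "sum f {..<3 * N} = (\<Sum>k<N. f k) + (\<Sum>k<N. f (N + k)) + (\<Sum>k<N. f (2 * N + k))"
  for f :: "nat \<Rightarrow> 'a::comm_monoid_add"
proof -
  have "3 * N = N + N + N" "2 * N = N + N" by simp_all
  thus ?thesis by (simp only: sum_lessThan_add)
qed

lemma lessThan_triple_cases:
  assumes "k < 3 * N"
  obtains j i where "j \<in> {1..3}" "i < N" "k = (j - 1) * N + (i::nat)"
proof -
  have "k div N < 3" using assms by (simp add: less_mult_imp_div_less)
  moreover have "0 < N" using assms by auto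
  ultimately show ?thesis
    by (intro that[of "k div N + 1" "k mod N"]) auto
qed

lemma monotone_bracket:
  fixes a :: "nat \<Rightarrow> real"
  assumes "0 < N" "a 0 < x" "x \<le> a N"
  shows "\<exists>k<N. a k < x \<and> x \<le> a (Suc k)"
  using assms
proof (induction N)
  case (Suc N)
  show ?case
  proof (cases "x \<le> a N")
    case True
    hence "0 < N" using Suc.prems by (cases N) auto
    thus ?thesis using Suc True by (meson less_Suc_eq)
  next
    case False thus ?thesis using Suc.prems by (intro exI[of _ N]) auto
  qed
qed simp

context self_similar_interval
begin

text \<open>Enumerates \<open>V p n\<close> from left to right. The recursion splits off the leading
  ternary digit of \<open>k\<close>, so that the map \<open>F p j\<close> acts on indices as
  \<open>k \<mapsto> (j - 1) * 3 ^ n + k\<close>.\<close>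

fun vertex :: "nat \<Rightarrow> nat \<Rightarrow> real" where
  "vertex 0 k = real k"
| "vertex (Suc n) k =
    (if k < 3 ^ n then F p 1 (vertex n k)
     else if k < 2 * 3 ^ n then F p 2 (vertex n (k - 3 ^ n))
     else F p 3 (vertex n (k - 2 * 3 ^ n)))"

lemma vertex_0 [simp]: "vertex n 0 = 0"
  by (induction n) (simp_all add: F_simps)

lemma vertex_last [simp]: "vertex n (3 ^ n) = 1"
proof (induction n)
  case (Suc n)
  have "3 ^ Suc n - 2 * 3 ^ n = (3 ^ n :: nat)" by simp
  thus ?case using Suc F_endpoints by simp
qed simp

lemma vertex_Suc:
  assumes j: "j \<in> {1..3}" and k: "k \<le> 3 ^ n"
  shows "vertex (Suc n) ((j - 1) * 3 ^ n + k) = F p j (vertex n k)"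
proof (cases "k = 3 ^ n")
  case True
  have e: "3 ^ n + 2 * 3 ^ n - 2 * 3 ^ n = (3 ^ n :: nat)" by simp
  from j show ?thesis
    by (elim one_to_three_cases) (simp_all add: True F_endpoints e)
next
  case False
  hence "k < 3 ^ n" using k by simp
  from j this show ?thesis by (elim one_to_three_cases) simp_all
qed

declare vertex.simps(2) [simp del]

lemma vertex_Suc_Suc:
  assumes j: "j \<in> {1..3}" and k: "k < 3 ^ n"
  shows "vertex (Suc n) (Suc ((j - 1) * 3 ^ n + k)) = F p j (vertex n (Suc k))"
  using vertex_Suc[OF j, of "Suc k" n] k by simp

abbreviation "len n k \<equiv> vertex n (Suc k) - vertex n k"

lemma F_diff: "F p j y - F p j x = r j * (y - x)"
  by (simp add: F_def algebra_simps)

lemma len_Suc: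
  assumes "j \<in> {1..3}" "k < 3 ^ n"
  shows "len (Suc n) ((j - 1) * 3 ^ n + k) = r j * len n k"
  using assms by (simp add: vertex_Suc vertex_Suc_Suc F_diff)

lemma vertex_cell_cases:
  fixes k n :: nat
  assumes "k < 3 ^ Suc n"
  obtains j i where "j \<in> {1..3}" "i < 3 ^ n" "k = (j - 1) * 3 ^ n + i"
  using lessThan_triple_cases[of k "3 ^ n"] assms by auto

lemma len_pos: "k < 3 ^ n \<Longrightarrow> 0 < len n k"
proof (induction n arbitrary: k)
  case (Suc n)
  from \<open>k < 3 ^ Suc n\<close> obtain j i where *: "j \<in> {1..3}" "i < 3 ^ n" "k = (j - 1) * 3 ^ n + i"
    by (rule vertex_cell_cases)
  show ?case unfolding *(3) len_Suc[OF *(1,2)] using Suc.IH[OF *(2)] resist_pos[OF *(1)] by simp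
qed simp

definition max_resist :: real where "max_resist = max (r 1) (r 2)"

lemma max_resist: "0 < max_resist" "max_resist < 1"
  using resist_12_pos resist_less_1[of 1] resist_less_1[of 2] by (auto simp: max_resist_def)

lemma len_le: "k < 3 ^ n \<Longrightarrow> len n k \<le> max_resist ^ n"
proof (induction n arbitrary: k)
  case (Suc n)
  from \<open>k < 3 ^ Suc n\<close> obtain j i where *: "j \<in> {1..3}" "i < 3 ^ n" "k = (j - 1) * 3 ^ n + i"
    by (rule vertex_cell_cases)
  have "r j \<le> max_resist" using *(1) by (elim one_to_three_cases) (simp_all add: max_resist_def resist_simps(2))
  thus ?case unfolding *(3) len_Suc[OF *(1,2)] power_Suc
    using Suc.IH[OF *(2)] resist_pos[OF *(1)] max_resist(1) len_pos[OF *(2)]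
    by (intro mult_mono) auto
qed simp

lemma vertex_less: "i < k \<Longrightarrow> k \<le> 3 ^ n \<Longrightarrow> vertex n i < vertex n k"
proof (induction k)
  case (Suc k)
  have "vertex n k < vertex n (Suc k)" using len_pos[of k n] Suc.prems by simp
  thus ?case using Suc by (cases "i = k") auto
qed simp

lemma vertex_le: "i \<le> k \<Longrightarrow> k \<le> 3 ^ n \<Longrightarrow> vertex n i \<le> vertex n k"
  using vertex_less[of i k n] by (cases "i = k") auto

lemma vertex_less_iff: "i \<le> 3 ^ n \<Longrightarrow> k \<le> 3 ^ n \<Longrightarrow> vertex n i < vertex n k \<longleftrightarrow> i < k"
  using vertex_less[of i k n] vertex_le[of k i n] by (meson not_le)

lemma vertex_in_unit: "k \<le> 3 ^ n \<Longrightarrow> vertex n k \<in> {0..1}"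
  using vertex_le[of 0 k n] vertex_le[of k "3 ^ n" n] by simp

text \<open>The maps act on the leading ternary digit of the index, whereas refinement appends a
  trailing zero; the two operations commute, which is the induction step.\<close>

lemma vertex_refine: "k \<le> 3 ^ n \<Longrightarrow> vertex (Suc n) (3 * k) = vertex n k"
proof (induction n arbitrary: k)
  case 0
  hence "k = 0 \<or> k = 1" by auto
  thus ?case using vertex_last[of "Suc 0"] by auto
next
  case (Suc n)
  show ?case
  proof (cases "k = 3 ^ Suc n")
    case True
    thus ?thesis using vertex_last[of "Suc (Suc n)"] vertex_last[of "Suc n"]
      by (simp del: vertex_last)
  next
    case False
    hence "k < 3 ^ Suc n" using Suc.prems by simp
    then obtain j i where *: "j \<in> {1..3}" "i < 3 ^ n" "k = (j - 1) * 3 ^ n + i"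
      by (rule vertex_cell_cases)
    have "3 * k = (j - 1) * 3 ^ Suc n + 3 * i" by (simp add: *(3) algebra_simps)
    hence "vertex (Suc (Suc n)) (3 * k) = F p j (vertex (Suc n) (3 * i))"
      using vertex_Suc[OF *(1), of "3 * i" "Suc n"] *(2) by (simp)
    also have "\<dots> = F p j (vertex n i)" using Suc.IH[of i] *(2) by (simp)
    also have "\<dots> = vertex (Suc n) k" using vertex_Suc[OF *(1), of i n] *(2,3) by simp
    finally show ?thesis .
  qed
qed

lemma V_eq: "V p n = vertex n ` {..3 ^ n}"
proof (induction n)
  case 0
  have "{..1::nat} = {0, 1}" by auto
  thus ?case by simp
next
  case (Suc n)
  show ?case
  proof (intro equalityI subsetI)
    fix x assume "x \<in> V p (Suc n)"
    then obtain j k where jk: "j \<in> {1..3}" "k \<le> 3 ^ n" "x = F p j (vertex n k)" using Suc by auto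
    have "(j - 1) * 3 ^ n + k \<le> 2 * 3 ^ n + 3 ^ n"
      using jk by (intro add_mono mult_right_mono) auto
    thus "x \<in> vertex (Suc n) ` {..3 ^ Suc n}"
      using vertex_Suc[OF jk(1,2)] jk(3) by (intro image_eqI[of _ _ "(j - 1) * 3 ^ n + k"]) auto
  next
    fix x assume "x \<in> vertex (Suc n) ` {..3 ^ Suc n}"
    then obtain k where k: "k \<le> 3 ^ Suc n" "x = vertex (Suc n) k" by auto
    show "x \<in> V p (Suc n)"
    proof (cases "k = 3 ^ Suc n")
      case True
      hence "x = F p 3 (vertex n (3 ^ n))" using k vertex_last[of "Suc n"] vertex_last[of n] by (simp add: F_endpoints del: vertex_last)
      moreover have "vertex n (3 ^ n) \<in> V p n" unfolding Suc by (rule imageI) simp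
      ultimately have "x \<in> F p 3 ` V p n" by (rule image_eqI)
      thus ?thesis by auto
    next
      case False
      hence "k < 3 ^ Suc n" using k by simp
      then obtain j i where *: "j \<in> {1..3}" "i < 3 ^ n" "k = (j - 1) * 3 ^ n + i"
        by (rule vertex_cell_cases)
      have "x = F p j (vertex n i)" unfolding k(2) *(3) using * by (intro vertex_Suc) auto
      moreover have "vertex n i \<in> V p n" unfolding Suc using *(2) by (intro imageI) simp
      ultimately have "x \<in> F p j ` V p n" by (rule image_eqI)
      thus ?thesis using *(1) by (simp only: V.simps) blast
    qed
  qed
qed

lemma V_mono: "n \<le> n' \<Longrightarrow> V p n \<subseteq> V p n'"
proof (induction rule: dec_induct)
  case (step n')
  have "vertex n' k \<in> vertex (Suc n') ` {..3 ^ Suc n'}" if "k \<le> 3 ^ n'" for k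
    using that vertex_refine[OF that] by (intro image_eqI[of _ _ "3 * k"]) auto
  thus ?case using step by (auto simp: V_eq simp del: V.simps)
qed simp

lemma vertex_bracket:
  assumes "x \<in> {0<..1}"
  obtains k where "k < 3 ^ n" "vertex n k < x" "x \<le> vertex n (Suc k)"
  using monotone_bracket[of "3 ^ n" "vertex n" x] assms by auto

lemma max_resist_power_small: "0 < e \<Longrightarrow> \<exists>N. \<forall>n\<ge>N. max_resist ^ n < e"
proof -
  assume "0 < e"
  have "(\<lambda>n. max_resist ^ n) \<longlonglongrightarrow> 0" using max_resist by (intro LIMSEQ_realpow_zero) auto
  hence "eventually (\<lambda>n. max_resist ^ n < e) sequentially" using \<open>0 < e\<close> by (rule order_tendstoD)
  thus ?thesis by (simp add: eventually_sequentially)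
qed

text \<open>The resistances are the contraction ratios of the maps, so the resistance of a cell is
  its length, and the form is that of a chain of resistors.\<close>

lemma energy_approx_eq:
  "energy_approx p n f g = (\<Sum>k<3 ^ n. (f (vertex n (Suc k)) - f (vertex n k)) *
     (g (vertex n (Suc k)) - g (vertex n k)) / len n k)"
proof (induction n arbitrary: f g)
  case 0 show ?case by simp
next
  case (Suc n)
  let ?t = "\<lambda>m f g k. (f (vertex m (Suc k)) - f (vertex m k)) *
     (g (vertex m (Suc k)) - g (vertex m k)) / len m k"
  have *: "1 / r j * energy_approx p n (f \<circ> F p j) (g \<circ> F p j) =
      (\<Sum>k<3 ^ n. ?t (Suc n) f g ((j - 1) * 3 ^ n + k))" if j: "j \<in> {1..3}" for j
    unfolding Suc sum_distrib_left using j resist_pos[OF j]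
    by (intro sum.cong refl) (simp add: vertex_Suc vertex_Suc_Suc F_diff)
  show ?case
    unfolding energy_approx.simps sum_one_to_three power_Suc sum_lessThan_triple
    using *[of 1] *[of 2] *[of 3] by (simp add: mult_2)
qed

text \<open>The mass of a cell, read off from mass times length being \<open>c\<close> to the power \<open>- n\<close>.\<close>

definition mass :: "nat \<Rightarrow> nat \<Rightarrow> real" where "mass n k = 1 / (c ^ n * len n k)"

lemma mass_pos: "k < 3 ^ n \<Longrightarrow> 0 < mass n k"
  using len_pos scaling_pos by (simp add: mass_def)

lemma mass_Suc:
  assumes j: "j \<in> {1..3}" and k: "k < 3 ^ n"
  shows "mass (Suc n) ((j - 1) * 3 ^ n + k) = m j * mass n k"
proof -
  have "m j = 1 / (c * r j)" using resist_weight[OF j] resist_pos[OF j] scaling_pos by (simp add: field_simps)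
  thus ?thesis unfolding mass_def len_Suc[OF j k] by simp
qed

lemma cell_integral:
  fixes g :: "real \<Rightarrow> real"
  assumes "k < 3 ^ n" and g: "g \<in> borel_measurable borel"
  shows "(\<integral>y. indicator {vertex n k<..vertex n (Suc k)} y * g y \<partial>mu) =
    mass n k * (\<integral>t. indicator {0<..1} t * g (vertex n k + len n k * t) \<partial>mu)"
  using assms
proof (induction n arbitrary: k g)
  case 0 thus ?case by (simp add: mass_def)
next
  case (Suc n)
  note [measurable] = Suc.prems(2)
  from \<open>k < 3 ^ Suc n\<close> obtain j i where *: "j \<in> {1..3}" "i < 3 ^ n" "k = (j - 1) * 3 ^ n + i"
    by (rule vertex_cell_cases)
  have v: "vertex (Suc n) k = F p j (vertex n i)" "vertex (Suc n) (Suc k) = F p j (vertex n (Suc i))"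
    using * vertex_Suc[OF *(1), of i n] vertex_Suc_Suc[OF *(1,2)] by (simp_all)
  have lin: "F p j (vertex n i + len n i * t) = vertex (Suc n) k + len (Suc n) k * t" for t
    using F_affine[of j "vertex n i + len n i * t"] F_affine[of j "vertex n i"]
      len_Suc[OF *(1,2)] *(3) v(1) by (simp add: algebra_simps)
  have "(\<integral>y. indicator {vertex (Suc n) k<..vertex (Suc n) (Suc k)} y * g y \<partial>mu) =
      m j * (\<integral>x. indicator {vertex n i<..vertex n (Suc i)} x * g (F p j x) \<partial>mu)"
    unfolding v using vertex_in_unit[of i n] vertex_in_unit[of "Suc i" n] *(2) Suc.prems(2)
    by (intro mu_cell_integral[OF *(1)]) auto
  also have "(\<integral>x. indicator {vertex n i<..vertex n (Suc i)} x * g (F p j x) \<partial>mu) =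
      mass n i * (\<integral>t. indicator {0<..1} t * g (F p j (vertex n i + len n i * t)) \<partial>mu)"
    by (rule Suc.IH[OF *(2)]) measurable
  also have "m j * \<dots> = mass (Suc n) k *
      (\<integral>t. indicator {0<..1} t * g (vertex (Suc n) k + len (Suc n) k * t) \<partial>mu)"
    using mass_Suc[OF *(1,2)] *(3) by (simp only: lin mult.assoc)
  finally show ?case .
qed

lemma mu_UNIV [simp]: "measure mu UNIV = 1"
  using mu.prob_space by simp

lemma integral_unit_indicator: "(\<integral>t. indicator {0<..1} t * g t \<partial>mu) = (\<integral>t. g t \<partial>mu)"
  if [measurable]: "g \<in> borel_measurable borel" for g :: "real \<Rightarrow> real"
proof (rule integral_cong_AE)
  show "AE t in mu. indicator {0<..1} t * g t = g t"
    using AE_mu_Ioc by eventually_elim simp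
qed measurable

lemma integrable_bounded_weight:
  fixes u w :: "real \<Rightarrow> real"
  assumes u: "integrable mu u" and [measurable]: "w \<in> borel_measurable borel"
    and B: "\<And>y. y \<in> {0<..1} \<Longrightarrow> \<bar>w y\<bar> \<le> B"
  shows "integrable mu (\<lambda>y. w y * u y)"
proof (rule Bochner_Integration.integrable_bound[OF integrable_mult_right[OF u, of B]])
  note [measurable] = borel_measurable_integrable[OF u]
  show "(\<lambda>y. w y * u y) \<in> borel_measurable mu" by measurable
  show "AE y in mu. norm (w y * u y) \<le> norm (B * u y)"
    using AE_mu_Ioc
  proof eventually_elim
    case (elim y)
    show ?case using B[OF elim] by (auto simp: abs_mult intro!: mult_right_mono)
  qed
qed

lemma integrable_bounded:
  fixes w :: "real \<Rightarrow> real"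
  assumes "w \<in> borel_measurable borel" "\<And>y. y \<in> {0<..1} \<Longrightarrow> \<bar>w y\<bar> \<le> B"
  shows "integrable mu w"
  using integrable_bounded_weight[of "\<lambda>_. 1" w B] assms by simp

lemma cell_mass: 
  assumes "k < 3 ^ n"
  shows "measure mu {vertex n k<..vertex n (Suc k)} = mass n k"
proof -
  have "(\<integral>t. indicator {0<..1} t \<partial>mu) = (1::real)" using mu_Ioc by simp
  thus ?thesis using cell_integral[OF assms, of "\<lambda>_. 1"] by simp
qed

lemma cell_mass_Icc:
  assumes "k < 3 ^ n"
  shows "measure mu {vertex n k..vertex n (Suc k)} = mass n k"
proof -
  have "{vertex n k..vertex n (Suc k)} = {vertex n k} \<union> {vertex n k<..vertex n (Suc k)}"
    using len_pos[OF assms] by auto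
  thus ?thesis
    using mu.finite_measure_Union[of "{vertex n k}" "{vertex n k<..vertex n (Suc k)}"]
      cell_mass[OF assms] mu_singleton by simp
qed

lemma scaling_ge: "3 < c"
proof -
  have "p * (1 - p) < 1" using p_pos p_less_1 mult_strict_mono[of p 1 "1 - p" 1] by simp
  thus ?thesis using pq_pos by (simp add: scaling_def field_simps)
qed

text \<open>Splitting the mean over the three cells gives a linear equation for it. Its coefficient
  is \<open>1 - 3 / c\<close>, as each cell contributes \<open>r j * m j = 1 / c\<close>, and it is
  nonzero because \<open>3 < c\<close>.\<close>

lemma mu_mean: "(\<integral>t. t \<partial>mu) = 1 / 2"
proof -
  let ?I = "\<integral>t. t \<partial>mu"
  have int: "integrable mu (\<lambda>t. a * t + b)" "integrable mu (\<lambda>t. t)" for a b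
  proof -
    have "integrable mu (\<lambda>t. t)" by (rule integrable_bounded[where B = 1]) auto
    thus "integrable mu (\<lambda>t. t)" "integrable mu (\<lambda>t. a * t + b)" by auto
  qed
  have cell: "(\<integral>y. indicator {F p j 0<..F p j 1} y * y \<partial>mu) = m j * (F p j 0 + r j * ?I)"
    if j: "j \<in> {1..3}" for j
  proof -
    have "(\<integral>y. indicator {F p j 0<..F p j 1} y * y \<partial>mu) =
        m j * (\<integral>x. indicator {0<..1} x * F p j x \<partial>mu)"
      using mu_cell_integral[OF j, of "\<lambda>y. y" 0 1] by simp
    also have "(\<integral>x. indicator {0<..1} x * F p j x \<partial>mu) = (\<integral>x. F p j x \<partial>mu)"
      by (rule integral_unit_indicator) measurable
    also have "\<dots> = (\<integral>x. r j * x + F p j 0 \<partial>mu)"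
      by (intro Bochner_Integration.integral_cong refl) (simp add: F_def algebra_simps)
    also have "\<dots> = F p j 0 + r j * ?I" using int(2) by simp
    finally show ?thesis .
  qed
  have "?I = (\<integral>y. indicator {0<..1} y * y \<partial>mu)" by (rule integral_unit_indicator[symmetric]) simp
  also have "\<dots> = (\<integral>y. indicator {F p 1 0<..F p 1 1} y * y + indicator {F p 2 0<..F p 2 1} y * y
      + indicator {F p 3 0<..F p 3 1} y * y \<partial>mu)"
    using F_endpoints F_endpoints_order
    by (intro Bochner_Integration.integral_cong refl) (auto simp: indicator_def)
  also have "\<dots> = m 1 * (F p 1 0 + r 1 * ?I) + m 2 * (F p 2 0 + r 2 * ?I) + m 3 * (F p 3 0 + r 3 * ?I)"
  proof -
    have "integrable mu (\<lambda>y. indicator {F p j 0<..F p j 1} y * y)" for j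
      by (rule integrable_bounded[where B = 1]) (auto simp: indicator_def)
    thus ?thesis using cell[of 1] cell[of 2] cell[of 3] by simp
  qed
  finally have I: "?I = m 1 * (r 1 * ?I) + m 2 * (r 1 + r 2 * ?I) + m 1 * (r 1 + r 2 + r 1 * ?I)"
    by (simp add: F_simps weight_simps(2) resist_simps(2))
  have rm: "r 1 * m 1 = 1 / c" "r 2 * m 2 = 1 / c" using resist_weight[of 1] resist_weight[of 2] by simp_all
  have "m 2 * r 1 + m 1 * (r 1 + r 2) = (r 1 + r 2 / 2) * (2 * m 1 + m 2) - r 1 * m 1 - r 2 * m 2 / 2"
    by (simp add: algebra_simps)
  also have "\<dots> = 1/2 * (1 - 3 / c)" using resist_sum weight_sum rm by simp
  finally have "m 2 * r 1 + m 1 * (r 1 + r 2) = 1/2 * (1 - 3 / c)" .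
  moreover have "?I * (1 - 3 / c) = ?I - (2 * (r 1 * m 1) + r 2 * m 2) * ?I"
    by (simp add: rm algebra_simps)
  ultimately have "?I * (1 - 3 / c) = 1/2 * (1 - 3 / c)" using I by (simp add: algebra_simps)
  moreover have "1 - 3 / c \<noteq> 0" using scaling_ge by simp
  ultimately show ?thesis by (metis mult_right_cancel)
qed

section \<open>The Volterra operator: integrating twice against mu from the left end\<close>

definition kernel_op :: "(real \<Rightarrow> real) \<Rightarrow> real \<Rightarrow> real" where
  "kernel_op u x = (\<integral>y. max 0 (x - y) * u y \<partial>mu)"

lemma integrable_kernel:
  assumes "integrable mu u" shows "integrable mu (\<lambda>y. max 0 (x - y) * u y)"
  using assms by (rule integrable_bounded_weight[where B = "\<bar>x\<bar> + 1"]) auto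

lemma integrable_indicator_mult:
  fixes u :: "real \<Rightarrow> real"
  assumes "integrable mu u" "A \<in> sets borel"
  shows "integrable mu (\<lambda>y. indicator A y * u y)"
  using assms by (intro integrable_bounded_weight[where B = 1]) (auto simp: indicator_def)

lemma kernel_op_0: "kernel_op u 0 = 0"
  unfolding kernel_op_def
proof (rule integral_eq_zero_AE)
  show "AE y in mu. max 0 (0 - y) * u y = 0" using AE_mu_Ioc by eventually_elim simp
qed

lemma kernel_op_lipschitz:
  assumes u: "integrable mu u"
  shows "\<bar>kernel_op u x - kernel_op u x'\<bar> \<le> \<bar>x - x'\<bar> * (\<integral>y. \<bar>u y\<bar> \<partial>mu)"
proof -
  have "kernel_op u x - kernel_op u x' = (\<integral>y. (max 0 (x - y) - max 0 (x' - y)) * u y \<partial>mu)"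
    unfolding kernel_op_def left_diff_distrib
    by (rule Bochner_Integration.integral_diff[symmetric]; rule integrable_kernel[OF u])
  also have "\<bar>\<dots>\<bar> \<le> (\<integral>y. \<bar>(max 0 (x - y) - max 0 (x' - y)) * u y\<bar> \<partial>mu)"
    by (rule integral_abs_bound)
  also have "\<dots> \<le> (\<integral>y. \<bar>x - x'\<bar> * \<bar>u y\<bar> \<partial>mu)"
  proof (rule integral_mono)
    show "integrable mu (\<lambda>y. \<bar>(max 0 (x - y) - max 0 (x' - y)) * u y\<bar>)"
      unfolding left_diff_distrib
      by (intro integrable_abs Bochner_Integration.integrable_diff integrable_kernel[OF u])
    show "\<bar>(max 0 (x - y) - max 0 (x' - y)) * u y\<bar> \<le> \<bar>x - x'\<bar> * \<bar>u y\<bar>" for y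
      unfolding abs_mult by (intro mult_right_mono) auto
  qed (use u in auto)
  finally show ?thesis by simp
qed

lemma continuous_on_kernel_op:
  assumes "integrable mu u" shows "continuous_on A (kernel_op u)"
proof -
  have "(\<integral>y. \<bar>u y\<bar> \<partial>mu)-lipschitz_on A (kernel_op u)"
    using kernel_op_lipschitz[OF assms]
    by (intro lipschitz_onI integral_nonneg_AE) (auto simp: dist_real_def mult.commute)
  thus ?thesis by (rule lipschitz_on_continuous_on)
qed

text \<open>The chord slope consists of the whole integral up to \<open>a\<close> and of the part on
  the cell weighted by the falling hat. The same weight occurs in \<open>interpolant\<close> and
  \<open>left_part\<close>, so the summations built on it are exact at every level.\<close>

lemma kernel_op_diff:
  assumes u: "integrable mu u" and ab: "a < b"
  shows "kernel_op u b - kernel_op u a = (b - a) * ((\<integral>y. indicator {..a} y * u y \<partial>mu) +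
    (\<integral>y. indicator {a<..b} y * ((b - y) / (b - a)) * u y \<partial>mu))"
proof -
  have i: "integrable mu (\<lambda>y. indicator {a<..b} y * ((b - y) / (b - a)) * u y)"
    using ab by (intro integrable_bounded_weight[OF u, where B = 1]) (auto simp: indicator_def divide_simps)
  have "kernel_op u b - kernel_op u a = (\<integral>y. max 0 (b - y) * u y - max 0 (a - y) * u y \<partial>mu)"
    unfolding kernel_op_def
    by (rule Bochner_Integration.integral_diff[symmetric]; rule integrable_kernel[OF u])
  also have "\<dots> = (\<integral>y. (b - a) * (indicator {..a} y * u y +
      indicator {a<..b} y * ((b - y) / (b - a)) * u y) \<partial>mu)"
  proof (intro Bochner_Integration.integral_cong refl)
    fix y
    consider "y \<le> a" | "a < y" "y \<le> b" | "b < y" by linarith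
    thus "max 0 (b - y) * u y - max 0 (a - y) * u y = (b - a) * (indicator {..a} y * u y +
      indicator {a<..b} y * ((b - y) / (b - a)) * u y)"
      using ab by cases (simp_all add: left_diff_distrib[symmetric])
  qed
  also have "\<dots> = (b - a) * ((\<integral>y. indicator {..a} y * u y \<partial>mu) +
      (\<integral>y. indicator {a<..b} y * ((b - y) / (b - a)) * u y \<partial>mu))"
    using i integrable_indicator_mult[OF u, of "{..a}"] by simp
  finally show ?thesis .
qed

lemma integral_Iic_diff:
  fixes u :: "real \<Rightarrow> real"
  assumes u: "integrable mu u" and ab: "a \<le> b"
  shows "(\<integral>y. indicator {a<..b} y * u y \<partial>mu) =
    (\<integral>y. indicator {..b} y * u y \<partial>mu) - (\<integral>y. indicator {..a} y * u y \<partial>mu)"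
proof -
  have "(\<integral>y. indicator {a<..b} y * u y \<partial>mu) =
      (\<integral>y. indicator {..b} y * u y - indicator {..a} y * u y \<partial>mu)"
    using ab by (intro Bochner_Integration.integral_cong refl) (auto simp: indicator_def)
  also have "\<dots> = (\<integral>y. indicator {..b} y * u y \<partial>mu) - (\<integral>y. indicator {..a} y * u y \<partial>mu)"
    by (intro Bochner_Integration.integral_diff integrable_indicator_mult u) auto
  finally show ?thesis .
qed

lemma integral_Iic_0: "(\<integral>y. indicator {..0} y * u y \<partial>mu) = 0" for u :: "real \<Rightarrow> real"
proof (rule integral_eq_zero_AE)
  show "AE y in mu. indicator {..0} y * u y = 0" using AE_mu_Ioc by eventually_elim simp
qed

lemma integral_Iic_1:
  fixes u :: "real \<Rightarrow> real"
  assumes [measurable]: "u \<in> borel_measurable borel"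
  shows "(\<integral>y. indicator {..1} y * u y \<partial>mu) = (\<integral>y. u y \<partial>mu)"
proof (rule integral_cong_AE)
  show "AE y in mu. indicator {..1} y * u y = u y" using AE_mu_Ioc by eventually_elim simp
qed measurable

subsection \<open>The Gauss--Green formula as an integral equation\<close>

text \<open>Piecewise linear interpolation of \<open>h\<close> at the level-\<open>n\<close>
  vertices, anchored at the right end of each half-open cell. At \<open>0\<close> it is
  \<open>0\<close> whatever \<open>h\<close> is, which happens on a null set.\<close>

definition interpolant :: "nat \<Rightarrow> (real \<Rightarrow> real) \<Rightarrow> real \<Rightarrow> real" where
  "interpolant n h y = (\<Sum>k<3 ^ n. indicator {vertex n k<..vertex n (Suc k)} y *
     (h (vertex n (Suc k)) - (h (vertex n (Suc k)) - h (vertex n k)) *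
       ((vertex n (Suc k) - y) / len n k)))"

lemma interpolant_measurable [measurable]: "interpolant n h \<in> borel_measurable borel"
  unfolding interpolant_def by measurable

lemma interpolant_cell:
  assumes k: "k < 3 ^ n" and y: "vertex n k < y" "y \<le> vertex n (Suc k)"
  shows "interpolant n h y = h (vertex n (Suc k)) - (h (vertex n (Suc k)) - h (vertex n k)) *
       ((vertex n (Suc k) - y) / len n k)"
proof -
  have "indicator {vertex n i<..vertex n (Suc i)} y = (0::real)" if "i < 3 ^ n" "i \<noteq> k" for i
  proof (cases "i < k")
    case True
    thus ?thesis using vertex_le[of "Suc i" k n] k y by (auto simp: indicator_def)
  next
    case False
    thus ?thesis using vertex_le[of "Suc k" i n] that y by (auto simp: indicator_def)
  qed
  hence "interpolant n h y = (\<Sum>i\<in>{k}. indicator {vertex n i<..vertex n (Suc i)} y *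
     (h (vertex n (Suc i)) - (h (vertex n (Suc i)) - h (vertex n i)) *
       ((vertex n (Suc i) - y) / len n i)))"
    unfolding interpolant_def using k by (intro sum.mono_neutral_right) auto
  thus ?thesis using y by simp
qed

text \<open>An interpolated value is a convex combination of two nearby values of \<open>h\<close>.
  Used with \<open>a = h y\<close> for pointwise convergence and with \<open>a = 0\<close> for the
  dominating bound.\<close>

lemma interpolant_near:
  assumes y: "y \<in> {0<..1}" and h: "\<And>z. z \<in> {0..1} \<Longrightarrow> \<bar>z - y\<bar> \<le> max_resist ^ n \<Longrightarrow> \<bar>h z - a\<bar> \<le> e"
  shows "\<bar>interpolant n h y - a\<bar> \<le> e"
proof -
  obtain k where k: "k < 3 ^ n" "vertex n k < y" "y \<le> vertex n (Suc k)" using y by (rule vertex_bracket)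
  define t where "t = (vertex n (Suc k) - y) / len n k"
  have t: "0 \<le> t" "t \<le> 1" using k len_pos[OF k(1)] by (auto simp: t_def divide_simps)
  have "\<bar>h (vertex n k) - a\<bar> \<le> e" "\<bar>h (vertex n (Suc k)) - a\<bar> \<le> e"
    using k len_le[OF k(1)] vertex_in_unit[of k n] vertex_in_unit[of "Suc k" n] by (intro h; force)+
  hence "t * \<bar>h (vertex n k) - a\<bar> + (1 - t) * \<bar>h (vertex n (Suc k)) - a\<bar> \<le> t * e + (1 - t) * e"
    using t by (intro add_mono mult_left_mono) auto
  moreover have "interpolant n h y - a = t * (h (vertex n k) - a) + (1 - t) * (h (vertex n (Suc k)) - a)"
    unfolding interpolant_cell[OF k] t_def[symmetric] by (simp add: algebra_simps)
  moreover have "\<bar>t * (h (vertex n k) - a) + (1 - t) * (h (vertex n (Suc k)) - a)\<bar> \<le>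
      t * \<bar>h (vertex n k) - a\<bar> + (1 - t) * \<bar>h (vertex n (Suc k)) - a\<bar>"
    using t abs_triangle_ineq[of "t * (h (vertex n k) - a)" "(1 - t) * (h (vertex n (Suc k)) - a)"]
    by (simp add: abs_mult)
  ultimately show ?thesis by (simp add: algebra_simps)
qed

text \<open>Abel summation: the boundary terms vanish because \<open>u\<close> has mean \<open>0\<close>.\<close>

lemma energy_approx_interpolant:
  assumes u: "integrable mu u" and um: "u \<in> borel_measurable borel"
    and u0: "(\<integral>y. u y \<partial>mu) = 0"
    and f: "\<And>x. x \<in> {0..1} \<Longrightarrow> f x = f 0 + C * kernel_op u x"
  shows "energy_approx p n f h = - C * (\<integral>y. interpolant n h y * u y \<partial>mu)"
proof -
  define A where "A k = (\<integral>y. indicator {..vertex n k} y * u y \<partial>mu)" for k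
  define w where "w k y = indicator {vertex n k<..vertex n (Suc k)} y *
      ((vertex n (Suc k) - y) / len n k)" for k y
  define B where "B k = (\<integral>y. w k y * u y \<partial>mu)" for k
  have wm [measurable]: "w k \<in> borel_measurable borel" for k unfolding w_def by measurable
  have w: "\<bar>w k y\<bar> \<le> 1" if "k < 3 ^ n" for k y
    using len_pos[OF that] by (auto simp: w_def indicator_def divide_simps)
  have wi: "integrable mu (\<lambda>y. w k y * u y)" if "k < 3 ^ n" for k
    using w[OF that] by (intro integrable_bounded_weight[OF u]) auto
  have ii: "integrable mu (\<lambda>y. indicator {vertex n k<..vertex n (Suc k)} y * u y)" for k
    using u by (rule integrable_indicator_mult) simp
  let ?hb = "\<lambda>k. h (vertex n (Suc k))" and ?ha = "\<lambda>k. h (vertex n k)"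
  have "f (vertex n (Suc k)) - f (vertex n k) = len n k * (C * (A k + B k))" if k: "k < 3 ^ n" for k
  proof -
    have "kernel_op u (vertex n (Suc k)) - kernel_op u (vertex n k) = len n k * (A k + B k)"
      unfolding A_def B_def w_def using len_pos[OF k] by (intro kernel_op_diff u) simp
    moreover have "f (vertex n k) = f 0 + C * kernel_op u (vertex n k)"
      "f (vertex n (Suc k)) = f 0 + C * kernel_op u (vertex n (Suc k))"
      using k by (intro f vertex_in_unit; simp)+
    ultimately show ?thesis by (simp add: right_diff_distrib[symmetric])
  qed
  hence "energy_approx p n f h = (\<Sum>k<3 ^ n. C * (A k + B k) * (?hb k - ?ha k))"
    unfolding energy_approx_eq using len_pos by (intro sum.cong refl) (auto dest!: len_pos)
  moreover have "(\<integral>y. interpolant n h y * u y \<partial>mu) =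
      (\<Sum>k<3 ^ n. ?hb k * (A (Suc k) - A k) - (?hb k - ?ha k) * B k)"
  proof -
    have "(\<integral>y. interpolant n h y * u y \<partial>mu) = (\<integral>y. (\<Sum>k<3 ^ n. ?hb k *
        (indicator {vertex n k<..vertex n (Suc k)} y * u y) - (?hb k - ?ha k) * (w k y * u y)) \<partial>mu)"
      unfolding interpolant_def w_def sum_distrib_right
      by (intro Bochner_Integration.integral_cong refl sum.cong) (simp add: algebra_simps)
    also have "\<dots> = (\<Sum>k<3 ^ n. ?hb k * (\<integral>y. indicator {vertex n k<..vertex n (Suc k)} y * u y \<partial>mu)
        - (?hb k - ?ha k) * B k)"
      using wi ii by (subst Bochner_Integration.integral_sum) (auto simp: B_def)
    also have "\<dots> = (\<Sum>k<3 ^ n. ?hb k * (A (Suc k) - A k) - (?hb k - ?ha k) * B k)"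
      using len_pos by (intro sum.cong refl) (auto dest!: len_pos simp: A_def integral_Iic_diff[OF u])
    finally show ?thesis .
  qed
  ultimately have "energy_approx p n f h + C * (\<integral>y. interpolant n h y * u y \<partial>mu) =
      C * (\<Sum>k<3 ^ n. (A k + B k) * (?hb k - ?ha k) + (?hb k * (A (Suc k) - A k) - (?hb k - ?ha k) * B k))"
    unfolding sum.distrib by (simp only: mult.assoc sum_distrib_left[symmetric] distrib_left[symmetric])
  also have "(\<Sum>k<3 ^ n. (A k + B k) * (?hb k - ?ha k) + (?hb k * (A (Suc k) - A k) - (?hb k - ?ha k) * B k))
      = (\<Sum>k<3 ^ n. ?hb k * A (Suc k) - ?ha k * A k)"
    by (intro sum.cong refl) (simp add: algebra_simps)
  also have "\<dots> = h (vertex n (3 ^ n)) * A (3 ^ n) - h (vertex n 0) * A 0"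
    by (rule sum_lessThan_telescope[of "\<lambda>k. h (vertex n k) * A k"])
  also have "\<dots> = 0" using u0 integral_Iic_1[OF um] by (simp add: A_def integral_Iic_0)
  finally show ?thesis by simp
qed

lemma energy_approx_tendsto:
  assumes u: "integrable mu u" and um: "u \<in> borel_measurable borel"
    and u0: "(\<integral>y. u y \<partial>mu) = 0"
    and f: "\<And>x. x \<in> {0..1} \<Longrightarrow> f x = f 0 + C * kernel_op u x"
    and h: "continuous_on {0..1} h" "h \<in> borel_measurable borel"
  shows "(\<lambda>n. energy_approx p n f h) \<longlonglongrightarrow> - C * (\<integral>y. h y * u y \<partial>mu)"
proof -
  note [measurable] = um h(2)
  obtain B where B: "\<And>x. x \<in> {0..1} \<Longrightarrow> \<bar>h x\<bar> \<le> B"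
    using compact_continuous_image[OF h(1) compact_Icc, THEN compact_imp_bounded]
    unfolding bounded_iff by (metis imageI real_norm_def)
  have "(\<lambda>n. \<integral>y. interpolant n h y * u y \<partial>mu) \<longlonglongrightarrow> (\<integral>y. h y * u y \<partial>mu)"
  proof (rule integral_dominated_convergence[where w = "\<lambda>y. B * \<bar>u y\<bar>"])
    show "integrable mu (\<lambda>y. B * \<bar>u y\<bar>)" using u by auto
    show "AE y in mu. (\<lambda>n. interpolant n h y * u y) \<longlonglongrightarrow> h y * u y"
      using AE_mu_Ioc
    proof eventually_elim
      case (elim y)
      have "(\<lambda>n. interpolant n h y) \<longlonglongrightarrow> h y"
      proof (rule LIMSEQ_I)
        fix e :: real assume "0 < e"
        then obtain d where d: "0 < d" "\<And>z. z \<in> {0..1} \<Longrightarrow> \<bar>z - y\<bar> < d \<Longrightarrow> \<bar>h z - h y\<bar> < e / 2"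
          using h(1) elim unfolding continuous_on_iff dist_real_def
          by (metis atLeastAtMost_iff greaterThanAtMost_iff half_gt_zero less_imp_le)
        obtain N where N: "\<forall>n\<ge>N. max_resist ^ n < d" using max_resist_power_small[OF d(1)] by auto
        have "norm (interpolant n h y - h y) < e" if "n \<ge> N" for n
        proof -
          have "\<bar>interpolant n h y - h y\<bar> \<le> e / 2"
            using N that d(2) by (intro interpolant_near[OF elim]) (force intro: less_imp_le)
          thus ?thesis using \<open>0 < e\<close> by simp
        qed
        thus "\<exists>N. \<forall>n\<ge>N. norm (interpolant n h y - h y) < e" by blast
      qed
      thus ?case by (intro tendsto_intros)
    qed
    show "AE y in mu. norm (interpolant n h y * u y) \<le> B * \<bar>u y\<bar>" for n
      using AE_mu_Ioc
    proof eventually_elim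
      case (elim y)
      have "\<bar>interpolant n h y - 0\<bar> \<le> B" using B by (intro interpolant_near[OF elim]) auto
      thus ?case by (auto simp: abs_mult intro: mult_right_mono)
    qed
  qed measurable
  hence "(\<lambda>n. - C * (\<integral>y. interpolant n h y * u y \<partial>mu)) \<longlonglongrightarrow> - C * (\<integral>y. h y * u y \<partial>mu)"
    by (intro tendsto_intros)
  thus ?thesis using energy_approx_interpolant[OF u um u0 f] by simp
qed

lemma borel_measurable_unit_extension:
  fixes f :: "real \<Rightarrow> real"
  assumes "continuous_on {0..1} f" "\<forall>x. x \<notin> {0..1} \<longrightarrow> f x = 0"
  shows "f \<in> borel_measurable borel"
proof -
  have "(\<lambda>x. indicator {0..1} x *\<^sub>R f x) \<in> borel_measurable borel"
    by (rule borel_measurable_continuous_on_indicator[OF _ assms(1)]) simp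
  moreover have "(\<lambda>x. indicator {0..1} x *\<^sub>R f x) = f"
    using assms(2) by (auto simp: indicator_def fun_eq_iff)
  ultimately show ?thesis by simp
qed

lemma energy_domain_measurable: "f \<in> energy_domain p \<Longrightarrow> f \<in> borel_measurable borel"
  by (intro borel_measurable_unit_extension) (simp_all add: energy_domain_def)

text \<open>The kernel of \<open>kernel_op\<close>, cut off to the unit interval to fit the form
  domain. It is linear on all cells as soon as \<open>x\<close> is a vertex, so its energy pairing
  stabilises and evaluates \<open>f\<close> at \<open>x\<close>.\<close>

definition ramp :: "real \<Rightarrow> real \<Rightarrow> real" where
  "ramp x y = indicator {0..1} y * max 0 (x - y)"

lemma energy_ramp:
  assumes k: "k \<le> 3 ^ n"
  shows "energy_approx p n f (ramp (vertex n k)) = - (f (vertex n k) - f 0)"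
proof -
  let ?x = "vertex n k"
  have "energy_approx p n f (ramp ?x) = (\<Sum>i<3 ^ n. if i < k then - (f (vertex n (Suc i)) - f (vertex n i)) else 0)"
    unfolding energy_approx_eq
  proof (intro sum.cong refl)
    fix i assume "i \<in> {..<(3::nat) ^ n}"
    hence i: "i < 3 ^ n" by simp
    have u: "vertex n i \<in> {0..1}" "vertex n (Suc i) \<in> {0..1}" using i by (intro vertex_in_unit; simp)+
    have "ramp ?x (vertex n (Suc i)) - ramp ?x (vertex n i) = (if i < k then - len n i else 0)"
      using u vertex_le[of "Suc i" k n] vertex_le[of k i n] len_pos[OF i] i k
      by (auto simp: ramp_def)
    thus "(f (vertex n (Suc i)) - f (vertex n i)) * (ramp ?x (vertex n (Suc i)) - ramp ?x (vertex n i)) / len n i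
       = (if i < k then - (f (vertex n (Suc i)) - f (vertex n i)) else 0)"
    proof -
      have "X * (- L) / L = - X" if "0 < L" for X L :: real using that by simp
      from this[OF len_pos[OF i]] show ?thesis
        unfolding \<open>ramp ?x (vertex n (Suc i)) - _ = _\<close> by simp
    qed
  qed
  also have "\<dots> = (\<Sum>i<k. - (f (vertex n (Suc i)) - f (vertex n i)))"
    using k by (subst sum.inter_filter[symmetric]) (auto intro!: sum.cong)
  also have "\<dots> = - (f ?x - f 0)"
    unfolding sum_negf using sum_lessThan_telescope[of "\<lambda>k. f (vertex n k)" k] by simp
  finally show ?thesis .
qed

lemma energy_ramp_eventually:
  assumes x: "x \<in> V p n"
  shows "(\<lambda>n. energy_approx p n f (ramp x)) \<longlonglongrightarrow> - (f x - f 0)"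
proof (rule tendsto_eventually)
  have "energy_approx p n' f (ramp x) = - (f x - f 0)" if "n' \<ge> n" for n'
    using V_mono[OF that] x energy_ramp[of _ n' f] by (auto simp: V_eq)
  thus "eventually (\<lambda>n. energy_approx p n f (ramp x) = - (f x - f 0)) sequentially"
    by (auto simp: eventually_sequentially)
qed

lemma ramp_in_domain:
  assumes "x \<in> V p n" shows "ramp x \<in> energy_domain p"
proof -
  have "continuous_on {0..1} (\<lambda>y. max 0 (x - y))" by (intro continuous_intros)
  hence "continuous_on {0..1} (ramp x)"
    by (rule continuous_on_eq) (simp add: ramp_def)
  thus ?thesis using energy_ramp_eventually[OF assms, of "ramp x"]
    by (auto simp: energy_domain_def convergent_def ramp_def)
qed

lemma unit_indicator_in_domain: "indicator {0..1} \<in> energy_domain p"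
  and energy_unit_indicator: "energy p f (indicator {0..1}) = 0"
proof -
  have z: "energy_approx p n f (indicator {0..1}) = 0" for f n
    unfolding energy_approx_eq
  proof (rule sum.neutral, safe)
    fix i :: nat assume "i < 3 ^ n"
    hence "vertex n i \<in> {0..1}" "vertex n (Suc i) \<in> {0..1}" by (intro vertex_in_unit; simp)+
    thus "(f (vertex n (Suc i)) - f (vertex n i)) *
      (indicator {0..1} (vertex n (Suc i)) - indicator {0..1} (vertex n i)) / len n i = 0" by simp
  qed
  thus "energy p f (indicator {0..1}) = 0" unfolding energy_def by (simp add: limI)
  have "continuous_on {0..1} (indicator {0..1} :: real \<Rightarrow> real)"
    by (rule continuous_on_eq[OF continuous_on_const[of _ 1]]) simp
  thus "indicator {0..1} \<in> energy_domain p" using z by (simp add: energy_domain_def convergent_const)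
qed

lemma integrable_of_square:
  fixes u :: "real \<Rightarrow> real"
  assumes [measurable]: "u \<in> borel_measurable borel" and "integrable mu (\<lambda>x. (u x)\<^sup>2)"
  shows "integrable mu u"
  by (rule mu.square_integrable_imp_integrable) (use assms in auto)

lemma integral_ramp:
  assumes [measurable]: "u \<in> borel_measurable borel"
  shows "(\<integral>y. ramp x y * u y \<partial>mu) = kernel_op u x"
  unfolding kernel_op_def
proof (rule integral_cong_AE)
  show "AE y in mu. ramp x y * u y = max 0 (x - y) * u y"
    using AE_mu_unit by eventually_elim (simp add: ramp_def)
qed (unfold ramp_def, measurable)

text \<open>From left to right, the constant test function gives the mean-zero condition and the
  ramps give the integral equation at the vertices; continuity and the shrinking cells extend it to
  the interval. Conversely, the limit of the approximate energies both puts \<open>f\<close> into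
  the domain (test function \<open>f\<close>) and is the formula itself.\<close>

theorem gauss_green_iff:
  assumes C: "0 < C"
  shows "gauss_green p C f u \<longleftrightarrow> continuous_on {0..1} f \<and> (\<forall>x. x \<notin> {0..1} \<longrightarrow> f x = 0) \<and>
     u \<in> borel_measurable borel \<and> integrable mu (\<lambda>x. (u x)\<^sup>2) \<and> (\<integral>y. u y \<partial>mu) = 0 \<and>
     (\<forall>x\<in>{0..1}. f x = f 0 + C * kernel_op u x)" (is "_ \<longleftrightarrow> ?R")
proof
  assume gg: "gauss_green p C f u"
  hence um [measurable]: "u \<in> borel_measurable borel" and u2: "integrable mu (\<lambda>x. (u x)\<^sup>2)"
    and fd: "f \<in> energy_domain p"
    and test: "\<And>h. h \<in> energy_domain p \<Longrightarrow> energy p f h = - C * (\<integral>x. h x * u x \<partial>mu)"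
    by (auto simp: gauss_green_def)
  have u: "integrable mu u" using um u2 by (rule integrable_of_square)
  have "(\<integral>x. indicator {0..1} x * u x \<partial>mu) = (\<integral>x. u x \<partial>mu)"
  proof (rule integral_cong_AE)
    show "AE x in mu. indicator {0..1} x * u x = u x" using AE_mu_unit by eventually_elim simp
  qed measurable
  hence u0: "(\<integral>x. u x \<partial>mu) = 0"
    using test[OF unit_indicator_in_domain] energy_unit_indicator C by simp
  have vert: "f x = f 0 + C * kernel_op u x" if "x \<in> V p n" for x n
  proof -
    have "energy p f (ramp x) = - (f x - f 0)"
      unfolding energy_def by (rule limI[OF energy_ramp_eventually[OF that]])
    thus ?thesis using test[OF ramp_in_domain[OF that]] integral_ramp[OF um, of x] by simp
  qed
  have cont: "continuous_on {0..1} f" and out: "\<forall>x. x \<notin> {0..1} \<longrightarrow> f x = 0"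
    using fd by (auto simp: energy_domain_def)
  define g where "g x = f x - (f 0 + C * kernel_op u x)" for x
  have gc: "continuous_on {0..1} g" unfolding g_def
    by (intro continuous_intros cont continuous_on_kernel_op u)
  have "g x = 0" if x: "x \<in> {0..1}" for x
  proof (rule ccontr)
    assume "g x \<noteq> 0"
    moreover have "g 0 = 0" by (simp add: g_def kernel_op_0)
    ultimately have "x \<noteq> 0" by metis
    hence x': "x \<in> {0<..1}" using x by auto
    have "0 < \<bar>g x\<bar>" using \<open>g x \<noteq> 0\<close> by simp
    then obtain d where d: "0 < d" "\<And>z. z \<in> {0..1} \<Longrightarrow> \<bar>z - x\<bar> < d \<Longrightarrow> \<bar>g z - g x\<bar> < \<bar>g x\<bar>"
      using gc x unfolding continuous_on_iff dist_real_def by metis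
    obtain N where N: "\<forall>n\<ge>N. max_resist ^ n < d" using max_resist_power_small[OF d(1)] by auto
    obtain k where k: "k < 3 ^ N" "vertex N k < x" "x \<le> vertex N (Suc k)"
      using x' by (rule vertex_bracket)
    have "\<bar>vertex N k - x\<bar> < d" using k len_le[OF k(1)] N by force
    hence "\<bar>g (vertex N k) - g x\<bar> < \<bar>g x\<bar>" using d(2) vertex_in_unit[of k N] k(1) by simp
    moreover have "vertex N k \<in> V p N" using k(1) by (simp add: V_eq)
    from vert[OF this] have "g (vertex N k) = 0" unfolding g_def by linarith
    ultimately show False by simp
  qed
  hence "\<forall>x\<in>{0..1}. f x = f 0 + C * kernel_op u x" unfolding g_def by (metis right_minus_eq)
  thus ?R using cont out um u2 u0 by blast
next
  assume R: ?R
  hence um: "u \<in> borel_measurable borel" and u2: "integrable mu (\<lambda>x. (u x)\<^sup>2)"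
    and u0: "(\<integral>x. u x \<partial>mu) = 0" and f: "\<And>x. x \<in> {0..1} \<Longrightarrow> f x = f 0 + C * kernel_op u x"
    and cont: "continuous_on {0..1} f" and out: "\<forall>x. x \<notin> {0..1} \<longrightarrow> f x = 0" by blast+
  have u: "integrable mu u" using um u2 by (rule integrable_of_square)
  have lim: "(\<lambda>n. energy_approx p n f h) \<longlonglongrightarrow> - C * (\<integral>y. h y * u y \<partial>mu)"
    if "continuous_on {0..1} h" "h \<in> borel_measurable borel" for h
    using u um u0 f that by (rule energy_approx_tendsto)
  have fm: "f \<in> borel_measurable borel" using cont out by (rule borel_measurable_unit_extension)
  hence "f \<in> energy_domain p" using cont out lim[OF cont fm] by (auto simp: energy_domain_def convergent_def)
  moreover have "energy p f h = - C * (\<integral>x. h x * u x \<partial>mu)" if h: "h \<in> energy_domain p" for h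
    unfolding energy_def using h energy_domain_measurable[OF h]
    by (intro limI lim) (auto simp: energy_domain_def)
  ultimately show "gauss_green p C f u" using um u2 by (auto simp: gauss_green_def)
qed

end

section \<open>The limit of the rescaled walk generators and the Gauss--Green constant\<close>

lemma LIMSEQ_scaled_le:
  fixes f :: "nat \<Rightarrow> real"
  assumes C: "0 < C" and "\<And>e. 0 < e \<Longrightarrow> \<exists>N. \<forall>n\<ge>N. \<bar>f n - L\<bar> \<le> C * e"
  shows "f \<longlonglongrightarrow> L"
proof (rule LIMSEQ_I)
  fix e :: real assume "0 < e"
  hence "0 < e / (2 * C)" using C by simp
  then obtain N where N: "\<forall>n\<ge>N. \<bar>f n - L\<bar> \<le> C * (e / (2 * C))" using assms(2) by blast
  have "C * (e / (2 * C)) = e / 2" using C by simp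
  hence "norm (f n - L) < e" if "n \<ge> N" for n
    using N[rule_format, OF that] \<open>0 < e\<close> unfolding real_norm_def by linarith
  thus "\<exists>N. \<forall>n\<ge>N. norm (f n - L) < e" by blast
qed

context self_similar_interval
begin

text \<open>The mean \<open>1 / 2\<close> of \<open>mu\<close>, transported to the cell: the hats at
  its two ends receive equal mass.\<close>

lemma cell_moment:
  assumes k: "k < 3 ^ n"
  shows "(\<integral>y. indicator {vertex n k<..vertex n (Suc k)} y * ((vertex n (Suc k) - y) / len n k) \<partial>mu) = mass n k / 2"
    and "(\<integral>y. indicator {vertex n k<..vertex n (Suc k)} y * ((y - vertex n k) / len n k) \<partial>mu) = mass n k / 2"
proof -
  have int: "integrable mu (\<lambda>t. t)" by (rule integrable_bounded[where B = 1]) auto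
  have L: "len n k \<noteq> 0" using len_pos[OF k] by simp
  have "(\<integral>t. indicator {0<..1} t * (1 - t) \<partial>mu) = (\<integral>t. 1 - t \<partial>mu)"
    by (rule integral_unit_indicator) measurable
  also have "\<dots> = 1 / 2" using int mu_mean by simp
  finally have 1: "(\<integral>t. indicator {0<..1} t * (1 - t) \<partial>mu) = 1 / 2" .
  have 2: "(\<integral>t. indicator {0<..1} t * t \<partial>mu) = 1 / 2"
    using integral_unit_indicator[of "\<lambda>t. t"] mu_mean by simp
  have e1: "(vertex n (Suc k) - (vertex n k + len n k * t)) / len n k = 1 - t" for t
    using L by (simp add: field_simps)
  have e2: "(vertex n k + len n k * t - vertex n k) / len n k = t" for t
    using L by simp
  show "(\<integral>y. indicator {vertex n k<..vertex n (Suc k)} y * ((vertex n (Suc k) - y) / len n k) \<partial>mu) = mass n k / 2"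
    by (subst cell_integral[OF k]) (simp_all only: e1 1, measurable)
  show "(\<integral>y. indicator {vertex n k<..vertex n (Suc k)} y * ((y - vertex n k) / len n k) \<partial>mu) = mass n k / 2"
    by (subst cell_integral[OF k]) (simp_all only: e2 2, measurable)
qed

text \<open>The share of the cell integral that belongs to the hat at the left vertex;
  \<open>right_part\<close> is the complementary share.\<close>

definition left_part :: "(real \<Rightarrow> real) \<Rightarrow> nat \<Rightarrow> nat \<Rightarrow> real" where
  "left_part u n k = (\<integral>y. indicator {vertex n k<..vertex n (Suc k)} y * ((vertex n (Suc k) - y) / len n k) * u y \<partial>mu)"

definition right_part :: "(real \<Rightarrow> real) \<Rightarrow> nat \<Rightarrow> nat \<Rightarrow> real" where
  "right_part u n k = (\<integral>y. indicator {vertex n k<..vertex n (Suc k)} y * ((y - vertex n k) / len n k) * u y \<partial>mu)"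

lemma weighted_cell_near:
  assumes k: "k < 3 ^ n" and u: "integrable mu u" and w [measurable]: "w \<in> borel_measurable borel"
    and w01: "\<And>y. vertex n k < y \<Longrightarrow> y \<le> vertex n (Suc k) \<Longrightarrow> 0 \<le> w y \<and> w y \<le> 1"
    and wint: "(\<integral>y. indicator {vertex n k<..vertex n (Suc k)} y * w y \<partial>mu) = mass n k / 2"
    and near: "\<And>y. vertex n k < y \<Longrightarrow> y \<le> vertex n (Suc k) \<Longrightarrow> \<bar>u y - a\<bar> \<le> e"
  shows "\<bar>(\<integral>y. indicator {vertex n k<..vertex n (Suc k)} y * w y * u y \<partial>mu) - a * mass n k / 2\<bar> \<le> e * mass n k"
proof -
  let ?I = "indicator {vertex n k<..vertex n (Suc k)} :: real \<Rightarrow> real"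
  have e: "0 \<le> e" using near[of "vertex n (Suc k)"] len_pos[OF k] by force
  have b: "\<bar>?I y * w y\<bar> \<le> 1" for y using w01[of y] by (auto simp: indicator_def)
  have i1: "integrable mu (\<lambda>y. ?I y * w y * u y)"
    using b by (intro integrable_bounded_weight[OF u, where B = 1]) auto
  have i2: "integrable mu (\<lambda>y. ?I y * w y)" using b by (intro integrable_bounded[where B = 1]) auto
  have eq: "(\<integral>y. ?I y * w y * u y \<partial>mu) - a * mass n k / 2 = (\<integral>y. ?I y * w y * u y - a * (?I y * w y) \<partial>mu)"
    unfolding Bochner_Integration.integral_diff[OF i1 integrable_mult_right[OF i2]]
      integral_mult_right_zero wint by simp
  have "\<bar>\<integral>y. ?I y * w y * u y - a * (?I y * w y) \<partial>mu\<bar> \<le> (\<integral>y. \<bar>?I y * w y * u y - a * (?I y * w y)\<bar> \<partial>mu)"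
    by (rule integral_abs_bound)
  also have "\<dots> \<le> (\<integral>y. e * ?I y \<partial>mu)"
  proof (rule integral_mono)
    show "integrable mu (\<lambda>y. \<bar>?I y * w y * u y - a * (?I y * w y)\<bar>)"
      by (rule integrable_abs[OF Bochner_Integration.integrable_diff[OF i1 integrable_mult_right[OF i2]]])
    show "integrable mu (\<lambda>y. e * ?I y)"
      using e by (intro integrable_bounded[where B = e]) (auto simp: indicator_def)
    fix y
    show "\<bar>?I y * w y * u y - a * (?I y * w y)\<bar> \<le> e * ?I y"
    proof (cases "vertex n k < y \<and> y \<le> vertex n (Suc k)")
      case True
      have "\<bar>w y * (u y - a)\<bar> \<le> 1 * e"
        unfolding abs_mult using w01[of y] near[of y] True by (intro mult_mono) auto
      thus ?thesis using True by (simp add: algebra_simps)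
    qed (auto simp: indicator_def)
  qed
  also have "\<dots> = e * mass n k" using cell_mass[OF k] by simp
  finally show ?thesis unfolding eq .
qed

lemma parts_near:
  assumes k: "k < 3 ^ n" and u: "integrable mu u"
    and near: "\<And>y. vertex n k < y \<Longrightarrow> y \<le> vertex n (Suc k) \<Longrightarrow> \<bar>u y - a\<bar> \<le> e"
  shows "\<bar>left_part u n k - a * mass n k / 2\<bar> \<le> e * mass n k"
    and "\<bar>right_part u n k - a * mass n k / 2\<bar> \<le> e * mass n k"
proof -
  have L: "0 < len n k" by (rule len_pos[OF k])
  show "\<bar>left_part u n k - a * mass n k / 2\<bar> \<le> e * mass n k"
    unfolding left_part_def
    by (rule weighted_cell_near[OF k u _ _ cell_moment(1)[OF k] near]) (use L in auto)
  show "\<bar>right_part u n k - a * mass n k / 2\<bar> \<le> e * mass n k"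
    unfolding right_part_def
    by (rule weighted_cell_near[OF k u _ _ cell_moment(2)[OF k] near]) (use L in auto)
qed

lemma parts_sum:
  assumes k: "k < 3 ^ n" and u: "integrable mu u"
  shows "left_part u n k + right_part u n k =
    (\<integral>y. indicator {..vertex n (Suc k)} y * u y \<partial>mu) - (\<integral>y. indicator {..vertex n k} y * u y \<partial>mu)"
proof -
  let ?I = "indicator {vertex n k<..vertex n (Suc k)} :: real \<Rightarrow> real"
  have L: "0 < len n k" by (rule len_pos[OF k])
  have i: "integrable mu (\<lambda>y. ?I y * ((vertex n (Suc k) - y) / len n k) * u y)"
      "integrable mu (\<lambda>y. ?I y * ((y - vertex n k) / len n k) * u y)"
    using L by (intro integrable_bounded_weight[OF u, where B = 1]; auto simp: indicator_def divide_simps)+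
  have "left_part u n k + right_part u n k =
      (\<integral>y. ?I y * ((vertex n (Suc k) - y) / len n k) * u y + ?I y * ((y - vertex n k) / len n k) * u y \<partial>mu)"
    unfolding left_part_def right_part_def using i by simp
  also have "\<dots> = (\<integral>y. ?I y * u y \<partial>mu)"
  proof (intro Bochner_Integration.integral_cong refl)
    fix y
    have "(vertex n (Suc k) - y) / len n k + (y - vertex n k) / len n k = 1"
      using L by (simp add: add_divide_distrib[symmetric])
    thus "?I y * ((vertex n (Suc k) - y) / len n k) * u y + ?I y * ((y - vertex n k) / len n k) * u y = ?I y * u y"
      by (metis distrib_left distrib_right mult.right_neutral)
  qed
  also have "\<dots> = (\<integral>y. indicator {..vertex n (Suc k)} y * u y \<partial>mu) - (\<integral>y. indicator {..vertex n k} y * u y \<partial>mu)"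
    using L by (intro integral_Iic_diff u) simp
  finally show ?thesis .
qed

lemma kernel_op_cell_diff:
  assumes k: "k < 3 ^ n" and u: "integrable mu u"
  shows "c ^ n * mass n k * (kernel_op u (vertex n (Suc k)) - kernel_op u (vertex n k)) =
    (\<integral>y. indicator {..vertex n k} y * u y \<partial>mu) + left_part u n k"
proof -
  have "kernel_op u (vertex n (Suc k)) - kernel_op u (vertex n k) =
      len n k * ((\<integral>y. indicator {..vertex n k} y * u y \<partial>mu) + left_part u n k)"
    unfolding left_part_def using len_pos[OF k] by (intro kernel_op_diff u) simp
  thus ?thesis using len_pos[OF k] scaling_pos by (simp add: mass_def)
qed

lemma left_nbr_vertex:
  assumes "k < 3 ^ n" shows "left_nbr p n (vertex n (Suc k)) = vertex n k"
  unfolding left_nbr_def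
proof (rule Max_eqI)
  show "finite {y \<in> V p n. y < vertex n (Suc k)}" by (simp add: V_eq)
  show "vertex n k \<in> {y \<in> V p n. y < vertex n (Suc k)}"
    using assms len_pos[OF assms] by (auto simp: V_eq)
  fix y assume "y \<in> {y \<in> V p n. y < vertex n (Suc k)}"
  then obtain i where "i \<le> 3 ^ n" "y = vertex n i" "vertex n i < vertex n (Suc k)" by (auto simp: V_eq)
  thus "y \<le> vertex n k" using vertex_less_iff[of i n "Suc k"] vertex_le[of i k n] assms by auto
qed

lemma right_nbr_vertex:
  assumes "k < 3 ^ n" shows "right_nbr p n (vertex n k) = vertex n (Suc k)"
  unfolding right_nbr_def
proof (rule Min_eqI)
  show "finite {y \<in> V p n. vertex n k < y}" by (simp add: V_eq)
  show "vertex n (Suc k) \<in> {y \<in> V p n. vertex n k < y}"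
    using assms len_pos[OF assms] by (auto simp: V_eq)
  fix y assume "y \<in> {y \<in> V p n. vertex n k < y}"
  then obtain i where "i \<le> 3 ^ n" "y = vertex n i" "vertex n k < vertex n i" by (auto simp: V_eq)
  thus "vertex n (Suc k) \<le> y" using vertex_less_iff[of k n i] vertex_le[of "Suc k" i n] assms by auto
qed

text \<open>Mass is inverse length up to \<open>c ^ n\<close>, so jump probabilities proportional to
  mass turn the generator into a difference of adjacent chord slopes of \<open>f\<close>. This
  difference is \<open>C\<close> times the integral of \<open>u\<close> against the hat at
  \<open>x\<close>, divided by the mass of both cells. The hat carries half of that mass, whence
  \<open>C / 2\<close>. At an end point one slope is missing, and the mean-zero condition makes it
  \<open>0\<close>.\<close>

lemma walk_generator_near:
  assumes C: "0 < C" and gg: "gauss_green p C f u" and x: "x \<in> V p n"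
    and near: "\<And>y. y \<in> {0..1} \<Longrightarrow> \<bar>y - x\<bar> \<le> max_resist ^ n \<Longrightarrow> \<bar>u y - u x\<bar> \<le> e"
  shows "\<bar>c ^ n * walk_generator p n f x - C / 2 * u x\<bar> \<le> C * e"
proof -
  from gg have um: "u \<in> borel_measurable borel" and u2: "integrable mu (\<lambda>x. (u x)\<^sup>2)"
    and u0: "(\<integral>y. u y \<partial>mu) = 0" and f: "\<And>x. x \<in> {0..1} \<Longrightarrow> f x = f 0 + C * kernel_op u x"
    unfolding gauss_green_iff[OF C] by blast+
  have u: "integrable mu u" using um u2 by (rule integrable_of_square)
  define A where "A k = (\<integral>y. indicator {..vertex n k} y * u y \<partial>mu)" for k
  have A0: "A 0 = 0" by (simp add: A_def integral_Iic_0)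
  have A1: "A (3 ^ n) = 0" using integral_Iic_1[OF um] u0 by (simp add: A_def)
  have diff: "c ^ n * mass n k * (f (vertex n (Suc k)) - f (vertex n k)) = C * (A k + left_part u n k)"
    if k: "k < 3 ^ n" for k
  proof -
    have "f (vertex n k) = f 0 + C * kernel_op u (vertex n k)"
      "f (vertex n (Suc k)) = f 0 + C * kernel_op u (vertex n (Suc k))"
      using k by (intro f vertex_in_unit; simp)+
    thus ?thesis using kernel_op_cell_diff[OF k u] by (simp add: A_def algebra_simps)
  qed
  have sum: "left_part u n k + right_part u n k = A (Suc k) - A k" if "k < 3 ^ n" for k
    using parts_sum[OF that u] by (simp add: A_def)
  obtain i where i: "i \<le> 3 ^ n" "x = vertex n i" using x by (auto simp: V_eq)
  have nearL: "\<bar>left_part u n i - u x * mass n i / 2\<bar> \<le> e * mass n i" if "i < 3 ^ n"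
  proof (rule parts_near[OF that u])
    fix y assume "vertex n i < y" "y \<le> vertex n (Suc i)"
    thus "\<bar>u y - u x\<bar> \<le> e"
      using len_le[OF that] vertex_in_unit[of i n] vertex_in_unit[of "Suc i" n] that i
      by (intro near) auto
  qed
  have nearR: "\<bar>right_part u n k - u x * mass n k / 2\<bar> \<le> e * mass n k" if "i = Suc k" for k
  proof -
    have k: "k < 3 ^ n" using that i by simp
    show ?thesis
    proof (rule parts_near[OF k u])
      fix y assume "vertex n k < y" "y \<le> vertex n (Suc k)"
      thus "\<bar>u y - u x\<bar> \<le> e"
        using len_le[OF k] vertex_in_unit[of k n] vertex_in_unit[of "Suc k" n] that i
        by (intro near) auto
    qed
  qed
  have scale: "\<bar>C * L / M - C / 2 * u x\<bar> \<le> C * e" if "0 < M" "\<bar>L - u x * M / 2\<bar> \<le> e * M" for L M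
  proof -
    have "C * L / M - C / 2 * u x = C * ((L - u x * M / 2) / M)" using that by (simp add: field_simps)
    also have "\<bar>\<dots>\<bar> \<le> C * e" unfolding abs_mult abs_divide
      using that C by (intro mult_mono) (auto simp: divide_simps)
    finally show ?thesis .
  qed
  have solve: "s * D = z / M" if "s * M * D = z" "0 < M" for s D z M :: real
    using that by (simp add: field_simps)
  consider "i = 0" | "i = 3 ^ n" "i \<noteq> 0" | k where "i = Suc k" "Suc k < 3 ^ n"
    using i(1) by (cases i) (auto simp: le_less)
  thus ?thesis
  proof cases
    case 1
    have 0: "(0::nat) < 3 ^ n" by simp
    have "walk_generator p n f x = f (vertex n (Suc 0)) - f (vertex n 0)"
      using right_nbr_vertex[OF 0] 1 i by (simp add: walk_generator_def Let_def)
    hence "c ^ n * walk_generator p n f x = C * left_part u n 0 / mass n 0"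
      using solve[OF diff[OF 0] mass_pos[OF 0]] A0 by simp
    thus ?thesis using scale[OF mass_pos[OF 0], of "left_part u n 0"] nearL 1 by simp
  next
    case 2
    obtain k where k: "i = Suc k" using 2(2) by (meson not0_implies_Suc)
    hence k': "k < 3 ^ n" using 2 by simp
    have cd: "s * (a - b) = - (s * (b - a))" for s a b :: real by (simp add: algebra_simps)
    have "walk_generator p n f x = f (vertex n k) - f (vertex n (Suc k))"
      using left_nbr_vertex[OF k'] 2 i k by (simp add: walk_generator_def Let_def)
    moreover have "A k + left_part u n k = - right_part u n k"
      using sum[OF k'] A1 2 k by simp
    moreover have "c ^ n * (f (vertex n (Suc k)) - f (vertex n k)) = C * (A k + left_part u n k) / mass n k"
      by (rule solve[OF diff[OF k'] mass_pos[OF k']])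
    ultimately have "c ^ n * walk_generator p n f x = C * right_part u n k / mass n k"
      using cd[of "c ^ n" "f (vertex n k)" "f (vertex n (Suc k))"] by simp
    thus ?thesis using scale[OF mass_pos[OF k'], of "right_part u n k"] nearR[OF k] by simp
  next
    case 3
    have k: "k < 3 ^ n" using 3 by simp
    let ?l = "mass n k" and ?r = "mass n (Suc k)"
    have pos: "0 < ?l" "0 < ?r" using mass_pos k 3 by auto
    have x01: "x \<noteq> 0" "x \<noteq> 1"
      using vertex_less[of 0 i n] vertex_less[of i "3 ^ n" n] 3 i by auto
    have W: "walk_generator p n f x = ?l / (?l + ?r) * f (vertex n k) +
        ?r / (?l + ?r) * f (vertex n (Suc (Suc k))) - f (vertex n (Suc k))"
      using left_nbr_vertex[OF k] right_nbr_vertex[OF 3(2)] 3 i x01 cell_mass_Icc[OF k] cell_mass_Icc[OF 3(2)]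
      by (simp add: walk_generator_def Let_def)
    have "walk_generator p n f x = (?r * (f (vertex n (Suc (Suc k))) - f (vertex n (Suc k))) -
        ?l * (f (vertex n (Suc k)) - f (vertex n k))) / (?l + ?r)"
    proof -
      have *: "l / w * a + s / w * b - z = (s * (b - z) - l * (z - a)) / w"
        if "w \<noteq> 0" "w = l + s" for l s a b z w :: real
      proof -
        have "w * z = l * z + s * z" unfolding that(2) by (rule distrib_right)
        thus ?thesis using that(1) by (simp add: field_simps)
      qed
      show ?thesis unfolding W by (rule *) (use pos in simp_all)
    qed
    hence "c ^ n * walk_generator p n f x = (c ^ n * ?r * (f (vertex n (Suc (Suc k))) - f (vertex n (Suc k))) -
        c ^ n * ?l * (f (vertex n (Suc k)) - f (vertex n k))) / (?l + ?r)"
      by (simp add: algebra_simps)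
    also have "\<dots> = (C * (A (Suc k) + left_part u n (Suc k)) - C * (A k + left_part u n k)) / (?l + ?r)"
      unfolding diff[OF k] diff[OF 3(2)] ..
    also have "\<dots> = C * (right_part u n k + left_part u n (Suc k)) / (?l + ?r)"
    proof -
      have "A (Suc k) = A k + left_part u n k + right_part u n k" using sum[OF k] by simp
      thus ?thesis by (simp add: algebra_simps)
    qed
    finally have eq: "c ^ n * walk_generator p n f x = C * (right_part u n k + left_part u n (Suc k)) / (?l + ?r)" .
    have "\<bar>right_part u n k + left_part u n (Suc k) - u x * (?l + ?r) / 2\<bar> \<le>
        \<bar>right_part u n k - u x * ?l / 2\<bar> + \<bar>left_part u n (Suc k) - u x * ?r / 2\<bar>"
      by (simp add: algebra_simps add_divide_distrib)
    also have "\<dots> \<le> e * (?l + ?r)"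
      using nearR[OF 3(1)] nearL 3 by (simp add: algebra_simps)
    finally show ?thesis unfolding eq using pos by (intro scale) auto
  qed
qed

lemma walk_generator_limit:
  assumes C: "0 < C" and gg: "gauss_green p C f u" and cont: "continuous_on {0..1} u" and x: "x \<in> V p k"
  shows "(\<lambda>n. c ^ n * walk_generator p n f x) \<longlonglongrightarrow> C / 2 * u x"
proof (rule LIMSEQ_scaled_le[OF C])
  fix e :: real assume e: "0 < e"
  have "x \<in> {0..1}" using x vertex_in_unit by (auto simp: V_eq)
  with e cont obtain d where d: "0 < d" "\<And>y. y \<in> {0..1} \<Longrightarrow> \<bar>y - x\<bar> < d \<Longrightarrow> \<bar>u y - u x\<bar> < e"
    unfolding continuous_on_iff dist_real_def by metis
  obtain N where N: "\<forall>n\<ge>N. max_resist ^ n < d" using max_resist_power_small[OF d(1)] by auto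
  have "\<bar>c ^ n * walk_generator p n f x - C / 2 * u x\<bar> \<le> C * e" if n: "n \<ge> max k N" for n
  proof (rule walk_generator_near[OF C gg])
    show "x \<in> V p n" using V_mono[of k n] n x by auto
    show "\<bar>u y - u x\<bar> \<le> e" if "y \<in> {0..1}" "\<bar>y - x\<bar> \<le> max_resist ^ n" for y
      using d(2)[of y] that N n by (force intro: less_imp_le)
  qed
  thus "\<exists>N. \<forall>n\<ge>N. \<bar>c ^ n * walk_generator p n f x - C / 2 * u x\<bar> \<le> C * e" by blast
qed

lemma gauss_green_const_eq: "gauss_green_const p = 2"
  unfolding gauss_green_const_def
proof (rule the_equality)
  show "(2::real) > 0 \<and> (\<forall>f u. gauss_green p 2 f u \<and> continuous_on {0..1} u \<longrightarrow>
        (\<forall>k. \<forall>x\<in>V p k. (\<lambda>n. scaling p ^ n * walk_generator p n f x) \<longlonglongrightarrow> u x))"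
    using walk_generator_limit[of 2] by auto
next
  fix C :: real
  assume "C > 0 \<and> (\<forall>f u. gauss_green p C f u \<and> continuous_on {0..1} u \<longrightarrow>
        (\<forall>k. \<forall>x\<in>V p k. (\<lambda>n. scaling p ^ n * walk_generator p n f x) \<longlonglongrightarrow> u x))"
  hence C: "C > 0" and lim: "\<And>f u. gauss_green p C f u \<Longrightarrow> continuous_on {0..1} u \<Longrightarrow>
        (\<lambda>n. c ^ n * walk_generator p n f 0) \<longlonglongrightarrow> u 0"
    by (metis V.simps(1) insertI1, metis V.simps(1) insertI1)
  \<comment> \<open>A mean-zero function that does not vanish at the vertex \<open>0\<close>:
    comparing the limits \<open>C / 2 * u 0\<close> and \<open>u 0\<close> then determines
    \<open>C\<close>.\<close>
  define u :: "real \<Rightarrow> real" where "u x = x - 1 / 2" for x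
  define f where "f x = indicator {0..1} x * (C * kernel_op u x)" for x
  have um: "u \<in> borel_measurable borel" unfolding u_def by measurable
  have int: "integrable mu (\<lambda>t. t)" by (rule integrable_bounded[where B = 1]) auto
  have u: "integrable mu u" unfolding u_def using int by simp
  have cont: "continuous_on {0..1} u" unfolding u_def by (intro continuous_intros)
  have "continuous_on {0..1} (\<lambda>x. C * kernel_op u x)"
    by (intro continuous_intros continuous_on_kernel_op u)
  hence "continuous_on {0..1} f" by (rule continuous_on_eq) (simp add: f_def)
  moreover have "integrable mu (\<lambda>x. (u x)\<^sup>2)"
  proof (rule integrable_bounded[where B = 1])
    show "(\<lambda>x. (u x)\<^sup>2) \<in> borel_measurable borel" using um by measurable
    show "\<bar>(u y)\<^sup>2\<bar> \<le> 1" if "y \<in> {0<..1}" for y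
      using that by (auto simp: u_def abs_square_le_1)
  qed
  moreover have "(\<integral>y. u y \<partial>mu) = 0" unfolding u_def using int mu_mean by simp
  moreover have "\<forall>x\<in>{0..1}. f x = f 0 + C * kernel_op u x" by (simp add: f_def kernel_op_0)
  ultimately have gg: "gauss_green p C f u"
    unfolding gauss_green_iff[OF C] using um by (auto simp: f_def)
  have "C / 2 * u 0 = u 0"
    using walk_generator_limit[OF C gg cont, of 0 0] lim[OF gg cont] by (intro LIMSEQ_unique) auto
  thus "C = 2" by (simp add: u_def)
qed

lemma laplacian_iff:
  "laplacian p f u \<longleftrightarrow> continuous_on {0..1} f \<and> (\<forall>x. x \<notin> {0..1} \<longrightarrow> f x = 0) \<and>
     u \<in> borel_measurable borel \<and> integrable mu (\<lambda>x. (u x)\<^sup>2) \<and> (\<integral>y. u y \<partial>mu) = 0 \<and>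
     (\<forall>x\<in>{0..1}. f x = f 0 + 2 * kernel_op u x)"
  unfolding laplacian_def gauss_green_const_eq by (rule gauss_green_iff) simp

subsection \<open>The initial value problem\<close>

text \<open>The bound is imposed only where \<open>mu\<close> lives: affine initial data and
  \<open>kernel_op f\<close> may grow outside the unit interval.\<close>

definition bounded_measurable :: "(real \<Rightarrow> real) \<Rightarrow> bool" where
  "bounded_measurable f \<longleftrightarrow> f \<in> borel_measurable borel \<and> (\<exists>B. \<forall>x\<in>{0..1}. \<bar>f x\<bar> \<le> B)"

lemma bounded_measurable_integrable: "bounded_measurable f \<Longrightarrow> integrable mu f"
  unfolding bounded_measurable_def
  by (elim conjE exE, rule integrable_bounded) auto

lemma bounded_measurable_continuous:
  assumes "continuous_on UNIV f" shows "bounded_measurable f"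
proof -
  have "compact (f ` {0..1})" using assms by (intro compact_continuous_image) (auto intro: continuous_on_subset)
  from compact_imp_bounded[OF this] obtain B where "\<forall>x\<in>f ` {0..1}. norm x \<le> B"
    unfolding bounded_iff by (elim exE)
  hence "\<forall>x\<in>{0..1}. \<bar>f x\<bar> \<le> B" by (metis imageI real_norm_def)
  moreover have "f \<in> borel_measurable borel" using assms by (rule borel_measurable_continuous_onI)
  ultimately show ?thesis unfolding bounded_measurable_def by blast
qed

lemma bounded_measurable_kernel_op: "bounded_measurable f \<Longrightarrow> bounded_measurable (kernel_op f)"
  by (rule bounded_measurable_continuous, rule continuous_on_kernel_op, rule bounded_measurable_integrable)

lemma bounded_measurable_funpow: "bounded_measurable g \<Longrightarrow> bounded_measurable ((kernel_op ^^ n) g)"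
  by (induction n) (auto intro: bounded_measurable_kernel_op)

lemma bounded_measurable_lincomb:
  assumes "bounded_measurable f" "bounded_measurable g"
  shows "bounded_measurable (\<lambda>x. s * f x + t * g x)"
proof -
  obtain B where B: "\<forall>x\<in>{0..1}. \<bar>f x\<bar> \<le> B" using assms by (auto simp: bounded_measurable_def)
  obtain B' where B': "\<forall>x\<in>{0..1}. \<bar>g x\<bar> \<le> B'" using assms by (auto simp: bounded_measurable_def)
  have "\<bar>s * f x + t * g x\<bar> \<le> \<bar>s\<bar> * B + \<bar>t\<bar> * B'" if "x \<in> {0..1}" for x
  proof -
    have "\<bar>s * f x + t * g x\<bar> \<le> \<bar>s\<bar> * \<bar>f x\<bar> + \<bar>t\<bar> * \<bar>g x\<bar>"
      unfolding abs_mult[symmetric] by (rule abs_triangle_ineq)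
    also have "\<dots> \<le> \<bar>s\<bar> * B + \<bar>t\<bar> * B'" using B B' that by (intro add_mono mult_left_mono) auto
    finally show ?thesis .
  qed
  hence "\<exists>B. \<forall>x\<in>{0..1}. \<bar>s * f x + t * g x\<bar> \<le> B" by blast
  moreover have [measurable]: "f \<in> borel_measurable borel" "g \<in> borel_measurable borel"
    using assms by (simp_all add: bounded_measurable_def)
  have "(\<lambda>x. s * f x + t * g x) \<in> borel_measurable borel" by measurable
  ultimately show ?thesis by (simp add: bounded_measurable_def)
qed

lemma kernel_op_lincomb:
  assumes "bounded_measurable f" "bounded_measurable g"
  shows "kernel_op (\<lambda>x. s * f x + t * g x) x = s * kernel_op f x + t * kernel_op g x"
proof -
  note i = integrable_kernel[OF bounded_measurable_integrable]
  have "kernel_op (\<lambda>x. s * f x + t * g x) x =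
      (\<integral>y. s * (max 0 (x - y) * f y) + t * (max 0 (x - y) * g y) \<partial>mu)"
    unfolding kernel_op_def by (intro Bochner_Integration.integral_cong refl) (simp add: algebra_simps)
  also have "\<dots> = s * kernel_op f x + t * kernel_op g x"
    unfolding kernel_op_def using i[OF assms(1)] i[OF assms(2)] by simp
  finally show ?thesis .
qed

text \<open>The weight \<open>exp (\<theta> x)\<close> makes the norm of the kernel operator at most \<open>1 / \<theta>\<close>.\<close>

lemma kernel_op_weighted_bound:
  assumes f: "bounded_measurable f" and th: "0 < \<theta>" and x: "x \<in> {0..1}"
    and B: "\<And>y. y \<in> {0..1} \<Longrightarrow> \<bar>f y\<bar> \<le> B * exp (\<theta> * y)"
  shows "\<bar>kernel_op f x\<bar> \<le> B / \<theta> * exp (\<theta> * x)"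
proof -
  have B0: "0 \<le> B" using B[of 0] by simp
  have "\<bar>kernel_op f x\<bar> \<le> (\<integral>y. \<bar>max 0 (x - y) * f y\<bar> \<partial>mu)"
    unfolding kernel_op_def by (rule integral_abs_bound)
  also have "\<dots> \<le> (\<integral>y. B / \<theta> * exp (\<theta> * x) \<partial>mu)"
  proof (rule integral_mono_AE)
    show "integrable mu (\<lambda>y. \<bar>max 0 (x - y) * f y\<bar>)"
      by (intro integrable_abs integrable_kernel bounded_measurable_integrable f)
    show "AE y in mu. \<bar>max 0 (x - y) * f y\<bar> \<le> B / \<theta> * exp (\<theta> * x)"
      using AE_mu_unit
    proof eventually_elim
      case (elim y)
      show ?case
      proof (cases "y \<le> x")
        case True
        have "\<theta> * (x - y) \<le> exp (\<theta> * (x - y))" using exp_ge_add_one_self[of "\<theta> * (x - y)"] by linarith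
        hence "x - y \<le> exp (\<theta> * (x - y)) / \<theta>" using th by (simp add: field_simps)
        hence "(x - y) * \<bar>f y\<bar> \<le> exp (\<theta> * (x - y)) / \<theta> * (B * exp (\<theta> * y))"
          using True B[OF elim] th by (intro mult_mono) auto
        also have "\<dots> = B / \<theta> * exp (\<theta> * x)"
          by (simp add: exp_add[symmetric] algebra_simps)
        finally show ?thesis using True by (simp add: abs_mult)
      next
        case False
        thus ?thesis using B0 th by simp
      qed
    qed
  qed simp
  finally show ?thesis by simp
qed

lemma kernel_funpow_bound:
  assumes g: "bounded_measurable g" and th: "0 < \<theta>" and B: "\<And>y. y \<in> {0..1} \<Longrightarrow> \<bar>g y\<bar> \<le> B"
    and x: "x \<in> {0..1}"
  shows "\<bar>(kernel_op ^^ n) g x\<bar> \<le> B / \<theta> ^ n * exp (\<theta> * x)"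
  using x
proof (induction n arbitrary: x)
  case 0
  have "0 \<le> B" using B[of 0] by simp
  hence "B * 1 \<le> B * exp (\<theta> * x)" using 0 th by (intro mult_left_mono) auto
  thus ?case using B[OF 0] by simp
next
  case (Suc n)
  show ?case
    using kernel_op_weighted_bound[OF bounded_measurable_funpow[OF g] th Suc.prems Suc.IH]
    by (simp add: mult.commute)
qed

text \<open>The Neumann series of \<open>f = g - l * kernel_op f\<close>, arranged as a power series
  in \<open>l\<close>; for \<open>g = 1\<close> and \<open>x = 1\<close> its coefficients are those
  of the entire function behind \<open>Z\<close>.\<close>

definition solution :: "(real \<Rightarrow> real) \<Rightarrow> real \<Rightarrow> real \<Rightarrow> real" where
  "solution g l x = (\<Sum>n. (kernel_op ^^ n) g x * (- l) ^ n)"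

lemma solution_term_bound:
  assumes g: "bounded_measurable g" and B: "\<And>y. y \<in> {0..1} \<Longrightarrow> \<bar>g y\<bar> \<le> B"
    and x: "x \<in> {0..1}" and l: "\<bar>l\<bar> \<le> L"
  shows "\<bar>(kernel_op ^^ n) g x * (- l) ^ n\<bar> \<le> B * exp (2 * L + 1) * (1 / 2) ^ n"
proof -
  have B0: "0 \<le> B" using B[of 0] by fastforce
  \<comment> \<open>With this weight \<open>l * kernel_op\<close> has norm at most
    \<open>1 / 2\<close>, uniformly for \<open>\<bar>l\<bar> \<le> L\<close>; the \<open>+ 1\<close>
    keeps the weight positive at \<open>L = 0\<close>.\<close>
  let ?th = "2 * L + 1"
  have th: "0 < ?th" "\<bar>l\<bar> \<le> ?th / 2" using l by auto
  have "\<bar>(kernel_op ^^ n) g x * (- l) ^ n\<bar> \<le> (B / ?th ^ n * exp (?th * x)) * (?th / 2) ^ n"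
    unfolding abs_mult power_abs using kernel_funpow_bound[OF g th(1) B x] th B0
    by (intro mult_mono power_mono) auto
  also have "\<dots> = B * exp (?th * x) * (1 / 2) ^ n"
    using th by (simp add: power_divide)
  also have "\<dots> \<le> B * exp (?th) * (1 / 2) ^ n"
    using x th B0 by (intro mult_right_mono mult_left_mono) auto
  finally show ?thesis .
qed

lemma summable_half_power: "summable (\<lambda>n. K * (1 / 2 :: real) ^ n)"
  by (intro summable_mult summable_geometric) simp

lemma suminf_half_power: "(\<Sum>n. K * (1 / 2 :: real) ^ n) = 2 * K"
  by (subst suminf_mult) (simp_all add: suminf_geometric)

lemma solution_summable:
  assumes g: "bounded_measurable g" and x: "x \<in> {0..1}"
  shows "summable (\<lambda>n. (kernel_op ^^ n) g x * (- l) ^ n)"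
proof -
  obtain B where B: "\<forall>x\<in>{0..1}. \<bar>g x\<bar> \<le> B" using g unfolding bounded_measurable_def by (elim conjE exE)
  have "norm ((kernel_op ^^ n) g x * (- l) ^ n) \<le> B * exp (2 * \<bar>l\<bar> + 1) * (1 / 2) ^ n" for n
    unfolding real_norm_def by (rule solution_term_bound[OF g B[rule_format] x order_refl])
  thus ?thesis by (rule summable_comparison_test'[OF summable_half_power])
qed

lemma solution_bound:
  assumes g: "bounded_measurable g" and B: "\<And>y. y \<in> {0..1} \<Longrightarrow> \<bar>g y\<bar> \<le> B"
    and x: "x \<in> {0..1}" and l: "\<bar>l\<bar> \<le> L"
  shows "\<bar>solution g l x\<bar> \<le> 2 * (B * exp (2 * L + 1))"
proof -
  have "norm (solution g l x) \<le> (\<Sum>n. B * exp (2 * L + 1) * (1 / 2) ^ n)"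
    unfolding solution_def
    by (rule norm_suminf_le[OF _ summable_half_power])
       (simp only: real_norm_def solution_term_bound[OF g B x l])
  thus ?thesis by (simp add: suminf_half_power)
qed

lemma solution_partial_bound:
  assumes g: "bounded_measurable g" and B: "\<And>y. y \<in> {0..1} \<Longrightarrow> \<bar>g y\<bar> \<le> B"
    and x: "x \<in> {0..1}" and l: "\<bar>l\<bar> \<le> L"
  shows "\<bar>\<Sum>n<N. (kernel_op ^^ n) g x * (- l) ^ n\<bar> \<le> 2 * (B * exp (2 * L + 1))"
proof -
  have B0: "0 \<le> B" using B[of 0] by fastforce
  have "\<bar>\<Sum>n<N. (kernel_op ^^ n) g x * (- l) ^ n\<bar> \<le> (\<Sum>n<N. B * exp (2 * L + 1) * (1 / 2) ^ n)"
    by (rule order_trans[OF sum_abs sum_mono]) (rule solution_term_bound[OF g B x l])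
  also have "\<dots> \<le> (\<Sum>n. B * exp (2 * L + 1) * (1 / 2) ^ n)"
    using B0 by (intro sum_le_suminf summable_half_power) auto
  finally show ?thesis by (simp only: suminf_half_power)
qed

lemma solution_bounded_measurable:
  assumes g: "bounded_measurable g" shows "bounded_measurable (solution g l)"
proof -
  obtain B where B: "\<forall>x\<in>{0..1}. \<bar>g x\<bar> \<le> B" using g unfolding bounded_measurable_def by (elim conjE exE)
  have [measurable]: "(kernel_op ^^ n) g \<in> borel_measurable borel" for n
    using bounded_measurable_funpow[OF g, of n] by (simp add: bounded_measurable_def)
  have "solution g l \<in> borel_measurable borel" unfolding solution_def by measurable
  moreover have "\<forall>x\<in>{0..1}. \<bar>solution g l x\<bar> \<le> 2 * (B * exp (2 * \<bar>l\<bar> + 1))"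
    using solution_bound[OF g B[rule_format] _ order_refl] by blast
  ultimately show ?thesis unfolding bounded_measurable_def by blast
qed

lemma solution_equation:
  assumes g: "bounded_measurable g" and x: "x \<in> {0..1}"
  shows "solution g l x = g x - l * kernel_op (solution g l) x"
proof -
  obtain B where B: "\<forall>x\<in>{0..1}. \<bar>g x\<bar> \<le> B" using g unfolding bounded_measurable_def by (elim conjE exE)
  define S where "S N y = (\<Sum>n<N. (kernel_op ^^ n) g y * (- l) ^ n)" for N y
  have bm: "bounded_measurable (S N)" for N
  proof (induction N)
    case 0
    show ?case by (intro bounded_measurable_continuous) (simp add: S_def)
  next
    case (Suc N)
    have "S (Suc N) = (\<lambda>y. 1 * S N y + (- l) ^ N * (kernel_op ^^ N) g y)"
      by (simp add: S_def fun_eq_iff)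
    thus ?case using bounded_measurable_lincomb[OF Suc bounded_measurable_funpow[OF g, of N]] by metis
  qed
  have lim: "(\<lambda>N. S N y) \<longlonglongrightarrow> solution g l y" if "y \<in> {0..1}" for y
    using solution_summable[OF g that] unfolding S_def solution_def by (rule summable_LIMSEQ)
  have rec: "S (Suc N) x = g x - l * kernel_op (S N) x" for N x
  proof (induction N)
    case 0 thus ?case by (simp add: S_def kernel_op_def)
  next
    case (Suc N)
    have "S (Suc N) = (\<lambda>y. 1 * S N y + (- l) ^ N * (kernel_op ^^ N) g y)"
      by (simp add: S_def fun_eq_iff)
    hence "kernel_op (S (Suc N)) x = kernel_op (S N) x + (- l) ^ N * kernel_op ((kernel_op ^^ N) g) x"
      using kernel_op_lincomb[OF bm[of N] bounded_measurable_funpow[OF g, of N], of 1 "(- l) ^ N" x] by simp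
    moreover have "S (Suc (Suc N)) x = S (Suc N) x + (- l) ^ Suc N * kernel_op ((kernel_op ^^ N) g) x"
      by (simp add: S_def)
    ultimately show ?case using Suc by (simp add: algebra_simps)
  qed
  have "(\<lambda>N. kernel_op (S N) x) \<longlonglongrightarrow> kernel_op (solution g l) x"
    unfolding kernel_op_def
  proof -
    have [measurable]: "solution g l \<in> borel_measurable borel" "S N \<in> borel_measurable borel" for N
      using solution_bounded_measurable[OF g, of l] bm[of N] by (simp_all add: bounded_measurable_def)
    show "(\<lambda>N. \<integral>y. max 0 (x - y) * S N y \<partial>mu) \<longlonglongrightarrow> (\<integral>y. max 0 (x - y) * solution g l y \<partial>mu)"
  proof (rule integral_dominated_convergence[where w = "\<lambda>_. 2 * (B * exp (2 * \<bar>l\<bar> + 1))"])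
    show "AE y in mu. (\<lambda>N. max 0 (x - y) * S N y) \<longlonglongrightarrow> max 0 (x - y) * solution g l y"
      using AE_mu_unit by eventually_elim (intro tendsto_intros lim)
    show "AE y in mu. norm (max 0 (x - y) * S N y) \<le> 2 * (B * exp (2 * \<bar>l\<bar> + 1))" for N
      using AE_mu_unit
    proof eventually_elim
      case (elim y)
      have "\<bar>max 0 (x - y)\<bar> * \<bar>S N y\<bar> \<le> 1 * (2 * (B * exp (2 * \<bar>l\<bar> + 1)))"
        using solution_partial_bound[OF g _ elim order_refl, of B l N] B elim x
        by (intro mult_mono) (auto simp: S_def)
      thus ?case by (simp add: abs_mult)
    qed
    show "(\<lambda>y. max 0 (x - y) * solution g l y) \<in> borel_measurable mu"
      "(\<lambda>y. max 0 (x - y) * S N y) \<in> borel_measurable mu" for N by measurable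
  qed simp
  qed
  hence "(\<lambda>N. S (Suc N) x) \<longlonglongrightarrow> g x - l * kernel_op (solution g l) x"
    unfolding rec by (intro tendsto_intros)
  moreover have "(\<lambda>N. S (Suc N) x) \<longlonglongrightarrow> solution g l x"
    using lim[OF x] by (rule LIMSEQ_Suc)
  ultimately show ?thesis by (metis LIMSEQ_unique)
qed

text \<open>The integrated form of the initial value problem \<open>f'' = - l f \<mu>\<close>, \<open>f 0 = A\<close>, \<open>f' 0 = B\<close>.\<close>

definition solves :: "real \<Rightarrow> real \<Rightarrow> real \<Rightarrow> (real \<Rightarrow> real) \<Rightarrow> bool" where
  "solves l A B f \<longleftrightarrow> bounded_measurable f \<and> (\<forall>x\<in>{0..1}. f x = A + B * x - l * kernel_op f x)"

lemma solvesD: "solves l A B f \<Longrightarrow> x \<in> {0..1} \<Longrightarrow> f x = A + B * x - l * kernel_op f x"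
  by (simp add: solves_def)

lemma solution_solves: "solves l A B (solution (\<lambda>x. A + B * x) l)"
proof -
  have "bounded_measurable (\<lambda>x. A + B * x)" by (intro bounded_measurable_continuous continuous_intros)
  thus ?thesis unfolding solves_def
    using solution_bounded_measurable solution_equation by blast
qed

lemma solves_lincomb:
  assumes f: "solves l A B f" and g: "solves l A' B' g"
  shows "solves l (s * A + t * A') (s * B + t * B') (\<lambda>x. s * f x + t * g x)"
proof -
  have bm: "bounded_measurable f" "bounded_measurable g" using f g by (auto simp: solves_def)
  have "s * f x + t * g x = (s * A + t * A') + (s * B + t * B') * x - l * kernel_op (\<lambda>x. s * f x + t * g x) x"
    if "x \<in> {0..1}" for x
    unfolding kernel_op_lincomb[OF bm] solvesD[OF f that] solvesD[OF g that] by (simp add: algebra_simps)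
  thus ?thesis using bounded_measurable_lincomb[OF bm] by (simp only: solves_def) simp
qed

text \<open>In the weighted norm the homogeneous equation is a contraction with factor
  \<open>1 / 2\<close>, so every bound on \<open>f\<close> can be halved indefinitely.\<close>

lemma solves_zero_unique:
  assumes f: "solves l 0 0 f" and x: "x \<in> {0..1}"
  shows "f x = 0"
proof -
  have bm: "bounded_measurable f" using f by (auto simp: solves_def)
  then obtain M where M: "\<forall>x\<in>{0..1}. \<bar>f x\<bar> \<le> M" by (auto simp: bounded_measurable_def)
  hence M0: "0 \<le> M" by force
  define \<theta> where "\<theta> = 2 * \<bar>l\<bar> + 1"
  have th: "0 < \<theta>" "\<bar>l\<bar> / \<theta> \<le> 1 / 2" by (auto simp: \<theta>_def divide_simps)
  have *: "\<bar>f y\<bar> \<le> M * (1 / 2) ^ n * exp (\<theta> * y)" if "y \<in> {0..1}" for y n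
    using that
  proof (induction n arbitrary: y)
    case 0
    have "M * 1 \<le> M * exp (\<theta> * y)" using 0 th M0 by (intro mult_left_mono) auto
    thus ?case using M[rule_format, OF 0] by simp
  next
    case (Suc n)
    have "\<bar>f y\<bar> = \<bar>l\<bar> * \<bar>kernel_op f y\<bar>" using solvesD[OF f Suc.prems] by (simp add: abs_mult)
    also have "\<dots> \<le> \<bar>l\<bar> * (M * (1 / 2) ^ n / \<theta> * exp (\<theta> * y))"
      by (intro mult_left_mono kernel_op_weighted_bound[OF bm th(1) Suc.prems Suc.IH]) auto
    also have "\<dots> = \<bar>l\<bar> / \<theta> * (M * (1 / 2) ^ n * exp (\<theta> * y))" by simp
    also have "\<dots> \<le> 1 / 2 * (M * (1 / 2) ^ n * exp (\<theta> * y))"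
      using th M0 by (intro mult_right_mono) auto
    finally show ?case by simp
  qed
  have "(\<lambda>n. (1 / 2 :: real) ^ n) \<longlonglongrightarrow> 0" by (rule LIMSEQ_realpow_zero) simp_all
  hence "(\<lambda>n. M * (1 / 2) ^ n * exp (\<theta> * x)) \<longlonglongrightarrow> M * 0 * exp (\<theta> * x)"
    by (rule tendsto_mult[OF tendsto_mult[OF tendsto_const] tendsto_const])
  hence "\<bar>f x\<bar> \<le> M * 0 * exp (\<theta> * x)" by (rule LIMSEQ_le_const) (use *[OF x] in blast)
  thus ?thesis by simp
qed

lemma solves_unique:
  assumes f: "solves l A B f" and g: "solves l A B g" and x: "x \<in> {0..1}"
  shows "f x = g x"
  using solves_zero_unique[OF _ x, of l "\<lambda>x. 1 * f x + (- 1) * g x"] solves_lincomb[OF f g, where s = 1 and t = "- 1"]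
  by simp

text \<open>With Lebesgue measure in place of \<open>mu\<close> and \<open>l > 0\<close>, these two
  would be \<open>cos (sqrt l * x)\<close> and \<open>sin (sqrt l * x) / sqrt l\<close>.\<close>

definition cosine :: "real \<Rightarrow> real \<Rightarrow> real" where "cosine = solution (\<lambda>_. 1)"
definition sine :: "real \<Rightarrow> real \<Rightarrow> real" where "sine = solution (\<lambda>x. x)"

lemma cosine_solves: "solves l 1 0 (cosine l)" and sine_solves: "solves l 0 1 (sine l)"
  using solution_solves[of l 1 0] solution_solves[of l 0 1] by (simp_all add: cosine_def sine_def)

lemma solves_eq_cosine_sine:
  assumes f: "solves l A B f" and x: "x \<in> {0..1}"
  shows "f x = A * cosine l x + B * sine l x"
  using solves_unique[OF f _ x] solves_lincomb[OF cosine_solves[of l] sine_solves, where s = A and t = B]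
  by simp

text \<open>The derivative at \<open>1\<close> is \<open>B - l\<close> times the mean; so these are the entries of the
  monodromy matrix.\<close>

definition mc :: "real \<Rightarrow> real" where "mc l = cosine l 1"
definition ms :: "real \<Rightarrow> real" where "ms l = sine l 1"
definition mc' :: "real \<Rightarrow> real" where "mc' l = - l * (\<integral>y. cosine l y \<partial>mu)"
definition ms' :: "real \<Rightarrow> real" where "ms' l = 1 - l * (\<integral>y. sine l y \<partial>mu)"

lemma solves_bm: "solves l A B f \<Longrightarrow> bounded_measurable f"
  by (simp add: solves_def)

lemma solves_end:
  assumes f: "solves l A B f"
  shows "f 1 = A * mc l + B * ms l" "B - l * (\<integral>y. f y \<partial>mu) = A * mc' l + B * ms' l"
proof -
  show "f 1 = A * mc l + B * ms l" using solves_eq_cosine_sine[OF f, of 1] by (simp add: mc_def ms_def)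
  note [measurable] = solves_bm[OF f, unfolded bounded_measurable_def, THEN conjunct1]
    solves_bm[OF cosine_solves[of l], unfolded bounded_measurable_def, THEN conjunct1]
    solves_bm[OF sine_solves[of l], unfolded bounded_measurable_def, THEN conjunct1]
  have "(\<integral>y. f y \<partial>mu) = (\<integral>y. A * cosine l y + B * sine l y \<partial>mu)"
  proof (rule integral_cong_AE)
    show "AE y in mu. f y = A * cosine l y + B * sine l y"
      using AE_mu_unit by eventually_elim (rule solves_eq_cosine_sine[OF f])
  qed measurable
  also have "\<dots> = A * (\<integral>y. cosine l y \<partial>mu) + B * (\<integral>y. sine l y \<partial>mu)"
    using bounded_measurable_integrable[OF solves_bm[OF cosine_solves]]
      bounded_measurable_integrable[OF solves_bm[OF sine_solves]] by simp
  finally show "B - l * (\<integral>y. f y \<partial>mu) = A * mc' l + B * ms' l"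
    by (simp add: mc'_def ms'_def algebra_simps)
qed

text \<open>The derivative of a solution at \<open>t\<close>, obtained by integrating
  \<open>f'' = - l f mu\<close> once from \<open>0\<close>, where the slope is
  \<open>B\<close>.\<close>

definition slope_at :: "real \<Rightarrow> real \<Rightarrow> (real \<Rightarrow> real) \<Rightarrow> real \<Rightarrow> real" where
  "slope_at l B f t = B - l * (\<integral>y. indicator {..t} y * f y \<partial>mu)"

text \<open>Zooming into a cell multiplies length by \<open>r j\<close> and mass by
  \<open>m j\<close>. The product \<open>1 / c\<close> goes into the spectral parameter, and the
  slope picks up the factor \<open>r j\<close>.\<close>

lemma solves_cell:
  assumes f: "solves l A B f" and j: "j \<in> {1..3}"
  shows "solves (l / c) (f (F p j 0)) (r j * slope_at l B f (F p j 0)) (f \<circ> F p j)"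
    and "r j * slope_at l B f (F p j 1) =
      r j * slope_at l B f (F p j 0) - l / c * (\<integral>y. (f \<circ> F p j) y \<partial>mu)"
proof -
  let ?a = "F p j 0" and ?g = "f \<circ> F p j"
  have bm: "bounded_measurable f" by (rule solves_bm[OF f])
  hence fm [measurable]: "f \<in> borel_measurable borel" by (simp add: bounded_measurable_def)
  have i: "integrable mu f" by (rule bounded_measurable_integrable[OF bm])
  have rm: "m j * r j = 1 / c" using resist_weight[OF j] by (simp add: mult.commute)
  have rj: "0 < r j" by (rule resist_pos[OF j])
  have gm [measurable]: "?g \<in> borel_measurable borel" by measurable
  have gbm: "bounded_measurable ?g"
    using bm F_in_unit[OF j] gm unfolding bounded_measurable_def comp_def by blast
  have eq: "?g x = f ?a + r j * slope_at l B f ?a * x - l / c * kernel_op ?g x" if x: "x \<in> {0..1}" for x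
  proof (cases "x = 0")
    case True thus ?thesis by (simp add: kernel_op_0)
  next
    case False
    hence x: "0 < x" "x \<le> 1" using that by auto
    let ?b = "F p j x"
    have ab: "?a < ?b" "?b - ?a = r j * x" using F_less_iff[OF j] x F_diff[of j x 0] by auto
    have un: "?a \<in> {0..1}" "?b \<in> {0..1}" using F_in_unit[OF j] x by auto
    have "(\<integral>y. indicator {?a<..?b} y * ((?b - y) / (?b - ?a)) * f y \<partial>mu) =
        (\<integral>y. indicator {?a<..?b} y * ((?b - y) / (?b - ?a) * f y) \<partial>mu)" by (simp only: mult.assoc)
    also have "\<dots> = m j * (\<integral>t. indicator {0<..x} t * ((?b - F p j t) / (?b - ?a) * f (F p j t)) \<partial>mu)"
    proof (rule mu_cell_integral[OF j])
      show "(\<lambda>y. (?b - y) / (?b - ?a) * f y) \<in> borel_measurable borel" by measurable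
    qed (use x in simp_all)
    also have "(\<integral>t. indicator {0<..x} t * ((?b - F p j t) / (?b - ?a) * f (F p j t)) \<partial>mu) =
        (\<integral>t. max 0 (x - t) * ?g t / x \<partial>mu)"
    proof (rule integral_cong_AE)
      show "AE t in mu. indicator {0<..x} t * ((?b - F p j t) / (?b - ?a) * f (F p j t)) = max 0 (x - t) * ?g t / x"
        using AE_mu_Ioc
        by eventually_elim (use x rj ab F_diff[of j x] in \<open>auto simp: indicator_def max_def\<close>)
    qed measurable
    also have "\<dots> = kernel_op ?g x / x" by (simp add: kernel_op_def)
    finally have "kernel_op f ?b - kernel_op f ?a =
        r j * x * ((\<integral>y. indicator {..?a} y * f y \<partial>mu) + m j * (kernel_op ?g x / x))"
      using kernel_op_diff[OF i ab(1)] ab(2) by simp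
    also have "\<dots> = r j * x * (\<integral>y. indicator {..?a} y * f y \<partial>mu) + (m j * r j) * kernel_op ?g x"
      using x by (simp add: algebra_simps)
    finally have K: "kernel_op f ?b = kernel_op f ?a + r j * x * (\<integral>y. indicator {..?a} y * f y \<partial>mu) + 1 / c * kernel_op ?g x"
      unfolding rm by simp
    have "?g x = A + B * ?b - l * kernel_op f ?b" using solvesD[OF f un(2)] by simp
    moreover have "f ?a = A + B * ?a - l * kernel_op f ?a" by (rule solvesD[OF f un(1)])
    moreover have "?b = ?a + r j * x" using ab(2) by simp
    ultimately show ?thesis unfolding K slope_at_def by (simp add: algebra_simps)
  qed
  thus "solves (l / c) (f ?a) (r j * slope_at l B f ?a) ?g"
    using gbm unfolding solves_def by blast
  have "(\<integral>y. indicator {?a<..F p j 1} y * f y \<partial>mu) = m j * (\<integral>t. indicator {0<..1} t * f (F p j t) \<partial>mu)"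
    by (intro mu_cell_integral[OF j]) auto
  also have "(\<integral>t. indicator {0<..1} t * f (F p j t) \<partial>mu) = (\<integral>y. ?g y \<partial>mu)"
    using integral_unit_indicator[OF gm] by simp
  finally have "(\<integral>y. indicator {..F p j 1} y * f y \<partial>mu) = (\<integral>y. indicator {..?a} y * f y \<partial>mu) + m j * (\<integral>y. ?g y \<partial>mu)"
    using integral_Iic_diff[OF i, of ?a "F p j 1"] F_less_iff[OF j, of 0 1] by simp
  hence "r j * slope_at l B f (F p j 1) = r j * slope_at l B f ?a - l * (m j * r j) * (\<integral>y. ?g y \<partial>mu)"
    by (simp add: slope_at_def algebra_simps)
  thus "r j * slope_at l B f (F p j 1) = r j * slope_at l B f ?a - l / c * (\<integral>y. ?g y \<partial>mu)"
    unfolding rm by simp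
qed

text \<open>The transfer matrix of the \<open>j\<close>-th cell is the monodromy matrix at
  \<open>l / c\<close> conjugated by \<open>diag (1, r j)\<close>.\<close>

lemma cell_transfer:
  assumes f: "solves l A B f" and j: "j \<in> {1..3}"
  shows "f (F p j 1) = f (F p j 0) * mc (l / c) + r j * slope_at l B f (F p j 0) * ms (l / c)"
    and "slope_at l B f (F p j 1) = f (F p j 0) * mc' (l / c) / r j + slope_at l B f (F p j 0) * ms' (l / c)"
proof -
  show "f (F p j 1) = f (F p j 0) * mc (l / c) + r j * slope_at l B f (F p j 0) * ms (l / c)"
    using solves_end(1)[OF solves_cell(1)[OF f j]] by simp
  have "r j * slope_at l B f (F p j 1) = f (F p j 0) * mc' (l / c) + r j * slope_at l B f (F p j 0) * ms' (l / c)"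
    using solves_cell(2)[OF f j] solves_end(2)[OF solves_cell(1)[OF f j]] by simp
  thus "slope_at l B f (F p j 1) = f (F p j 0) * mc' (l / c) / r j + slope_at l B f (F p j 0) * ms' (l / c)"
    using resist_pos[OF j] by (simp add: field_simps)
qed

lemma slope_at_ends:
  assumes f: "solves l A B f"
  shows "slope_at l B f 0 = B" "slope_at l B f 1 = A * mc' l + B * ms' l" "f 0 = A"
  using solves_end(2)[OF f] integral_Iic_1[of f] solves_bm[OF f] solvesD[OF f, of 0]
  by (simp_all add: slope_at_def integral_Iic_0 bounded_measurable_def kernel_op_0)

end

lemma tendsto_of_linear_bound:
  fixes f :: "real \<Rightarrow> real"
  assumes "\<And>x. \<bar>x\<bar> \<le> 1 \<Longrightarrow> \<bar>f x - L\<bar> \<le> G * \<bar>x\<bar>"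
  shows "(f \<longlongrightarrow> L) (at 0)"
proof -
  have "((\<lambda>x. f x - L) \<longlongrightarrow> 0) (at 0)"
  proof (rule Lim_null_comparison)
    show "\<forall>\<^sub>F x in at 0. norm (f x - L) \<le> G * \<bar>x\<bar>"
      unfolding eventually_at using assms by (intro exI[of _ 1]) (auto simp: dist_real_def)
    have "((\<lambda>x::real. G * \<bar>x\<bar>) \<longlongrightarrow> G * \<bar>0\<bar>) (at 0)" by (intro tendsto_intros)
    thus "((\<lambda>x::real. G * \<bar>x\<bar>) \<longlongrightarrow> 0) (at 0)" by simp
  qed
  thus ?thesis by (simp add: LIM_zero_iff)
qed

context self_similar_interval
begin

abbreviation "q \<equiv> 1 - p"

subsection \<open>The monodromy matrix\<close>

lemma scaling_ge_9: "9 \<le> c"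
proof -
  have "0 \<le> (2 * p - 1)\<^sup>2" by simp
  hence "p * q \<le> 1 / 4" by (simp add: power2_eq_square algebra_simps)
  thus ?thesis using pq_pos by (simp add: scaling_def field_simps)
qed

text \<open>One step multiplies \<open>X\<close> by at most \<open>4\<close> near \<open>0\<close>,
  while the linear bound is divided by \<open>c\<close> on the way to the origin. As
  \<open>4 < c\<close>, iteration makes \<open>X\<close> vanish near \<open>0\<close>, and the
  recursion carries the zero outwards. Here \<open>4\<close> is a convenient number between the
  limit \<open>3\<close> of the factors and \<open>9 \<le> c\<close>.\<close>

lemma scaling_vanishing:
  assumes rec: "\<And>l. X (c * l) = X l * s l" and lin: "\<And>l. \<bar>l\<bar> \<le> 1 \<Longrightarrow> \<bar>X l\<bar> \<le> C * \<bar>l\<bar>"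
    and s: "\<forall>\<^sub>F l in at 0. \<bar>s l\<bar> \<le> 4"
  shows "X l = (0::real)"
proof -
  obtain d where d: "0 < d" "\<And>l. l \<noteq> 0 \<Longrightarrow> \<bar>l\<bar> < d \<Longrightarrow> \<bar>s l\<bar> \<le> 4"
    using s unfolding eventually_at dist_real_def by auto
  have c: "9 \<le> c" by (rule scaling_ge_9)
  have X0: "X 0 = 0" using lin[of 0] by simp
  have bd: "\<bar>X l\<bar> \<le> (4 / c) ^ n * (C * \<bar>l\<bar>)" if "\<bar>l\<bar> < min d 1" for n l
    using that
  proof (induction n arbitrary: l)
    case 0 thus ?case using lin by simp
  next
    case (Suc n)
    show ?case
    proof (cases "l = 0")
      case False
      have "\<bar>l\<bar> * 1 \<le> \<bar>l\<bar> * c" using c by (intro mult_left_mono) auto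
      hence cl: "\<bar>l / c\<bar> \<le> \<bar>l\<bar>" using c by (simp add: divide_simps)
      have "\<bar>X l\<bar> = \<bar>X (l / c)\<bar> * \<bar>s (l / c)\<bar>" using rec[of "l / c"] c by (simp add: abs_mult)
      also have "\<dots> \<le> ((4 / c) ^ n * (C * \<bar>l / c\<bar>)) * 4"
      proof (intro mult_mono)
        show "\<bar>X (l / c)\<bar> \<le> (4 / c) ^ n * (C * \<bar>l / c\<bar>)" using cl Suc.prems by (intro Suc.IH) simp
        thus "0 \<le> (4 / c) ^ n * (C * \<bar>l / c\<bar>)" by (rule order_trans[OF abs_ge_zero])
        show "\<bar>s (l / c)\<bar> \<le> 4" using cl Suc.prems False c by (intro d(2)) auto
      qed simp
      finally show ?thesis using c by (simp add: abs_divide mult_ac)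
    qed (simp add: X0)
  qed
  have small: "X l = 0" if "\<bar>l\<bar> < min d 1" for l
  proof -
    have "(\<lambda>n. (4 / c) ^ n) \<longlonglongrightarrow> 0" using c by (intro LIMSEQ_realpow_zero) auto
    hence "(\<lambda>n. (4 / c) ^ n * (C * \<bar>l\<bar>)) \<longlonglongrightarrow> 0 * (C * \<bar>l\<bar>)"
      by (rule tendsto_mult[OF _ tendsto_const])
    hence "\<bar>X l\<bar> \<le> 0 * (C * \<bar>l\<bar>)" by (rule LIMSEQ_le_const) (use bd[OF that] in blast)
    thus ?thesis by simp
  qed
  have "(\<lambda>n. l * (1 / c) ^ n) \<longlonglongrightarrow> l * 0"
    using c by (intro tendsto_mult tendsto_const LIMSEQ_realpow_zero) auto
  moreover have "0 < min d 1" using d(1) by simp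
  ultimately have "\<forall>\<^sub>F n in sequentially. dist (l * (1 / c) ^ n) 0 < min d 1"
    unfolding mult_zero_right by (rule tendstoD)
  then obtain n where "\<bar>l * (1 / c) ^ n\<bar> < min d 1"
    unfolding eventually_sequentially dist_real_def by auto
  hence "X (l * (1 / c) ^ n) = 0" by (rule small)
  hence "X (l * (1 / c) ^ (n - k)) = 0" if "k \<le> n" for k
    using that
  proof (induction k)
    case (Suc k)
    have "n - k = Suc (n - Suc k)" using Suc.prems by simp
    hence e: "c * (l * (1 / c) ^ (n - k)) = l * (1 / c) ^ (n - Suc k)" using c by simp
    have "X (l * (1 / c) ^ (n - k)) = 0" using Suc by simp
    thus ?case using rec[of "l * (1 / c) ^ (n - k)"] unfolding e by simp
  qed simp
  from this[of n] show ?thesis by simp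
qed

text \<open>Only the ratio of the two resistances enters the recursions once \<open>mc'\<close> and
  \<open>ms\<close> are rescaled by \<open>r 1\<close>.\<close>

definition rr :: real where "rr = r 2 / r 1"

lemma rr_eq: "rr = q / p"
proof -
  have "2 + p * q \<noteq> 0" "p + p * q \<noteq> 0" using add_pos_pos[OF _ pq_pos, of 2] add_pos_pos[OF p_pos pq_pos] by auto
  hence "rr = (2 * q - p * q) / (p + p * q)" by (simp add: rr_def resist_simps)
  also have "2 * q - p * q = q * (2 - p)" by (simp add: algebra_simps)
  also have "p + p * q = p * (2 - p)" by (simp add: algebra_simps)
  also have "q * (2 - p) / (p * (2 - p)) = q / p" using p_less_1 by simp
  finally show ?thesis .
qed

lemma rr_pos: "0 < rr"
  using p_pos p_less_1 by (simp add: rr_eq)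

text \<open>The product of the three transfer matrices applied to the initial data:
  \<open>f1, d1\<close> and \<open>f2, d2\<close> are value and slope at the two interior vertices
  of level \<open>1\<close>.\<close>

lemma chain:
  assumes f: "solves (c * l) A B f"
  defines "f1 \<equiv> A * mc l + r 1 * B * ms l" and "d1 \<equiv> A * mc' l / r 1 + B * ms' l"
  defines "f2 \<equiv> f1 * mc l + r 2 * d1 * ms l" and "d2 \<equiv> f1 * mc' l / r 2 + d1 * ms' l"
  shows "A * mc (c * l) + B * ms (c * l) = f2 * mc l + r 1 * d2 * ms l"
    and "A * mc' (c * l) + B * ms' (c * l) = f2 * mc' l / r 1 + d2 * ms' l"
proof -
  have cl: "c * l / c = l" using scaling_pos by simp
  note t = cell_transfer[OF f, unfolded cl]
  note e = slope_at_ends[OF f]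
  let ?s = "slope_at (c * l) B f"
  have 1: "f (F p 2 0) = f1" "?s (F p 2 0) = d1"
    using t[of 1] e unfolding F_endpoints f1_def d1_def by simp_all
  have 2: "f (F p 3 0) = f2" "?s (F p 3 0) = d2"
    using t[of 2] 1 unfolding F_endpoints f2_def d2_def by simp_all
  show "A * mc (c * l) + B * ms (c * l) = f2 * mc l + r 1 * d2 * ms l"
    using t(1)[of 3] 2 solves_end(1)[OF f] unfolding F_endpoints resist_simps(2) by simp
  show "A * mc' (c * l) + B * ms' (c * l) = f2 * mc' l / r 1 + d2 * ms' l"
    using t(2)[of 3] 2 e unfolding F_endpoints resist_simps(2) by simp
qed

lemma monodromy_rec:
  shows "mc (c * l) = (mc l)^2 * mc l + rr * mc l * ms l * mc' l + mc l * ms l * mc' l / rr + ms' l * ms l * mc' l"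
    and "r 1 * mc' (c * l) = ((mc l)^2 + rr * ms l * mc' l) * mc' l + (mc l * mc' l / rr + ms' l * mc' l) * ms' l"
    and "ms (c * l) / r 1 = (mc l * ms l + rr * ms' l * ms l) * mc l + (ms l * mc' l / rr + (ms' l)^2) * ms l"
    and "ms' (c * l) = (mc l * ms l + rr * ms' l * ms l) * mc' l + (ms l * mc' l / rr + (ms' l)^2) * ms' l"
proof -
  have r: "r 1 \<noteq> 0" "rr \<noteq> 0" and r2: "r 2 = rr * r 1"
    using resist_12_pos by (auto simp: rr_def)
  note C = chain[OF cosine_solves[of "c * l"]] and S = chain[OF sine_solves[of "c * l"]]
  show "mc (c * l) = (mc l)^2 * mc l + rr * mc l * ms l * mc' l + mc l * ms l * mc' l / rr + ms' l * ms l * mc' l"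
    using C(1)[unfolded r2] r by (simp add: algebra_simps add_divide_distrib power2_eq_square)
  show "r 1 * mc' (c * l) = ((mc l)^2 + rr * ms l * mc' l) * mc' l + (mc l * mc' l / rr + ms' l * mc' l) * ms' l"
    using C(2)[unfolded r2] r by (simp add: algebra_simps add_divide_distrib power2_eq_square)
  show "ms (c * l) / r 1 = (mc l * ms l + rr * ms' l * ms l) * mc l + (ms l * mc' l / rr + (ms' l)^2) * ms l"
    using S(1)[unfolded r2] r by (simp add: algebra_simps add_divide_distrib power2_eq_square)
  show "ms' (c * l) = (mc l * ms l + rr * ms' l * ms l) * mc' l + (ms l * mc' l / rr + (ms' l)^2) * ms' l"
    using S(2)[unfolded r2] r by (simp add: algebra_simps add_divide_distrib power2_eq_square)
qed

text \<open>The constant of \<open>solution_bound\<close> for \<open>B = 1\<close> and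
  \<open>L = 1\<close>.\<close>

definition gbound :: real where "gbound = 2 * exp 3"

lemma gbound_pos: "0 < gbound" by (simp add: gbound_def)

lemma fundamental_bound:
  assumes l: "\<bar>l\<bar> \<le> 1" and x: "x \<in> {0..1}"
  shows "\<bar>cosine l x\<bar> \<le> gbound" "\<bar>sine l x\<bar> \<le> gbound"
proof -
  have "bounded_measurable (\<lambda>x. 1)" "bounded_measurable (\<lambda>x. x)"
    by (intro bounded_measurable_continuous continuous_intros)+
  from solution_bound[OF this(1) _ x l, of 1] solution_bound[OF this(2) _ x l, of 1]
  show "\<bar>cosine l x\<bar> \<le> gbound" "\<bar>sine l x\<bar> \<le> gbound"
    by (auto simp: cosine_def sine_def gbound_def)
qed

lemma weighted_integral_bound:
  assumes f: "bounded_measurable f" and B: "\<And>y. y \<in> {0..1} \<Longrightarrow> \<bar>f y\<bar> \<le> B"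
  shows "\<bar>\<integral>y. f y \<partial>mu\<bar> \<le> B" "x \<in> {0..1} \<Longrightarrow> \<bar>kernel_op f x\<bar> \<le> B"
proof -
  have B0: "0 \<le> B" using B[of 0] by simp
  have "\<bar>\<integral>y. f y \<partial>mu\<bar> \<le> (\<integral>y. \<bar>f y\<bar> \<partial>mu)" by (rule integral_abs_bound)
  also have "\<dots> \<le> (\<integral>y. B \<partial>mu)"
  proof (rule integral_mono_AE)
    show "integrable mu (\<lambda>y. \<bar>f y\<bar>)" using bounded_measurable_integrable[OF f] by simp
    show "AE y in mu. \<bar>f y\<bar> \<le> B" using AE_mu_unit by eventually_elim (rule B)
  qed simp
  finally show "\<bar>\<integral>y. f y \<partial>mu\<bar> \<le> B" by simp
  assume x: "x \<in> {0..1}"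
  have "\<bar>kernel_op f x\<bar> \<le> (\<integral>y. \<bar>max 0 (x - y) * f y\<bar> \<partial>mu)"
    unfolding kernel_op_def by (rule integral_abs_bound)
  also have "\<dots> \<le> (\<integral>y. B \<partial>mu)"
  proof (rule integral_mono_AE)
    show "integrable mu (\<lambda>y. \<bar>max 0 (x - y) * f y\<bar>)"
      using integrable_kernel[OF bounded_measurable_integrable[OF f]] by simp
    show "AE y in mu. \<bar>max 0 (x - y) * f y\<bar> \<le> B"
      using AE_mu_unit
    proof eventually_elim
      case (elim y)
      have "\<bar>max 0 (x - y)\<bar> * \<bar>f y\<bar> \<le> 1 * B" using elim x B[OF elim] by (intro mult_mono) auto
      thus ?case by (simp add: abs_mult)
    qed
  qed simp
  finally show "\<bar>kernel_op f x\<bar> \<le> B" by simp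
qed

lemma monodromy_near:
  assumes l: "\<bar>l\<bar> \<le> 1"
  shows "\<bar>mc l - 1\<bar> \<le> gbound * \<bar>l\<bar>" "\<bar>ms l - 1\<bar> \<le> gbound * \<bar>l\<bar>"
    "\<bar>mc' l\<bar> \<le> gbound * \<bar>l\<bar>" "\<bar>ms' l - 1\<bar> \<le> gbound * \<bar>l\<bar>"
    "\<bar>(\<integral>y. cosine l y \<partial>mu) - 1\<bar> \<le> gbound * \<bar>l\<bar>"
proof -
  note bc = solves_bm[OF cosine_solves[of l]] and bs = solves_bm[OF sine_solves[of l]]
  note wc = weighted_integral_bound[OF bc fundamental_bound(1)[OF l]]
  note ws = weighted_integral_bound[OF bs fundamental_bound(2)[OF l]]
  have *: "\<bar>l * K\<bar> \<le> gbound * \<bar>l\<bar>" if "\<bar>K\<bar> \<le> gbound" for K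
    using mult_left_mono[OF that, of "\<bar>l\<bar>"] by (simp add: abs_mult mult.commute)
  have "mc l - 1 = - (l * kernel_op (cosine l) 1)" "ms l - 1 = - (l * kernel_op (sine l) 1)"
    using solvesD[OF cosine_solves, of 1 l] solvesD[OF sine_solves, of 1 l] by (simp_all add: mc_def ms_def)
  thus "\<bar>mc l - 1\<bar> \<le> gbound * \<bar>l\<bar>" "\<bar>ms l - 1\<bar> \<le> gbound * \<bar>l\<bar>"
    using *[OF wc(2)] *[OF ws(2)] by auto
  show "\<bar>mc' l\<bar> \<le> gbound * \<bar>l\<bar>" "\<bar>ms' l - 1\<bar> \<le> gbound * \<bar>l\<bar>"
    using *[OF wc(1)] *[OF ws(1)] by (auto simp: mc'_def ms'_def)
  have cm [measurable]: "cosine l \<in> borel_measurable borel" using bc by (simp add: bounded_measurable_def)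
  have "(\<integral>y. cosine l y \<partial>mu) = (\<integral>y. 1 - l * kernel_op (cosine l) y \<partial>mu)"
  proof (rule integral_cong_AE)
    show "AE y in mu. cosine l y = 1 - l * kernel_op (cosine l) y"
      using AE_mu_unit by eventually_elim (use solvesD[OF cosine_solves[of l]] in auto)
    have [measurable]: "kernel_op (cosine l) \<in> borel_measurable borel"
      using bounded_measurable_kernel_op[OF bc] unfolding bounded_measurable_def by (rule conjunct1)
    show "(\<lambda>y. 1 - l * kernel_op (cosine l) y) \<in> borel_measurable mu" by measurable
  qed measurable
  also have "\<dots> = 1 - l * (\<integral>y. kernel_op (cosine l) y \<partial>mu)"
    using bounded_measurable_integrable[OF bounded_measurable_kernel_op[OF bc]] by simp
  finally have "(\<integral>y. cosine l y \<partial>mu) - 1 = - (l * (\<integral>y. kernel_op (cosine l) y \<partial>mu))" by simp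
  thus "\<bar>(\<integral>y. cosine l y \<partial>mu) - 1\<bar> \<le> gbound * \<bar>l\<bar>"
    using *[OF weighted_integral_bound(1)[OF bounded_measurable_kernel_op[OF bc] wc(2)]] by simp
qed

lemma monodromy_tendsto:
  "(mc \<longlongrightarrow> 1) (at 0)" "(ms \<longlongrightarrow> 1) (at 0)" "(mc' \<longlongrightarrow> 0) (at 0)" "(ms' \<longlongrightarrow> 1) (at 0)"
  using monodromy_near by (auto intro!: tendsto_of_linear_bound[where G = gbound])

text \<open>Both the asymmetry and the determinant defect satisfy a multiplicative recursion whose
  factor tends to \<open>3 < c\<close> at \<open>0\<close>, so they vanish identically.\<close>

lemma monodromy_symmetric: "ms' l = mc l"
proof -
  \<comment> \<open>The factor by which the asymmetry grows in one step; its limit at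
    \<open>0\<close> is \<open>1 + 1 + 1 = 3\<close>.\<close>
  define s where "s l = (mc l)\<^sup>2 + mc l * ms' l + (ms' l)\<^sup>2 + ms l * mc' l * (rr + 1 / rr - 1)" for l
  have "mc l - ms' l = 0"
  proof (rule scaling_vanishing[where X = "\<lambda>l. mc l - ms' l" and s = s and C = "2 * gbound"])
    fix l
    show "mc (c * l) - ms' (c * l) = (mc l - ms' l) * s l"
      unfolding monodromy_rec s_def using rr_pos by (simp add: field_simps power2_eq_square)
    show "\<bar>mc l - ms' l\<bar> \<le> (2 * gbound) * \<bar>l\<bar>" if "\<bar>l\<bar> \<le> 1"
      using monodromy_near(1,4)[OF that] by (simp add: abs_le_iff)
  next
    have "(s \<longlongrightarrow> 1\<^sup>2 + 1 * 1 + 1\<^sup>2 + 1 * 0 * (rr + 1 / rr - 1)) (at 0)"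
      unfolding s_def by (intro tendsto_intros monodromy_tendsto)
    hence "((\<lambda>l. \<bar>s l\<bar>) \<longlongrightarrow> \<bar>3\<bar>) (at 0)" by (intro tendsto_rabs) simp
    hence "\<forall>\<^sub>F l in at 0. \<bar>s l\<bar> < 4" by (rule order_tendstoD) simp
    thus "\<forall>\<^sub>F l in at 0. \<bar>s l\<bar> \<le> 4" by eventually_elim simp
  qed
  thus ?thesis by simp
qed

text \<open>A Wronskian identity. Conjugation leaves determinants alone and the three cells multiply
  them, so the determinant satisfies \<open>E (c * l) = (E l)^3\<close>. The defect
  \<open>E - 1\<close> is then multiplied by \<open>E\<^sup>2 + E + 1\<close>, which tends to
  \<open>3\<close>.\<close>

lemma monodromy_det: "ms l * mc' l = (mc l)\<^sup>2 - 1"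
proof -
  define E where "E l = (mc l)\<^sup>2 - ms l * mc' l" for l
  have r: "r 1 \<noteq> 0" using resist_12_pos by auto
  have "E l - 1 = 0"
  proof (rule scaling_vanishing[where X = "\<lambda>l. E l - 1" and s = "\<lambda>l. (E l)\<^sup>2 + E l + 1"
        and C = "gbound * gbound + gbound * (gbound + 1)"])
    fix l
    define a b d u where "a = mc l" and "b = ms l" and "d = mc' l" and "u = 1 / rr"
    have tu: "rr * u = 1" using rr_pos by (simp add: u_def)
    have 1: "mc (c * l) = a^2 * a + rr * a * b * d + a * b * d * u + a * b * d"
      using monodromy_rec(1)[of l] by (simp add: monodromy_symmetric a_def b_def d_def u_def)
    have 2: "r 1 * mc' (c * l) = (a^2 + rr * b * d) * d + (a * d * u + a * d) * a"
      using monodromy_rec(2)[of l] by (simp add: monodromy_symmetric a_def b_def d_def u_def)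
    have 3: "ms (c * l) / r 1 = (a * b + rr * a * b) * a + (b * d * u + a^2) * b"
      using monodromy_rec(3)[of l] by (simp add: monodromy_symmetric a_def b_def d_def u_def)
    have "ms (c * l) * mc' (c * l) = (ms (c * l) / r 1) * (r 1 * mc' (c * l))" using r by simp
    hence "E (c * l) = (a^2 * a + rr * a * b * d + a * b * d * u + a * b * d)^2 -
        ((a * b + rr * a * b) * a + (b * d * u + a^2) * b) * ((a^2 + rr * b * d) * d + (a * d * u + a * d) * a)"
      unfolding E_def 1 2 3 by simp
    also have "\<dots> = (a^2 - b * d)^3" using tu by algebra
    finally have "E (c * l) = (E l)^3" by (simp add: E_def a_def b_def d_def)
    thus "E (c * l) - 1 = (E l - 1) * ((E l)\<^sup>2 + E l + 1)"
      by (simp add: power2_eq_square power3_eq_cube algebra_simps)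
  next
    fix l :: real assume l: "\<bar>l\<bar> \<le> 1"
    have "ms l * mc' l = - (l * (ms l * (\<integral>y. cosine l y \<partial>mu)))" by (simp add: mc'_def)
    moreover have "\<bar>ms l\<bar> \<le> gbound" "\<bar>mc l\<bar> \<le> gbound" using fundamental_bound[OF l, of 1] by (auto simp: ms_def mc_def)
    ultimately have "\<bar>ms l * mc' l\<bar> \<le> gbound * (gbound * \<bar>l\<bar>)"
      using monodromy_near(3)[OF l] gbound_pos unfolding abs_mult by (intro mult_mono) auto
    moreover have "(mc l)\<^sup>2 - 1 = (mc l - 1) * (mc l + 1)" by (simp add: power2_eq_square algebra_simps)
    hence "\<bar>(mc l)\<^sup>2 - 1\<bar> \<le> (gbound * \<bar>l\<bar>) * (gbound + 1)"
      using monodromy_near(1)[OF l] \<open>\<bar>mc l\<bar> \<le> gbound\<close> gbound_pos unfolding \<open>(mc l)\<^sup>2 - 1 = _\<close> abs_mult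
      by (intro mult_mono) auto
    ultimately have "\<bar>E l - 1\<bar> \<le> gbound * (gbound * \<bar>l\<bar>) + (gbound * \<bar>l\<bar>) * (gbound + 1)"
      unfolding E_def by (simp only: abs_le_iff) linarith
    thus "\<bar>E l - 1\<bar> \<le> (gbound * gbound + gbound * (gbound + 1)) * \<bar>l\<bar>" by (simp add: algebra_simps)
  next
    have E: "(E \<longlongrightarrow> 1\<^sup>2 - 1 * 0) (at 0)" unfolding E_def by (intro tendsto_intros monodromy_tendsto)
    have "((\<lambda>l. \<bar>(E l)\<^sup>2 + E l + 1\<bar>) \<longlongrightarrow> \<bar>(1\<^sup>2 - 1 * 0)\<^sup>2 + (1\<^sup>2 - 1 * 0) + 1\<bar>) (at 0)"
      by (intro tendsto_intros E)
    hence "\<forall>\<^sub>F l in at 0. \<bar>(E l)\<^sup>2 + E l + 1\<bar> < 4" by (rule order_tendstoD) simp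
    thus "\<forall>\<^sub>F l in at 0. \<bar>(E l)\<^sup>2 + E l + 1\<bar> \<le> 4" by eventually_elim simp
  qed
  thus ?thesis by (simp add: E_def)
qed

text \<open>After symmetry the off-diagonal entries enter only through their product, which the
  determinant expresses by \<open>mc\<close>; so the diagonal entry obeys a closed cubic
  recursion.\<close>

lemma mc_rec: "mc (c * l) = ((mc l)^3 - mc l * (1 - p * q)) / (p * q)"
proof -
  have pq: "p \<noteq> 0" "q \<noteq> 0" using p_pos p_less_1 by auto
  have "mc (c * l) = mc l * ((mc l)\<^sup>2 + (ms l * mc' l) * (rr + 1 / rr + 1))"
    unfolding monodromy_rec(1)[of l] monodromy_symmetric by (simp add: algebra_simps)
  also have "rr + 1 / rr + 1 = (1 - p * q) / (p * q)"
    unfolding rr_eq using pq by (simp add: field_simps)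
  also have "mc l * ((mc l)\<^sup>2 + (ms l * mc' l) * ((1 - p * q) / (p * q))) =
      ((mc l)^3 - mc l * (1 - p * q)) / (p * q)"
  proof -
    define w where "w = p * q"
    have "w \<noteq> 0" using pq by (simp add: w_def)
    thus ?thesis unfolding monodromy_det w_def[symmetric]
      by (simp add: field_simps power2_eq_square power3_eq_cube)
  qed
  finally show ?thesis .
qed

text \<open>The factor shows where new zeros of \<open>mc'\<close> appear under scaling: exactly at
  \<open>mc l = q\<close> and \<open>mc l = - q\<close>, that is, where \<open>1 - mc l\<close> is a
  base point.\<close>

lemma mc'_rec: "mc' (c * l) = mc' l * ((mc l)\<^sup>2 - q\<^sup>2) / (r 1 * (p * q))"
proof -
  have pq: "p \<noteq> 0" "q \<noteq> 0" "r 1 \<noteq> 0" using p_pos p_less_1 resist_12_pos by auto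
  have "r 1 * mc' (c * l) = mc' l * ((mc l)\<^sup>2 * (2 + 1 / rr) + rr * (ms l * mc' l))"
    unfolding monodromy_rec(2)[of l] monodromy_symmetric by (simp add: algebra_simps power2_eq_square)
  also have "\<dots> = mc' l * ((mc l)\<^sup>2 * (2 + 1 / rr + rr) - rr)"
    unfolding monodromy_det by (simp add: algebra_simps)
  also have "2 + 1 / rr + rr = 1 / (p * q)"
    unfolding rr_eq using pq by (simp add: field_simps)
  also have "rr = q\<^sup>2 / (p * q)" unfolding rr_eq using pq by (simp add: power2_eq_square)
  finally show ?thesis using pq by (simp add: diff_divide_distrib[symmetric] field_simps)
qed

subsection \<open>The entire function satisfying the Poincare equation\<close>

definition coef :: "nat \<Rightarrow> real" where "coef n = (kernel_op ^^ n) (\<lambda>_. 1) 1"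

text \<open>The Gauss--Green constant \<open>2\<close> turns the eigenvalue \<open>k\<close> into
  the parameter \<open>2 * k\<close> of the initial value problem. Subtraction from \<open>1\<close>
  moves the value at \<open>k = 0\<close> to the fixed point \<open>0\<close> of
  \<open>RR\<close>.\<close>

definition Z :: "real \<Rightarrow> real" where "Z k = 1 - mc (2 * k)"

definition Zcoef :: "nat \<Rightarrow> real" where
  "Zcoef n = (if n = 0 then 0 else - (coef n * (- 2) ^ n))"

definition RR :: "real \<Rightarrow> real" where "RR z = z * (z\<^sup>2 - 3 * z + 2 + p * q) / (p * q)"

lemma bounded_measurable_const: "bounded_measurable (\<lambda>_. a)"
  by (intro bounded_measurable_continuous continuous_intros)

lemma kernel_op_nonneg: "(\<And>y. 0 \<le> f y) \<Longrightarrow> 0 \<le> kernel_op f x"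
  unfolding kernel_op_def by (intro Bochner_Integration.integral_nonneg) simp

lemma coef_nonneg: "0 \<le> coef n"
proof -
  have "0 \<le> (kernel_op ^^ n) (\<lambda>_. 1) x" for x
  proof (induction n arbitrary: x)
    case (Suc n)
    show ?case using kernel_op_nonneg[OF Suc] by simp
  qed simp
  thus ?thesis by (simp add: coef_def)
qed

lemma coef_0: "coef 0 = 1"
  by (simp add: coef_def)

lemma coef_1: "coef (Suc 0) = 1 / 2"
proof -
  have int: "integrable mu (\<lambda>t. t)" by (rule integrable_bounded[where B = 1]) auto
  have "coef (Suc 0) = (\<integral>y. max 0 (1 - y) * 1 \<partial>mu)" by (simp add: coef_def kernel_op_def)
  also have "\<dots> = (\<integral>y. 1 - y \<partial>mu)"
  proof (rule integral_cong_AE)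
    show "AE y in mu. max 0 (1 - y) * 1 = 1 - y" using AE_mu_unit by eventually_elim simp
  qed measurable
  also have "\<dots> = 1 / 2" using int mu_mean by simp
  finally show ?thesis .
qed

lemma Zcoef_sums: "(\<lambda>n. Zcoef n * k ^ n) sums Z k"
proof -
  have "(\<lambda>n. coef n * (- (2 * k)) ^ n) sums mc (2 * k)"
    using solution_summable[OF bounded_measurable_const, of 1 1 "2 * k"]
    unfolding mc_def cosine_def solution_def coef_def by (intro summable_sums) simp
  hence "(\<lambda>n. (if n = 0 then 1 else 0) - coef n * (- (2 * k)) ^ n) sums (1 - mc (2 * k))"
    by (intro sums_diff sums_single[of 0 "\<lambda>_. 1"])
  moreover have "(if n = 0 then 1 else 0) - coef n * (- (2 * k)) ^ n = Zcoef n * k ^ n" for n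
  proof -
    have "(- (2 * k)) ^ n = (- 2) ^ n * k ^ n" unfolding power_mult_distrib[symmetric] by simp
    thus ?thesis by (simp add: Zcoef_def coef_0)
  qed
  ultimately show ?thesis by (simp add: Z_def)
qed

lemma Z_eq: "Z = (\<lambda>k. \<Sum>n. Zcoef n * k ^ n)"
  using Zcoef_sums by (simp add: sums_iff fun_eq_iff)

lemma Z_0 [simp]: "Z 0 = 0"
  using Zcoef_sums[of 0] sums_unique2[OF _ powser_sums_zero[of Zcoef]] by (simp add: Zcoef_def)

definition Z' :: "real \<Rightarrow> real" where "Z' k = (\<Sum>n. diffs Zcoef n * k ^ n)"

lemma Z_deriv: "(Z has_real_derivative Z' k) (at k)"
  unfolding Z_eq Z'_def
  by (rule termdiffs_strong_converges_everywhere) (rule sums_summable[OF Zcoef_sums])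

lemma Z'_cont: "isCont Z' k"
  unfolding Z'_def
  by (rule isCont_powser_converges_everywhere, rule termdiff_converges_all,
      rule sums_summable[OF Zcoef_sums])

lemma Z'_0: "Z' 0 = 1"
proof -
  have "Z' 0 = diffs Zcoef 0" unfolding Z'_def
    using sums_unique[OF powser_sums_zero[of "diffs Zcoef"]] by simp
  thus ?thesis by (simp add: diffs_def Zcoef_def coef_1)
qed

lemma Z_isCont: "isCont Z k" by (rule DERIV_isCont[OF Z_deriv])

lemma continuous_on_Z: "continuous_on A Z"
  by (simp add: continuous_at_imp_continuous_on Z_isCont)

lemma Z_locally_increasing: "\<exists>d>0. \<forall>x y. 0 \<le> x \<longrightarrow> x < y \<longrightarrow> y \<le> d \<longrightarrow> Z x < Z y"
proof -
  have "(Z' \<longlongrightarrow> 1) (at 0)" using Z'_cont[of 0] by (simp add: isCont_def Z'_0)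
  hence "\<forall>\<^sub>F k in at 0. 0 < Z' k" by (rule order_tendstoD) simp
  then obtain d where d: "d > 0" "\<And>k. k \<noteq> 0 \<Longrightarrow> \<bar>k\<bar> < d \<Longrightarrow> 0 < Z' k"
    unfolding eventually_at dist_real_def by auto
  have "Z x < Z y" if "0 \<le> x" "x < y" "y \<le> d / 2" for x y
  proof (rule DERIV_pos_imp_increasing[OF that(2)])
    fix z assume z: "x \<le> z" "z \<le> y"
    have "0 < Z' z" using d z that Z'_0 by (cases "z = 0") auto
    thus "\<exists>D. (Z has_real_derivative D) (at z) \<and> 0 < D" using Z_deriv by blast
  qed
  thus ?thesis using d(1) by (intro exI[of _ "d / 2"]) auto
qed

lemma Z_quotient_tendsto: "((\<lambda>k. Z k / k) \<longlongrightarrow> 1) (at 0)"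
  using Z_deriv[of 0] by (simp add: DERIV_def Z'_0)

text \<open>On the negative axis all terms of the series have the same sign, and the linear one is
  \<open>x\<close>. This excludes negative eigenvalues and makes \<open>log_growth\<close> nearly
  tripling.\<close>

lemma Z_neg_ge: "0 \<le> x \<Longrightarrow> x \<le> - Z (- x)"
proof -
  assume x: "0 \<le> x"
  have s: "(\<lambda>n. - (Zcoef n * (- x) ^ n)) sums (- Z (- x))" by (rule sums_minus[OF Zcoef_sums])
  have t: "- (Zcoef n * (- x) ^ n) = (if n = 0 then 0 else coef n * (2 * x) ^ n)" for n
  proof -
    have "(- 2) ^ n * (- x) ^ n = (2 * x) ^ n" unfolding power_mult_distrib[symmetric] by simp
    thus ?thesis by (simp add: Zcoef_def)
  qed
  have "(\<Sum>n\<in>{Suc 0}. - (Zcoef n * (- x) ^ n)) \<le> (\<Sum>n. - (Zcoef n * (- x) ^ n))"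
    using sums_summable[OF s] x coef_nonneg unfolding t by (intro sum_le_suminf) auto
  thus ?thesis using sums_unique[OF s] unfolding t by (simp add: coef_1)
qed

lemma RR_conj: "RR (1 - a) = 1 - (a^3 - a * (1 - p * q)) / (p * q)"
proof -
  define w where "w = p * q"
  have "w \<noteq> 0" using p_pos p_less_1 by (simp add: w_def)
  thus ?thesis unfolding RR_def w_def[symmetric]
    by (simp add: field_simps power2_eq_square power3_eq_cube)
qed

theorem Z_scaling: "Z (c * k) = RR (Z k)"
  unfolding Z_def RR_conj using mc_rec[of "2 * k"] by (simp add: mult.left_commute mult.commute)

lemma Z_scaling_pow: "Z (c ^ n * k) = (RR ^^ n) (Z k)"
proof (induction n)
  case (Suc n)
  have "Z (c ^ Suc n * k) = RR (Z (c ^ n * k))" using Z_scaling[of "c ^ n * k"] by (simp add: mult.assoc)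
  thus ?case using Suc by simp
qed simp

subsection \<open>The eigenvalues\<close>

lemma mc'_nonzero_near:
  assumes "l \<noteq> 0" "\<bar>l\<bar> \<le> 1" "gbound * \<bar>l\<bar> < 1"
  shows "mc' l \<noteq> 0"
  using monodromy_near(5)[OF assms(2)] assms by (auto simp: mc'_def)

lemma mc'_double_rec: "mc' (2 * (c * k)) = 0 \<longleftrightarrow> mc' (2 * k) = 0 \<or> Z k = 1 + q \<or> Z k = 1 - q"
proof -
  have "mc' (2 * (c * k)) = 0 \<longleftrightarrow> mc' (2 * k) = 0 \<or> (mc (2 * k))\<^sup>2 = q\<^sup>2"
    using mc'_rec[of "2 * k"] pq_pos resist_12_pos p_pos p_less_1 by (simp add: mult.left_commute)
  moreover have "(mc (2 * k))\<^sup>2 = q\<^sup>2 \<longleftrightarrow> Z k = 1 + q \<or> Z k = 1 - q"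
    unfolding power2_eq_iff Z_def by auto
  ultimately show ?thesis by simp
qed

lemma scaled_vanishes:
  "0 < d \<Longrightarrow> \<exists>n. \<bar>k / c ^ n\<bar> < d"
proof -
  assume "0 < d"
  have "(\<lambda>n. k * (1 / c) ^ n) \<longlonglongrightarrow> k * 0"
    using scaling_ge_9 by (intro tendsto_mult tendsto_const LIMSEQ_realpow_zero) auto
  hence "\<forall>\<^sub>F n in sequentially. dist (k * (1 / c) ^ n) 0 < d"
    unfolding mult_zero_right using \<open>0 < d\<close> by (rule tendstoD)
  thus ?thesis unfolding eventually_sequentially dist_real_def
    by (auto simp: power_divide)
qed

text \<open>Follow a zero down along \<open>k / c ^ j\<close>. It persists unless a base point is
  hit, but near the origin \<open>mc' l\<close> is \<open>- l\<close> times a number close to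
  \<open>1\<close> and cannot vanish for \<open>l \<noteq> 0\<close>.\<close>

lemma mc'_zero_iff:
  assumes k: "k \<noteq> 0"
  shows "mc' (2 * k) = 0 \<longleftrightarrow> (\<exists>j. Z (k / c ^ Suc j) = 1 + q \<or> Z (k / c ^ Suc j) = 1 - q)"
proof
  have c: "c \<noteq> 0" using scaling_pos by simp
  have rec: "mc' (2 * (k / c ^ j)) = 0 \<longleftrightarrow> mc' (2 * (k / c ^ Suc j)) = 0 \<or>
      Z (k / c ^ Suc j) = 1 + q \<or> Z (k / c ^ Suc j) = 1 - q" for j
    using mc'_double_rec[of "k / c ^ Suc j"] c by simp
  {
    assume 0: "mc' (2 * k) = 0"
    show "\<exists>j. Z (k / c ^ Suc j) = 1 + q \<or> Z (k / c ^ Suc j) = 1 - q"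
    proof (rule ccontr)
      assume "\<not> ?thesis"
      hence n: "mc' (2 * (k / c ^ j)) = 0" for j
        using rec by (induction j) (use 0 in auto)
      obtain n where "\<bar>2 * k / c ^ n\<bar> < min 1 (1 / gbound)"
        using scaled_vanishes[of "min 1 (1 / gbound)" "2 * k"] gbound_pos by auto
      hence "mc' (2 * (k / c ^ n)) \<noteq> 0"
        using k c gbound_pos by (intro mc'_nonzero_near) (auto simp: field_simps)
      thus False using n by simp
    qed
  next
    assume "\<exists>j. Z (k / c ^ Suc j) = 1 + q \<or> Z (k / c ^ Suc j) = 1 - q"
    then obtain j where "mc' (2 * (k / c ^ j)) = 0" using rec by blast
    thus "mc' (2 * k) = 0"
      using rec by (induction j) auto
  }
qed

definition eigenfunction :: "real \<Rightarrow> real \<Rightarrow> real" where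
  "eigenfunction k x = indicator {0..1} x * cosine (2 * k) x"

lemma kernel_op_cong:
  assumes "bounded_measurable f" "bounded_measurable g" "\<And>y. y \<in> {0..1} \<Longrightarrow> f y = g y"
  shows "kernel_op f x = kernel_op g x" "(\<integral>y. f y \<partial>mu) = (\<integral>y. g y \<partial>mu)"
proof -
  have [measurable]: "f \<in> borel_measurable borel" "g \<in> borel_measurable borel"
    using assms(1,2) by (simp_all add: bounded_measurable_def)
  have "AE y in mu. f y = g y" using AE_mu_unit by eventually_elim (rule assms(3))
  thus "kernel_op f x = kernel_op g x" "(\<integral>y. f y \<partial>mu) = (\<integral>y. g y \<partial>mu)"
    unfolding kernel_op_def by (auto intro!: integral_cong_AE elim!: eventually_mono)
qed

text \<open>The integral equation has slope \<open>0\<close> at the left end, which leaves multiples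
  of the cosine solution; the mean-zero condition is slope \<open>0\<close> at the right end. The
  condition on the product treats eigenvalues and other \<open>k\<close> together.\<close>

lemma eigenspace_iff:
  assumes k: "k \<noteq> 0"
  shows "f \<in> eigenspace p k \<longleftrightarrow> (\<exists>s. f = (\<lambda>x. s * eigenfunction k x) \<and> s * mc' (2 * k) = 0)"
proof
  assume "f \<in> eigenspace p k"
  hence "laplacian p f (\<lambda>x. - (k * f x))" by (simp add: eigenspace_def)
  hence cont: "continuous_on {0..1} f" and out: "\<forall>x. x \<notin> {0..1} \<longrightarrow> f x = 0"
    and mean: "(\<integral>y. - (k * f y) \<partial>mu) = 0"
    and eq: "\<forall>x\<in>{0..1}. f x = f 0 + 2 * kernel_op (\<lambda>x. - (k * f x)) x"
    unfolding laplacian_iff by blast+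
  have fm: "f \<in> borel_measurable borel" using cont out by (rule borel_measurable_unit_extension)
  have "\<exists>B. \<forall>x\<in>f ` {0..1}. norm x \<le> B"
    using compact_imp_bounded[OF compact_continuous_image[OF cont compact_Icc]] unfolding bounded_iff .
  hence "\<exists>B. \<forall>x\<in>{0..1}. \<bar>f x\<bar> \<le> B" by (metis imageI real_norm_def)
  hence bm: "bounded_measurable f" using fm by (simp add: bounded_measurable_def)
  have "kernel_op (\<lambda>x. - (k * f x)) x = - k * kernel_op f x" for x
    using kernel_op_lincomb[OF bm bm, of "- k" 0 x] by simp
  hence "\<forall>x\<in>{0..1}. f x = f 0 + 0 * x - 2 * k * kernel_op f x" using eq by (metis add_0_right diff_conv_add_uminus mult.assoc mult_minus_left mult_minus_right mult_zero_left)
  hence sol: "solves (2 * k) (f 0) 0 f" using bm by (simp only: solves_def)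
  have "f x = f 0 * eigenfunction k x" for x
    using solves_eq_cosine_sine[OF sol, of x] out by (cases "x \<in> {0..1}") (auto simp: eigenfunction_def)
  moreover have "(\<integral>y. f y \<partial>mu) = 0" using mean k by simp
  hence "f 0 * mc' (2 * k) = 0" using solves_end(2)[OF sol] by simp
  ultimately show "\<exists>s. f = (\<lambda>x. s * eigenfunction k x) \<and> s * mc' (2 * k) = 0" by blast
next
  assume "\<exists>s. f = (\<lambda>x. s * eigenfunction k x) \<and> s * mc' (2 * k) = 0"
  then obtain s where f: "f = (\<lambda>x. s * eigenfunction k x)" and s: "s * mc' (2 * k) = 0" by blast
  let ?C = "cosine (2 * k)"
  have bC: "bounded_measurable ?C" by (rule solves_bm[OF cosine_solves])
  have Ceq: "?C x = 1 - 2 * k * kernel_op ?C x" if "x \<in> {0..1}" for x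
    using solvesD[OF cosine_solves that, of "2 * k"] by simp
  have fC: "f x = s * ?C x" if "x \<in> {0..1}" for x using that by (simp add: f eigenfunction_def)
  have out: "\<forall>x. x \<notin> {0..1} \<longrightarrow> f x = 0" by (simp add: f eigenfunction_def)
  have "continuous_on {0..1} (\<lambda>x. s * (1 - 2 * k * kernel_op ?C x))"
    by (intro continuous_intros continuous_on_kernel_op bounded_measurable_integrable bC)
  hence cont: "continuous_on {0..1} f"
  proof (rule continuous_on_eq)
    fix x :: real assume "x \<in> {0..1}"
    thus "s * (1 - 2 * k * kernel_op ?C x) = f x" using fC Ceq by simp
  qed
  have fm [measurable]: "f \<in> borel_measurable borel" using cont out by (rule borel_measurable_unit_extension)
  have bsC: "bounded_measurable (\<lambda>x. s * ?C x)"
    using bounded_measurable_lincomb[OF bC bC, of s 0] by simp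
  have "\<exists>B. \<forall>x\<in>{0..1}. \<bar>f x\<bar> \<le> B" using bsC fC unfolding bounded_measurable_def by simp
  hence bm: "bounded_measurable f" using fm by (simp add: bounded_measurable_def)
  have K: "kernel_op f x = s * kernel_op ?C x" for x
    using kernel_op_cong(1)[OF bm bsC fC, of x] kernel_op_lincomb[OF bC bC, of s 0 x] by simp
  have bkf: "bounded_measurable (\<lambda>x. - (k * f x))"
    using bounded_measurable_lincomb[OF bm bm, of "- k" 0] by simp
  have Kk: "kernel_op (\<lambda>x. - (k * f x)) x = - k * kernel_op f x" for x
    using kernel_op_lincomb[OF bm bm, of "- k" 0 x] by simp
  have "f x = f 0 + 2 * kernel_op (\<lambda>x. - (k * f x)) x" if "x \<in> {0..1}" for x
  proof -
    have "f 0 = s" using fC[of 0] Ceq[of 0] by (simp add: kernel_op_0)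
    thus ?thesis unfolding Kk K fC[OF that] Ceq[OF that] by (simp add: algebra_simps)
  qed
  moreover have "(\<integral>y. - (k * f y) \<partial>mu) = 0"
  proof -
    have "(\<integral>y. f y \<partial>mu) = s * (\<integral>y. ?C y \<partial>mu)" using kernel_op_cong(2)[OF bm bsC fC] by simp
    hence "2 * (\<integral>y. - (k * f y) \<partial>mu) = s * mc' (2 * k)" by (simp add: mc'_def)
    thus ?thesis using s by simp
  qed
  moreover have "integrable mu (\<lambda>x. (- (k * f x))\<^sup>2)"
  proof -
    obtain B where B: "\<forall>x\<in>{0..1}. \<bar>- (k * f x)\<bar> \<le> B" using bkf unfolding bounded_measurable_def by (elim conjE exE)
    have "\<bar>(- (k * f x))\<^sup>2\<bar> \<le> B\<^sup>2" if "x \<in> {0<..1}" for x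
    proof -
      have "\<bar>- (k * f x)\<bar> \<le> B" using B that by (intro B[rule_format]) auto
      hence "\<bar>- (k * f x)\<bar>\<^sup>2 \<le> B\<^sup>2" by (intro power_mono) auto
      thus ?thesis by simp
    qed
    thus ?thesis by (intro integrable_bounded[where B = "B\<^sup>2"]) auto
  qed
  moreover have "(\<lambda>x. - (k * f x)) \<in> borel_measurable borel" by measurable
  ultimately have "laplacian p f (\<lambda>x. - (k * f x))" unfolding laplacian_iff using cont out by blast
  thus "f \<in> eigenspace p k" by (simp add: eigenspace_def)
qed

lemma eigenfunction_nonzero: "eigenfunction k \<noteq> (\<lambda>x. 0)"
proof -
  have "eigenfunction k 0 = 1"
    using solvesD[OF cosine_solves, of 0 "2 * k"] by (simp add: eigenfunction_def kernel_op_0)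
  thus ?thesis by (metis zero_neq_one)
qed

lemma nonzero_eigenvalues_iff_mc': "k \<in> nonzero_eigenvalues p \<longleftrightarrow> k \<noteq> 0 \<and> mc' (2 * k) = 0"
proof (cases "k = 0")
  case False
  show ?thesis
  proof
    assume "k \<in> nonzero_eigenvalues p"
    then obtain f where "f \<in> eigenspace p k" "f \<noteq> (\<lambda>x. 0)" by (auto simp: nonzero_eigenvalues_def)
    then obtain s where "f = (\<lambda>x. s * eigenfunction k x)" "s * mc' (2 * k) = 0" "f \<noteq> (\<lambda>x. 0)"
      unfolding eigenspace_iff[OF False] by blast
    thus "k \<noteq> 0 \<and> mc' (2 * k) = 0" using False by auto
  next
    assume "k \<noteq> 0 \<and> mc' (2 * k) = 0"
    hence "eigenfunction k \<in> eigenspace p k" unfolding eigenspace_iff[OF False]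
      by (intro exI[of _ 1]) simp
    thus "k \<in> nonzero_eigenvalues p"
      using False eigenfunction_nonzero[of k] by (auto simp: nonzero_eigenvalues_def)
  qed
qed (simp add: nonzero_eigenvalues_def)

lemma multiplicity_one:
  assumes "k \<in> nonzero_eigenvalues p" shows "multiplicity_ev p k = 1"
proof -
  interpret vs: vector_space "\<lambda>(a::real) (f::real \<Rightarrow> real) x. a * f x" by (rule vector_space_real_fun)
  have k: "k \<noteq> 0" "mc' (2 * k) = 0" using assms by (auto simp: nonzero_eigenvalues_iff_mc')
  have "eigenspace p k = range (\<lambda>s x. s * eigenfunction k x)"
    using k(2) eigenspace_iff[OF k(1)] by auto
  also have "\<dots> = vs.span {eigenfunction k}" by (simp add: vs.span_singleton)
  finally have "multiplicity_ev p k = vs.dim (vs.span {eigenfunction k})"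
    by (simp add: multiplicity_ev_def)
  also have "\<dots> = card {eigenfunction k}"
    using eigenfunction_nonzero[of k]
    by (intro vs.dim_span_eq_card_independent) (simp add: zero_fun_def)
  finally show ?thesis by simp
qed

theorem nonzero_eigenvalues_eq:
  "nonzero_eigenvalues p = {k. k \<noteq> 0 \<and> (\<exists>j. Z (k / c ^ Suc j) = 1 + q \<or> Z (k / c ^ Suc j) = 1 - q)}"
  using nonzero_eigenvalues_iff_mc' mc'_zero_iff by blast

end

locale self_similar_interval_asym = self_similar_interval +
  assumes p_neq_half: "p \<noteq> 1 / 2"
begin

subsection \<open>Level sets\<close>

text \<open>With \<open>lo\<close> and \<open>hi\<close> the points
  \<open>0 < lo < hi < 1 + lo < 1 + hi < 2\<close>, where \<open>RR\<close> takes the values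
  \<open>0, 2, 2, 0, 0, 2\<close>, come in one fixed order, whichever of \<open>p\<close> and
  \<open>q\<close> is smaller.\<close>

definition lo :: real where "lo = min p q"
definition hi :: real where "hi = max p q"

lemma lo_hi: "0 < lo" "lo < 1 / 2" "hi = 1 - lo" "lo * hi = p * q"
  using p_pos p_less_1 p_neq_half unfolding lo_def hi_def by (auto simp: min_def max_def)

lemma lo_hi_pos: "0 < lo * hi"
  using lo_hi(1-3) by (intro mult_pos_pos) auto

lemma RR_zeros: "RR z = z * (1 + lo - z) * (1 + hi - z) / (lo * hi)"
  unfolding RR_def lo_hi(4)[symmetric] lo_hi(3)
  by (rule arg_cong[where f = "\<lambda>t. t / (lo * (1 - lo))"]) (simp add: power2_eq_square algebra_simps)

lemma RR_twos: "2 - RR z = (2 - z) * (lo - z) * (hi - z) / (lo * hi)"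
proof -
  have n: "lo * hi \<noteq> 0" using lo_hi by auto
  have "2 - RR z = (2 * (lo * hi) - z * (1 + lo - z) * (1 + hi - z)) / (lo * hi)"
    unfolding RR_zeros using n by (simp add: diff_divide_distrib)
  also have "2 * (lo * hi) - z * (1 + lo - z) * (1 + hi - z) = (2 - z) * (lo - z) * (hi - z)"
    unfolding lo_hi(3) by (simp add: algebra_simps)
  finally show ?thesis .
qed

lemma RR_special: "RR lo = 2" "RR hi = 2" "RR (1 + lo) = 0" "RR (1 + hi) = 0" "RR 0 = 0" "RR 2 = 2"
  using RR_twos[of lo] RR_twos[of hi] RR_zeros[of "1 + lo"] RR_zeros[of "1 + hi"] RR_zeros[of 0] RR_twos[of 2]
  by simp_all

lemma RR_cont: "continuous_on A RR"
  unfolding RR_def divide_inverse by (intro continuous_intros)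

lemma RR_le_0: "z \<le> 0 \<Longrightarrow> RR z \<le> 0"
proof -
  assume z: "z \<le> 0"
  have "0 \<le> (1 + lo - z) * (1 + hi - z)" using z lo_hi by (intro mult_nonneg_nonneg) auto
  hence "z * ((1 + lo - z) * (1 + hi - z)) \<le> 0" using z by (intro mult_nonpos_nonneg) auto
  thus ?thesis unfolding RR_zeros by (intro divide_nonpos_pos lo_hi_pos) (simp add: mult.assoc)
qed

lemma RR_ge_2: "2 \<le> z \<Longrightarrow> 2 \<le> RR z"
proof -
  assume z: "2 \<le> z"
  have "0 \<le> (lo - z) * (hi - z)" using z lo_hi by (intro mult_nonpos_nonpos) auto
  hence "(2 - z) * ((lo - z) * (hi - z)) \<le> 0" using z by (intro mult_nonpos_nonneg) auto
  hence "2 - RR z \<le> 0" unfolding RR_twos by (intro divide_nonpos_pos lo_hi_pos) (simp add: mult.assoc)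
  thus ?thesis by simp
qed

text \<open>Up to the factor \<open>lo * hi\<close>, \<open>Q\<close> is the difference quotient of
  \<open>RR\<close>. On \<open>[0, lo]\<close> it is smallest at the corner \<open>(lo, lo)\<close>,
  where it is positive because \<open>lo < 1 / 2\<close>.\<close>

lemma RR_increasing:
  assumes "0 \<le> x" "x < y" "y \<le> lo"
  shows "RR x < RR y"
proof -
  define Q where "Q x y = x\<^sup>2 + x * y + y\<^sup>2 - 3 * (x + y) + 2 + lo * hi" for x y
  have "Q lo lo = (1 - 2 * lo) * (2 - lo)"
    unfolding Q_def lo_hi(3) by (simp add: power2_eq_square algebra_simps)
  hence "0 < Q lo lo" using lo_hi by simp
  moreover have "Q x y - Q lo lo = (lo - x)\<^sup>2 + (lo - x) * (lo - y) + (lo - y)\<^sup>2 + ((lo - x) + (lo - y)) * (3 - 3 * lo)"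
    unfolding Q_def by (simp add: power2_eq_square algebra_simps)
  moreover have "0 \<le> \<dots>" using assms lo_hi by (intro add_nonneg_nonneg mult_nonneg_nonneg) auto
  ultimately have "0 < Q x y" by linarith
  moreover have "RR y - RR x = (y - x) * Q x y / (lo * hi)"
    unfolding RR_def Q_def lo_hi(4) diff_divide_distrib[symmetric]
    by (rule arg_cong[where f = "\<lambda>t. t / (p * q)"]) (simp add: power2_eq_square algebra_simps)
  ultimately have "0 < RR y - RR x" using assms lo_hi_pos by simp
  thus ?thesis by simp
qed

text \<open>Both linear factors are at least \<open>1\<close> on \<open>[0, lo]\<close>, and
  \<open>lo * hi \<le> 1 / 4\<close>. Iteration therefore leaves \<open>[0, lo]\<close> after
  finitely many steps from any positive start.\<close>

lemma RR_growth: "0 \<le> z \<Longrightarrow> z \<le> lo \<Longrightarrow> 4 * z \<le> RR z"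
proof -
  assume z: "0 \<le> z" "z \<le> lo"
  have "lo * hi \<le> 1 / 4"
  proof -
    have "0 \<le> (2 * lo - 1)\<^sup>2" by simp
    thus ?thesis unfolding lo_hi(3) by (simp add: power2_eq_square algebra_simps)
  qed
  moreover have "1 * 1 \<le> (1 + lo - z) * (1 + hi - z)" using z lo_hi by (intro mult_mono) auto
  ultimately have "4 * (lo * hi) \<le> (1 + lo - z) * (1 + hi - z)" by linarith
  hence "z * (4 * (lo * hi)) \<le> z * ((1 + lo - z) * (1 + hi - z))" using z by (intro mult_left_mono) auto
  thus ?thesis unfolding RR_zeros using lo_hi_pos by (simp add: pos_le_divide_eq mult_ac)
qed

text \<open>On \<open>[0, c * d]\<close> the function is \<open>RR\<close> after
  \<open>Z (x / c)\<close>; monotonicity spreads by a factor \<open>c\<close> as long as the inner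
  values stay on the first increasing branch.\<close>

lemma Z_inc_scale:
  assumes inc: "\<And>x y. 0 \<le> x \<Longrightarrow> x < y \<Longrightarrow> y \<le> d \<Longrightarrow> Z x < Z y" and d: "0 \<le> d" "Z d \<le> lo"
    and xy: "0 \<le> x" "x < y" "y \<le> c * d"
  shows "Z x < Z y"
proof -
  have c: "0 < c" by (rule scaling_pos)
  let ?x = "x / c" and ?y = "y / c"
  have *: "0 \<le> ?x" "?x < ?y" "?y \<le> d" using xy c by (auto simp: field_simps)
  have "Z ?y \<le> Z d" using inc[of ?y d] * by (cases "?y = d") auto
  moreover have "Z 0 \<le> Z ?x" using inc[of 0 ?x] * by (cases "?x = 0") auto
  ultimately have "RR (Z ?x) < RR (Z ?y)" using inc[OF *] d by (intro RR_increasing) auto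
  thus ?thesis using Z_scaling[of ?x] Z_scaling[of ?y] c by simp
qed

text \<open>Monotonicity near \<open>0\<close> is spread outwards. As long as \<open>Z\<close> stays
  below \<open>lo\<close> it grows by a factor \<open>4\<close> per step, so it must reach
  \<open>lo\<close>, say at \<open>k\<close>. One last step gives \<open>c * k\<close>, with value
  \<open>RR lo = 2\<close>.\<close>

lemma ex_kap: "\<exists>k>0. (\<forall>x y. 0 \<le> x \<longrightarrow> x < y \<longrightarrow> y \<le> k \<longrightarrow> Z x < Z y) \<and> Z k = 2 \<and> Z (k / c) = lo"
proof -
  have c: "1 < c" by (rule scaling_gt_1)
  obtain d where d: "0 < d" and inc: "\<And>x y. 0 \<le> x \<Longrightarrow> x < y \<Longrightarrow> y \<le> d \<Longrightarrow> Z x < Z y"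
    using Z_locally_increasing by blast
  have "\<exists>e>0. (\<forall>x y. 0 \<le> x \<longrightarrow> x < y \<longrightarrow> y \<le> e \<longrightarrow> Z x < Z y) \<and> lo \<le> Z e"
  proof (rule ccontr)
    assume no: "\<not> ?thesis"
    have "(\<forall>x y. 0 \<le> x \<longrightarrow> x < y \<longrightarrow> y \<le> c ^ n * d \<longrightarrow> Z x < Z y) \<and> 4 ^ n * Z d \<le> Z (c ^ n * d)" for n
    proof (induction n)
      case 0 thus ?case using inc by simp
    next
      case (Suc n)
      let ?e = "c ^ n * d"
      have e: "0 < ?e" using c d by simp
      hence le: "Z ?e \<le> lo" using no Suc by fastforce
      have ge: "0 \<le> Z ?e" using Suc e Z_0 by (metis less_imp_le order_refl)
      have "\<forall>x y. 0 \<le> x \<longrightarrow> x < y \<longrightarrow> y \<le> c * ?e \<longrightarrow> Z x < Z y"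
      proof (intro allI impI)
        fix x y assume xy: "0 \<le> x" "x < y" "y \<le> c * ?e"
        show "Z x < Z y" by (rule Z_inc_scale[OF _ _ le xy]) (use Suc e in auto)
      qed
      moreover have "4 ^ Suc n * Z d \<le> 4 * Z ?e" using Suc by simp
      hence "4 ^ Suc n * Z d \<le> Z (c * ?e)" using RR_growth[OF ge le] Z_scaling[of ?e] by simp
      ultimately show ?case by (simp add: mult.assoc)
    qed
    note * = this
    have "0 < Z d" using inc[of 0 d] d by simp
    then obtain n where "lo / Z d < 4 ^ n" using real_arch_pow[of 4 "lo / Z d"] by auto
    hence "lo < 4 ^ n * Z d" using \<open>0 < Z d\<close> by (simp add: field_simps)
    hence "lo \<le> Z (c ^ n * d)" using *[of n] by linarith
    moreover have "0 < c ^ n * d" using c d by simp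
    ultimately show False using no *[of n] by blast
  qed
  then obtain e where e: "0 < e" "lo \<le> Z e"
    and inc: "\<And>x y. 0 \<le> x \<Longrightarrow> x < y \<Longrightarrow> y \<le> e \<Longrightarrow> Z x < Z y" by blast
  obtain k where k: "0 \<le> k" "k \<le> e" "Z k = lo"
    using IVT'[of Z 0 lo e] e lo_hi continuous_on_Z by auto
  have "0 < k" using k lo_hi by (cases "k = 0") auto
  have "Z x < Z y" if "0 \<le> x" "x < y" "y \<le> c * k" for x y
    by (rule Z_inc_scale[of k, OF inc]) (use k that in auto)
  moreover have "Z (c * k) = 2" using Z_scaling[of k] k RR_special by simp
  ultimately show ?thesis using \<open>0 < k\<close> k c by (intro exI[of _ "c * k"]) auto
qed

definition kap :: real where
  "kap = (SOME k. k > 0 \<and> (\<forall>x y. 0 \<le> x \<longrightarrow> x < y \<longrightarrow> y \<le> k \<longrightarrow> Z x < Z y) \<and> Z k = 2 \<and> Z (k / c) = lo)"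

lemma kap: "0 < kap" "\<And>x y. 0 \<le> x \<Longrightarrow> x < y \<Longrightarrow> y \<le> kap \<Longrightarrow> Z x < Z y" "Z kap = 2" "Z (kap / c) = lo"
  using someI_ex[OF ex_kap] unfolding kap_def by blast+

lemma Z_le: "0 \<le> x \<Longrightarrow> x \<le> y \<Longrightarrow> y \<le> kap \<Longrightarrow> Z x \<le> Z y"
  using kap(2)[of x y] by (cases "x = y") auto

lemma Z_pos: "0 < x \<Longrightarrow> x \<le> kap \<Longrightarrow> 0 < Z x"
  using kap(2)[of 0 x] by simp

definition level_set :: "real \<Rightarrow> real set" where "level_set z0 = {k. 0 < k \<and> Z k = z0}"

definition preimages :: "nat \<Rightarrow> real \<Rightarrow> real set" where
  "preimages n z0 = {z \<in> {0<..<2}. (RR ^^ n) z = z0}"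

text \<open>The degree allows at most three solutions; the intermediate value theorem gives one on
  each of the branches \<open>(0, lo)\<close>, \<open>(hi, 1 + lo)\<close> and
  \<open>(1 + hi, 2)\<close>.\<close>

lemma RR_fibre_card:
  assumes w: "w \<in> {0<..<2}"
  shows "finite {z \<in> {0<..<2}. RR z = w}" "card {z \<in> {0<..<2}. RR z = w} = 3"
proof -
  let ?A = "{z \<in> {0<..<2}. RR z = w}" and ?P = "[:- (w * (p * q)), 2 + p * q, - 3, 1:]"
  have P: "?P \<noteq> 0" "degree ?P = 3" by simp_all
  have n: "p * q \<noteq> 0" using p_pos p_less_1 by simp
  have "RR z = w \<longleftrightarrow> poly ?P z = 0" for z
    unfolding RR_def using n by (simp add: divide_eq_eq algebra_simps power2_eq_square power3_eq_cube)
  hence sub: "?A \<subseteq> {z. poly ?P z = 0}" by auto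
  have fin: "finite {z. poly ?P z = 0}" by (rule poly_roots_finite[OF P(1)])
  show "finite ?A" using sub fin by (rule finite_subset)
  have "card ?A \<le> 3" using card_mono[OF fin sub] card_poly_roots_bound[OF P(1)] unfolding P(2) by linarith
  have ivt: "\<exists>z. a < z \<and> z < b \<and> RR z = w"
    if "a < b" "RR a = 0 \<and> RR b = 2 \<or> RR a = 2 \<and> RR b = 0" for a b
  proof -
    have "\<exists>z\<ge>a. z \<le> b \<and> RR z = w"
      using that w IVT'[of RR a w b] IVT2'[of RR b w a] RR_cont by auto
    thus ?thesis using that w by (metis greaterThanLessThan_iff less_eq_real_def less_irrefl)
  qed
  obtain z1 z2 z3 where z: "0 < z1" "z1 < lo" "RR z1 = w" "hi < z2" "z2 < 1 + lo" "RR z2 = w"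
    "1 + hi < z3" "z3 < 2" "RR z3 = w"
    using ivt[of 0 lo] ivt[of hi "1 + lo"] ivt[of "1 + hi" 2] lo_hi(1-3) RR_special by auto
  have "{z1, z2, z3} \<subseteq> ?A" "card {z1, z2, z3} = 3" using z lo_hi(1-3) by auto
  hence "3 \<le> card ?A" using card_mono[OF \<open>finite ?A\<close>] by metis
  thus "card ?A = 3" using \<open>card ?A \<le> 3\<close> by simp
qed

lemma RR_iter_le_0: "z \<le> 0 \<Longrightarrow> (RR ^^ n) z \<le> 0"
  by (induction n) (auto intro: RR_le_0)

lemma RR_iter_ge_2: "2 \<le> z \<Longrightarrow> 2 \<le> (RR ^^ n) z"
  by (induction n) (auto intro: RR_ge_2)

lemma preimages_card:
  assumes z0: "z0 \<in> {0<..<2}"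
  shows "finite (preimages n z0) \<and> card (preimages n z0) = 3 ^ n"
proof (induction n)
  case 0
  have "preimages 0 z0 = {z0}" using z0 by (auto simp: preimages_def)
  thus ?case by simp
next
  case (Suc n)
  let ?f = "\<lambda>w. {z \<in> {0<..<2}. RR z = w}"
  have "(RR ^^ Suc n) z = (RR ^^ n) (RR z)" for z by (simp add: funpow_swap1)
  hence eq: "preimages (Suc n) z0 = (\<Union>w\<in>preimages n z0. ?f w)"
  proof -
    \<comment> \<open>Both half-lines outside the interval are forward invariant, so an orbit that
      ends inside has never left.\<close>
    have "RR z \<in> {0<..<2}" if "(RR ^^ n) (RR z) = z0" for z
      using RR_iter_le_0[of "RR z" n] RR_iter_ge_2[of "RR z" n] that z0 by force
    thus ?thesis using \<open>\<And>z. (RR ^^ Suc n) z = _\<close> unfolding preimages_def by auto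
  qed
  have in02: "w \<in> {0<..<2}" if "w \<in> preimages n z0" for w using that by (auto simp: preimages_def)
  have "card (\<Union>w\<in>preimages n z0. ?f w) = (\<Sum>w\<in>preimages n z0. card (?f w))"
    using Suc RR_fibre_card(1)[OF in02] by (intro card_UN_disjoint) auto
  also have "\<dots> = (\<Sum>w\<in>preimages n z0. 3)" using RR_fibre_card(2)[OF in02] by (intro sum.cong refl)
  finally show ?case unfolding eq using Suc RR_fibre_card(1)[OF in02] by (simp add: mult.commute)
qed

text \<open>\<open>Z\<close> maps \<open>(0, kap)\<close> bijectively onto \<open>(0, 2)\<close> and
  turns multiplication by \<open>c ^ n\<close> into the \<open>n\<close>-th iterate of
  \<open>RR\<close>.\<close>

lemma level_set_bij:
  assumes z0: "z0 \<in> {0<..<2}"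
  shows "bij_betw (\<lambda>k. Z (k / c ^ n)) (level_set z0 \<inter> {..c ^ n * kap}) (preimages n z0)"
proof (rule bij_betw_imageI)
  have c: "0 < c ^ n" using scaling_pos by simp
  have iter: "(RR ^^ n) (Z (k / c ^ n)) = Z k" for k
  proof -
    have "c ^ n * (k / c ^ n) = k" using c by (metis less_irrefl nonzero_mult_div_cancel_left times_divide_eq_right)
    thus ?thesis using Z_scaling_pow[of n "k / c ^ n"] by simp
  qed
  show "inj_on (\<lambda>k. Z (k / c ^ n)) (level_set z0 \<inter> {..c ^ n * kap})"
  proof (rule inj_onI, rule ccontr)
    fix x y assume x: "x \<in> level_set z0 \<inter> {..c ^ n * kap}" and y: "y \<in> level_set z0 \<inter> {..c ^ n * kap}"
      and eq: "Z (x / c ^ n) = Z (y / c ^ n)" and "x \<noteq> y"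
    have b: "0 \<le> x / c ^ n" "x / c ^ n \<le> kap" "0 \<le> y / c ^ n" "y / c ^ n \<le> kap" "x / c ^ n \<noteq> y / c ^ n"
      using x y c scaling_pos \<open>x \<noteq> y\<close> by (auto simp: level_set_def field_simps)
    thus False using kap(2)[of "x / c ^ n" "y / c ^ n"] kap(2)[of "y / c ^ n" "x / c ^ n"] eq
      by (metis less_irrefl linorder_neqE_linordered_idom)
  qed
  show "(\<lambda>k. Z (k / c ^ n)) ` (level_set z0 \<inter> {..c ^ n * kap}) = preimages n z0"
  proof (intro equalityI subsetI)
    fix z assume "z \<in> (\<lambda>k. Z (k / c ^ n)) ` (level_set z0 \<inter> {..c ^ n * kap})"
    then obtain k where k: "0 < k" "Z k = z0" "k \<le> c ^ n * kap" "z = Z (k / c ^ n)"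
      by (auto simp: level_set_def)
    have "(RR ^^ n) z = z0" using iter[of k] k by simp
    moreover have "0 < z" unfolding k(4) using k c by (intro Z_pos) (auto simp: field_simps)
    moreover have "z < 2"
      using RR_iter_ge_2[of z n] \<open>(RR ^^ n) z = z0\<close> z0 by force
    ultimately show "z \<in> preimages n z0" by (simp add: preimages_def)
  next
    fix z assume z: "z \<in> preimages n z0"
    then obtain y where y: "0 \<le> y" "y \<le> kap" "Z y = z"
      using IVT'[of Z 0 z kap] kap continuous_on_Z by (auto simp: preimages_def)
    have "y \<noteq> 0" using y z by (auto simp: preimages_def)
    hence "c ^ n * y \<in> level_set z0 \<inter> {..c ^ n * kap}"
      using y z c iter[of "c ^ n * y"] scaling_pos by (auto simp: level_set_def preimages_def)
    thus "z \<in> (\<lambda>k. Z (k / c ^ n)) ` (level_set z0 \<inter> {..c ^ n * kap})"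
      using y c scaling_pos by (intro image_eqI[of _ _ "c ^ n * y"]) auto
  qed
qed

lemma level_set_card:
  assumes "z0 \<in> {0<..<2}"
  shows "finite (level_set z0 \<inter> {..c ^ n * kap})" "card (level_set z0 \<inter> {..c ^ n * kap}) = 3 ^ n"
  using bij_betw_finite[OF level_set_bij[OF assms, of n]] bij_betw_same_card[OF level_set_bij[OF assms, of n]]
    preimages_card[OF assms, of n] by auto

lemma poly_R_real: "poly (R p) (of_real z) = of_real (RR z)"
  by (simp add: poly_R RR_def)

lemma poly_R_iter_real: "poly (R_iter p n) (of_real z) = of_real ((RR ^^ n) z)"
  unfolding poly_R_iter by (induction n) (simp_all add: poly_R_real)

lemma degree_R_iter: "degree (R_iter p n) = 3 ^ n"
proof (induction n)
  case (Suc n)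
  have "p * (1 - p) \<noteq> 0" using p_pos p_less_1 by simp
  hence "degree (R p) = 3" unfolding R_def by (subst degree_smult_eq) simp
  moreover have "R_iter p (Suc n) = pcompose (R p) (R_iter p n)" by (simp add: R_iter_def)
  ultimately show ?case using Suc by (simp add: degree_pcompose)
qed (simp add: R_iter_def)

lemma degree_R_iter_minus: "degree (R_iter p n - [:w:]) = 3 ^ n"
proof -
  have "degree (R_iter p n + (- [:w:])) = degree (R_iter p n)"
    by (rule degree_add_eq_left) (simp add: degree_R_iter)
  thus ?thesis unfolding degree_R_iter diff_conv_add_uminus .
qed

text \<open>The \<open>3 ^ n\<close> real preimages already exhaust the degree, so no other complex
  root exists and all of these are simple.\<close>

lemma proots_R_iter:
  assumes z0: "z0 \<in> {0<..<2}"
  shows "proots (R_iter p n - [:of_real z0:]) = image_mset of_real (mset_set (preimages n z0))"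
proof -
  let ?P = "R_iter p n - [:of_real z0:]" and ?A = "of_real ` preimages n z0 :: complex set"
  have P: "?P \<noteq> 0" using degree_R_iter_minus[of n "of_real z0"] by auto
  note card = preimages_card[OF z0, of n]
  have root: "poly ?P z = 0" if "z \<in> ?A" for z
    using that by (auto simp: preimages_def poly_R_iter_real)
  have "mset_set ?A \<subseteq># proots ?P"
  proof (rule mset_subset_eqI)
    fix z
    show "count (mset_set ?A) z \<le> count (proots ?P) z"
    proof (cases "z \<in> ?A")
      case True
      hence "0 < order z ?P" using root[OF True] order_root[of ?P z] P by auto
      thus ?thesis using True card P by (simp add: Suc_le_eq)
    qed (use card in simp)
  qed
  moreover have "size (mset_set ?A) = size (proots ?P)"
    using card by (simp add: size_proots_complex degree_R_iter_minus card_image inj_on_def)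
  ultimately have "mset_set ?A = proots ?P" by (metis size_mset_mono mset_subset_size order_less_irrefl subset_mset.order_iff_strict)
  moreover have "mset_set ?A = image_mset of_real (mset_set (preimages n z0))"
    by (rule image_mset_mset_set[symmetric]) (simp add: inj_on_def)
  ultimately show ?thesis by simp
qed

text \<open>The factorisation over the roots, normalised at the fixed point \<open>w = 0\<close>.
  Its limit is the product formula \<open>log_product\<close> for \<open>1 - Z / z0\<close>.\<close>

lemma RR_iter_product:
  assumes z0: "z0 \<in> {0<..<2}"
  shows "1 - (RR ^^ n) w / z0 = (\<Prod>z\<in>preimages n z0. 1 - w / z)"
proof -
  let ?P = "R_iter p n - [:complex_of_real z0:]"
  define L where "L = lead_coeff ?P"
  have P: "?P \<noteq> 0" using degree_R_iter_minus[of n "of_real z0"] by auto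
  hence L: "L \<noteq> 0" unfolding L_def by (rule leading_coeff_neq_0)
  have fact: "?P = smult L (\<Prod>x\<in>#proots ?P. [:- x, 1:])"
    by (rule complex_poly_decompose_multiset[symmetric, of ?P, folded L_def])
  have ev: "poly ?P x = L * (\<Prod>z\<in>preimages n z0. x - of_real z)" for x
    by (subst fact) (simp add: proots_R_iter[OF z0] poly_prod_mset prod_unfold_prod_mset image_mset.compositionality comp_def)
  have nz: "z \<noteq> 0" if "z \<in> preimages n z0" for z using that by (auto simp: preimages_def)
  have "RR 0 = 0" by (simp add: RR_special)
  hence R0: "(RR ^^ n) 0 = 0" by (induction n) auto
  have "complex_of_real ((RR ^^ n) w - z0) / of_real (- z0) = poly ?P (of_real w) / poly ?P 0"
    using poly_R_iter_real[of n w] poly_R_iter_real[of n 0] R0 by simp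
  also have "\<dots> = (\<Prod>z\<in>preimages n z0. (of_real w - of_real z) / (0 - of_real z))"
    unfolding ev prod_dividef using L by simp
  also have "\<dots> = (\<Prod>z\<in>preimages n z0. of_real (1 - w / z))"
    using nz by (intro prod.cong refl) (simp add: field_simps)
  also have "\<dots> = of_real (\<Prod>z\<in>preimages n z0. 1 - w / z)" by simp
  finally have "((RR ^^ n) w - z0) / (- z0) = (\<Prod>z\<in>preimages n z0. 1 - w / z)"
    by (simp only: of_real_divide[symmetric] of_real_eq_iff)
  thus ?thesis using z0 by (simp add: field_simps)
qed

subsection \<open>The zeta function of the polynomial\<close>

text \<open>Half of the dimension: the exponent bound for sums over level sets, whose powers are
  written in the variable \<open>s / 2\<close>.\<close>

definition rho :: real where "rho = ln 3 / ln c"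

text \<open>Strict since \<open>p \<noteq> 1 / 2\<close>. With \<open>9 = 3\<^sup>2\<close> this
  gives \<open>rho < 1 / 2\<close>, that is, dimension below \<open>1\<close>.\<close>

lemma scaling_gt_9: "9 < c"
proof -
  have "0 < (2 * p - 1)\<^sup>2" using p_neq_half by simp
  hence "p * q < 1 / 4" by (simp add: power2_eq_square algebra_simps)
  thus ?thesis using pq_pos by (simp add: scaling_def field_simps)
qed

lemma R_dimension_eq: "R_dimension p = 2 * rho"
  by (simp add: R_dimension_def rho_def)

lemma rho: "0 < rho" "rho < 1 / 2" "c powr rho = 3"
proof -
  have l: "0 < ln c" using scaling_gt_9 by simp
  show "0 < rho" unfolding rho_def using l by simp
  have "2 * ln 3 = ln (9::real)" using ln_realpow[of 3 2] by simp
  also have "\<dots> < ln c" using scaling_gt_9 by simp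
  finally show "rho < 1 / 2" unfolding rho_def using l by (simp add: field_simps)
  show "c powr rho = 3" unfolding rho_def using l scaling_gt_9 by (simp add: powr_def)
qed

lemma scaling_pow_powr: "(c ^ n) powr rho = 3 ^ n"
proof -
  have "(c ^ n) powr rho = (c powr rho) ^ n"
    using scaling_pos by (simp add: powr_realpow[symmetric] powr_powr powr_power mult.commute)
  thus ?thesis by (simp add: rho)
qed

lemma level_set_pos: "k \<in> level_set z0 \<Longrightarrow> 0 < k"
  by (simp add: level_set_def)

lemma level_set_exhaust: "\<exists>n. k \<le> c ^ n * kap"
proof -
  obtain n where "k / kap < c ^ n" using real_arch_pow[OF scaling_gt_1] by blast
  thus ?thesis using kap(1) by (intro exI[of _ n]) (simp add: field_simps)
qed

lemma exhaust_mono: "i \<le> n \<Longrightarrow> c ^ i * kap \<le> c ^ n * kap"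
  using kap(1) scaling_gt_1 by (intro mult_right_mono power_increasing) auto

text \<open>Between \<open>c ^ N * kap\<close> and \<open>c ^ Suc N * kap\<close> there are at most
  \<open>3 ^ Suc N\<close> points, so the shells are dominated by a geometric series of ratio
  \<open>3 * c powr (- s)\<close>, below \<open>1\<close> because
  \<open>c powr rho = 3\<close>.\<close>

lemma level_set_summable:
  assumes z0: "z0 \<in> {0<..<2}" and s: "rho < s"
  shows "(\<lambda>k. k powr (- s)) summable_on level_set z0"
proof (rule nonneg_bdd_above_summable_on)
  have s0: "0 < s" using s rho by simp
  have ratio: "3 * c powr (- s) < 1"
  proof -
    have "3 < c powr s" using s rho(3) scaling_gt_1 by (metis powr_less_cancel_iff)
    moreover have "0 < c powr s" using scaling_gt_1 by simp
    ultimately show ?thesis by (simp add: powr_minus field_simps)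
  qed
  let ?X = "level_set z0" and ?f = "\<lambda>k::real. k powr (- s)"
  define T where "T N = (\<Sum>k\<in>?X \<inter> {..c ^ N * kap}. ?f k)" for N
  define b where "b n = 3 * kap powr (- s) * (3 * c powr (- s)) ^ n" for n
  have fin: "finite (?X \<inter> {..c ^ N * kap})" for N by (rule level_set_card(1)[OF z0])
  have step: "T (Suc N) \<le> T N + b N" for N
  proof -
    let ?A = "?X \<inter> {..c ^ N * kap}" and ?B = "?X \<inter> {..c ^ Suc N * kap}"
    have AB: "?A \<subseteq> ?B" using exhaust_mono[of N "Suc N"] by auto
    have "T (Suc N) = T N + (\<Sum>k\<in>?B - ?A. ?f k)"
      unfolding T_def using sum.subset_diff[OF AB fin, of ?f] by simp
    also have "(\<Sum>k\<in>?B - ?A. ?f k) \<le> (\<Sum>k\<in>?B - ?A. (c ^ N * kap) powr (- s))"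
      using s0 scaling_pos kap(1) by (intro sum_mono powr_mono2') auto
    also have "\<dots> \<le> 3 ^ Suc N * (c ^ N * kap) powr (- s)"
    proof -
      have "card (?B - ?A) \<le> card ?B" by (intro card_mono fin) auto
      hence "card (?B - ?A) \<le> 3 ^ Suc N" unfolding level_set_card(2)[OF z0] .
      hence "real (card (?B - ?A)) \<le> real (3 ^ Suc N)" by (simp only: of_nat_le_iff)
      thus ?thesis by (simp add: mult_right_mono)
    qed
    also have "\<dots> = b N"
    proof -
      have "(c ^ N * kap) powr (- s) = (c powr (- s)) ^ N * kap powr (- s)"
        using scaling_pos kap(1)
        by (simp add: powr_mult powr_realpow[symmetric] powr_powr powr_power mult.commute)
      thus ?thesis by (simp add: b_def power_mult_distrib mult_ac)
    qed
    finally show ?thesis by simp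
  qed
  have sb: "summable b" unfolding b_def using ratio scaling_pos by (intro summable_mult summable_geometric) simp
  have b0: "0 \<le> b n" for n unfolding b_def by simp
  have T: "T N \<le> T 0 + (\<Sum>n<N. b n)" for N
    by (induction N) (use step in \<open>auto intro: order_trans\<close>, smt (verit) step)
  have Tb: "T N \<le> T 0 + suminf b" for N
    using T[of N] sum_le_suminf[OF sb, of "{..<N}"] b0 by simp
  show "bdd_above (sum ?f ` {F. F \<subseteq> ?X \<and> finite F})"
  proof (rule bdd_aboveI2)
    fix F assume "F \<in> {F. F \<subseteq> ?X \<and> finite F}"
    hence F: "F \<subseteq> ?X" "finite F" by auto
    obtain N where N: "Max (insert 0 F) \<le> c ^ N * kap" using level_set_exhaust by blast
    have "F \<subseteq> ?X \<inter> {..c ^ N * kap}"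
      using F N by (auto intro: order_trans[OF Max_ge[of "insert 0 F"] N])
    hence "sum ?f F \<le> T N" unfolding T_def by (intro sum_mono2 fin) auto
    thus "sum ?f F \<le> T 0 + suminf b" using Tb[of N] by simp
  qed
qed auto

lemma level_set_infinite:
  assumes z0: "z0 \<in> {0<..<2}"
  shows "infinite (level_set z0)"
proof
  assume fin: "finite (level_set z0)"
  have "3 ^ n \<le> card (level_set z0)" for n
    unfolding level_set_card(2)[OF z0, symmetric] using fin by (intro card_mono) auto
  from this[of "card (level_set z0)"] show False using less_exp[of "card (level_set z0)"]
    by (metis less_le_trans not_less numeral_le_iff power_mono semiring_norm(68) semiring_norm(72) zero_le_numeral)
qed

lemma level_set_countable:
  assumes z0: "z0 \<in> {0<..<2}"
  shows "countable (level_set z0)"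
proof -
  have "level_set z0 = (\<Union>n. level_set z0 \<inter> {..c ^ n * kap})" using level_set_exhaust by auto
  moreover have "countable (\<Union>n. level_set z0 \<inter> {..c ^ n * kap})"
    using level_set_card(1)[OF z0] by (intro countable_UN) (auto intro: countable_finite)
  ultimately show ?thesis by metis
qed

lemma level_set_enum:
  assumes z0: "z0 \<in> {0<..<2}"
  shows "bij_betw (from_nat_into (level_set z0)) UNIV (level_set z0)"
  by (rule bij_betw_from_nat_into[OF level_set_countable[OF z0] level_set_infinite[OF z0]])

lemma level_set_enum_summable:
  assumes z0: "z0 \<in> {0<..<2}" and s: "rho < s"
  shows "summable (\<lambda>j. from_nat_into (level_set z0) j powr (- s))"
  using level_set_summable[OF assms]
  unfolding summable_on_reindex_bij_betw[OF level_set_enum[OF z0], symmetric]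
  by (rule summable_on_imp_summable)

text \<open>Dominated convergence for sums whose range grows with \<open>n\<close>. The bound is
  asked only for \<open>k \<le> c ^ n * kap\<close>, because \<open>Z (k / c ^ n)\<close> is bounded
  below linearly only while its argument is in \<open>[0, kap]\<close>. It serves the powers in
  \<open>R_zeta_limit\<close> and the logarithms in \<open>log_product\<close>.\<close>

lemma level_set_tannery:
  fixes a :: "nat \<Rightarrow> real \<Rightarrow> 'a :: {banach, real_normed_algebra}"
  assumes z0: "z0 \<in> {0<..<2}" and s: "rho < s"
    and lim: "\<And>k. k \<in> level_set z0 \<Longrightarrow> (\<lambda>n. a n k) \<longlonglongrightarrow> f k"
    and bd: "\<And>n k. k \<in> level_set z0 \<Longrightarrow> k \<le> c ^ n * kap \<Longrightarrow> norm (a n k) \<le> M * k powr (- s)"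
    and M: "0 \<le> M"
  shows "summable (\<lambda>j. norm (f (from_nat_into (level_set z0) j)))"
    and "(\<lambda>n. \<Sum>k\<in>level_set z0 \<inter> {..c ^ n * kap}. a n k) \<longlonglongrightarrow> (\<Sum>j. f (from_nat_into (level_set z0) j))"
proof -
  let ?X = "level_set z0" and ?e = "from_nat_into (level_set z0)"
  note bij = level_set_enum[OF z0]
  have eX: "?e j \<in> ?X" for j using bij_betwE[OF bij] by blast
  define b where "b j n = (if ?e j \<le> c ^ n * kap then a n (?e j) else 0)" for j n
  have "(\<forall>\<^sub>F n in sequentially. summable (\<lambda>j. norm (b j n))) \<and>
       summable (\<lambda>j. norm (f (?e j))) \<and> ((\<lambda>n. \<Sum>j. b j n) \<longlongrightarrow> (\<Sum>j. f (?e j))) sequentially"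
  proof (rule tannerys_theorem[where a = b and b = "\<lambda>j. f (?e j)" and F = sequentially
        and M = "\<lambda>j. M * ?e j powr (- s)"])
    show "(b j \<longlongrightarrow> f (?e j)) sequentially" for j
    proof (rule Lim_transform_eventually[OF lim[OF eX]])
      obtain N where "?e j \<le> c ^ N * kap" using level_set_exhaust by blast
      hence "?e j \<le> c ^ n * kap" if "n \<ge> N" for n using exhaust_mono[OF that] by linarith
      thus "\<forall>\<^sub>F n in sequentially. a n (?e j) = b j n"
        unfolding eventually_sequentially b_def by auto
    qed
    show "\<forall>\<^sub>F (j, n) in sequentially \<times>\<^sub>F sequentially. norm (b j n) \<le> M * ?e j powr (- s)"
      using bd[OF eX] M by (intro always_eventually) (auto simp: b_def)
    show "summable (\<lambda>j. M * ?e j powr (- s))"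
      by (intro summable_mult level_set_enum_summable[OF z0 s])
  qed simp
  moreover have "(\<Sum>j. b j n) = (\<Sum>k\<in>?X \<inter> {..c ^ n * kap}. a n k)" for n
  proof -
    let ?J = "{j. ?e j \<le> c ^ n * kap}"
    have b': "bij_betw ?e ?J (?X \<inter> {..c ^ n * kap})"
      using bij unfolding bij_betw_def by (auto simp: inj_on_def)
    have "finite ?J" using bij_betw_finite[OF b'] level_set_card(1)[OF z0] by simp
    hence "(\<Sum>j. b j n) = (\<Sum>j\<in>?J. b j n)" by (rule suminf_finite) (simp add: b_def)
    also have "\<dots> = (\<Sum>j\<in>?J. a n (?e j))" by (intro sum.cong refl) (simp add: b_def)
    also have "\<dots> = (\<Sum>k\<in>?X \<inter> {..c ^ n * kap}. a n k)" by (rule sum.reindex_bij_betw[OF b'])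
    finally show ?thesis .
  qed
  ultimately show "summable (\<lambda>j. norm (f (?e j)))"
    "(\<lambda>n. \<Sum>k\<in>?X \<inter> {..c ^ n * kap}. a n k) \<longlonglongrightarrow> (\<Sum>j. f (?e j))" by simp_all
qed

lemma Z_lower: "\<exists>\<alpha>>0. \<forall>x. 0 \<le> x \<longrightarrow> x \<le> kap \<longrightarrow> \<alpha> * x \<le> Z x"
proof -
  have "\<forall>\<^sub>F k in at 0. 1 / 2 < Z k / k" using Z_quotient_tendsto by (rule order_tendstoD) simp
  then obtain d where d: "d > 0" "\<And>k. k \<noteq> 0 \<Longrightarrow> \<bar>k\<bar> < d \<Longrightarrow> 1 / 2 < Z k / k"
    unfolding eventually_at dist_real_def by auto
  define e where "e = min d kap / 2"
  have e: "0 < e" "e < d" "e < kap" using d kap(1) by (auto simp: e_def min_def)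
  have Ze: "e / 2 < Z e" using d(2)[of e] e by (simp add: field_simps)
  \<comment> \<open>Below \<open>e\<close> the quotient \<open>Z x / x\<close> exceeds
    \<open>1 / 2\<close>; above it \<open>Z x \<ge> Z e\<close> while
    \<open>x \<le> kap\<close>.\<close>
  define \<alpha> where "\<alpha> = min (1 / 2) (Z e / kap)"
  have "\<alpha> * x \<le> Z x" if x: "0 \<le> x" "x \<le> kap" for x
  proof (cases "x < e")
    case True
    show ?thesis
    proof (cases "x = 0")
      case False
      hence "1 / 2 * x \<le> Z x" using d(2)[of x] True e x by (simp add: field_simps)
      moreover have "\<alpha> * x \<le> 1 / 2 * x" using x
        unfolding \<alpha>_def by (intro mult_right_mono min.cobounded1)
      ultimately show ?thesis by simp
    qed simp
  next
    case False
    have "\<alpha> * x \<le> Z e / kap * kap" using x e Ze kap(1) by (intro mult_mono) (auto simp: \<alpha>_def)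
    also have "\<dots> = Z e" using kap(1) by simp
    also have "\<dots> \<le> Z x" using False x e by (intro Z_le) auto
    finally show ?thesis .
  qed
  moreover have "0 < \<alpha>" using Ze e kap(1) by (auto simp: \<alpha>_def)
  ultimately show ?thesis by blast
qed

text \<open>The linearisation at the fixed point. As \<open>Z' 0 = 1\<close>, the rescaled preimages
  tend to the points of the level set themselves, with no extra constant.\<close>

lemma Z_rescaled_tendsto: "(\<lambda>n. c ^ n * Z (k / c ^ n)) \<longlonglongrightarrow> k"
proof (cases "k = 0")
  case False
  have c: "c ^ n \<noteq> 0" for n using scaling_pos by simp
  have "(\<lambda>n. k * (1 / c) ^ n) \<longlonglongrightarrow> k * 0"
    using scaling_gt_1 by (intro tendsto_mult tendsto_const LIMSEQ_realpow_zero) auto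
  hence "(\<lambda>n. k / c ^ n) \<longlonglongrightarrow> 0" by (simp add: power_divide)
  hence "filterlim (\<lambda>n. k / c ^ n) (at 0) sequentially"
    using False c by (simp add: filterlim_at)
  hence "(\<lambda>n. Z (k / c ^ n) / (k / c ^ n)) \<longlonglongrightarrow> 1"
    by (rule filterlim_compose[OF Z_quotient_tendsto])
  hence "(\<lambda>n. k * (Z (k / c ^ n) / (k / c ^ n))) \<longlonglongrightarrow> k * 1" by (intro tendsto_mult tendsto_const)
  moreover have "k * (Z (k / c ^ n) / (k / c ^ n)) = c ^ n * Z (k / c ^ n)" for n using False by simp
  ultimately show ?thesis by simp
qed simp

lemma Z_rescaled_lower:
  obtains \<alpha> where "0 < \<alpha>" "\<And>n k. 0 \<le> k \<Longrightarrow> k \<le> c ^ n * kap \<Longrightarrow> \<alpha> * k \<le> c ^ n * Z (k / c ^ n)"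
proof -
  obtain \<alpha> where a: "0 < \<alpha>" "\<And>x. 0 \<le> x \<Longrightarrow> x \<le> kap \<Longrightarrow> \<alpha> * x \<le> Z x" using Z_lower by blast
  have "\<alpha> * k \<le> c ^ n * Z (k / c ^ n)" if "0 \<le> k" "k \<le> c ^ n * kap" for n k
  proof -
    have c: "0 < c ^ n" using scaling_pos by simp
    have "\<alpha> * (k / c ^ n) \<le> Z (k / c ^ n)" using that c by (intro a) (auto simp: field_simps)
    thus ?thesis using c by (simp add: field_simps)
  qed
  thus ?thesis using a(1) that by blast
qed

text \<open>The argument is the exponent itself, so the zeta functions of the statement are obtained
  at \<open>s / 2\<close>. The enumeration gives a series, to which Tannery's theorem and termwise
  integration apply.\<close>

definition level_zeta :: "real \<Rightarrow> complex \<Rightarrow> complex" where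
  "level_zeta z0 s = (\<Sum>j. of_real (from_nat_into (level_set z0) j) powr (- s))"

lemma R_zeta_approx_eq:
  assumes z0: "z0 \<in> {0<..<2}"
  shows "R_zeta_approx p (of_real z0) s n =
    (\<Sum>k\<in>level_set z0 \<inter> {..c ^ n * kap}. of_real (c ^ n * Z (k / c ^ n)) powr (- s / 2))"
proof -
  have "R_zeta_approx p (of_real z0) s n =
      (\<Sum>z\<in>preimages n z0. of_real (c ^ n * z) powr (- s / 2))"
    unfolding R_zeta_approx_def proots_R_iter[OF z0]
    by (simp add: image_mset.compositionality comp_def sum_unfold_sum_mset)
  also have "\<dots> = (\<Sum>k\<in>level_set z0 \<inter> {..c ^ n * kap}. of_real (c ^ n * Z (k / c ^ n)) powr (- s / 2))"
    by (rule sum.reindex_bij_betw[OF level_set_bij[OF z0], symmetric])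
  finally show ?thesis .
qed

lemma R_zeta_limit:
  assumes z0: "z0 \<in> {0<..<2}" and s: "2 * rho < Re s"
  shows "summable (\<lambda>j. norm (complex_of_real (from_nat_into (level_set z0) j) powr (- s / 2)))"
    and "R_zeta_approx p (of_real z0) s \<longlonglongrightarrow> level_zeta z0 (s / 2)"
proof -
  obtain \<alpha> where a: "0 < \<alpha>" "\<And>n k. 0 \<le> k \<Longrightarrow> k \<le> c ^ n * kap \<Longrightarrow> \<alpha> * k \<le> c ^ n * Z (k / c ^ n)"
    using Z_rescaled_lower by blast
  define A where "A n k = complex_of_real (c ^ n * Z (k / c ^ n)) powr (- s / 2)" for n k
  have s': "rho < Re s / 2" using s by simp
  have s0: "0 < Re s" using s rho(1) by simp
  have lim: "(\<lambda>n. A n k) \<longlonglongrightarrow> of_real k powr (- s / 2)" if "k \<in> level_set z0" for k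
    unfolding A_def using level_set_pos[OF that]
    by (intro tendsto_powr_complex tendsto_intros Z_rescaled_tendsto) (simp add: complex_nonpos_Reals_iff)
  have bd: "norm (A n k) \<le> \<alpha> powr (- (Re s / 2)) * k powr (- (Re s / 2))"
    if "k \<in> level_set z0" "k \<le> c ^ n * kap" for n k
  proof -
    have k: "0 < k" using level_set_pos[OF that(1)] .
    have ge: "\<alpha> * k \<le> c ^ n * Z (k / c ^ n)" using a(2) k that(2) by simp
    have pos: "0 < \<alpha> * k" using a(1) k by simp
    have "norm (A n k) = (c ^ n * Z (k / c ^ n)) powr (- (Re s / 2))"
      unfolding A_def using ge pos by (subst norm_powr_real_powr) auto
    also have "\<dots> \<le> (\<alpha> * k) powr (- (Re s / 2))" using ge pos s0 by (intro powr_mono2') auto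
    finally show ?thesis using a(1) k by (simp add: powr_mult)
  qed
  note T = level_set_tannery[OF z0 s' lim bd]
  show "summable (\<lambda>j. norm (complex_of_real (from_nat_into (level_set z0) j) powr (- s / 2)))"
    using T(1) by simp
  have "(\<lambda>n. \<Sum>k\<in>level_set z0 \<inter> {..c ^ n * kap}. A n k) \<longlonglongrightarrow> level_zeta z0 (s / 2)"
    using T(2) by (simp add: level_zeta_def)
  thus "R_zeta_approx p (of_real z0) s \<longlonglongrightarrow> level_zeta z0 (s / 2)"
    unfolding A_def R_zeta_approx_eq[OF z0, symmetric] by simp
qed

lemma level_zeta_has_sum:
  assumes z0: "z0 \<in> {0<..<2}" and s: "2 * rho < Re s"
  shows "((\<lambda>k. complex_of_real k powr (- s / 2)) has_sum level_zeta z0 (s / 2)) (level_set z0)"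
    and "(\<lambda>k. norm (complex_of_real k powr (- s / 2))) summable_on level_set z0"
proof -
  let ?e = "from_nat_into (level_set z0)"
  note sm = R_zeta_limit(1)[OF assms]
  have "(\<lambda>j. complex_of_real (?e j) powr (- s / 2)) sums level_zeta z0 (s / 2)"
    using summable_sums[OF summable_norm_cancel[OF sm]] by (simp add: level_zeta_def)
  from norm_summable_imp_has_sum[OF sm this]
  show "((\<lambda>k. complex_of_real k powr (- s / 2)) has_sum level_zeta z0 (s / 2)) (level_set z0)"
    using has_sum_reindex_bij_betw[OF level_set_enum[OF z0], of "\<lambda>k. complex_of_real k powr (- s / 2)"] by simp
  have "(\<lambda>j. norm (complex_of_real (?e j) powr (- s / 2))) summable_on UNIV"
    using sm by (intro norm_summable_imp_summable_on) simp
  thus "(\<lambda>k. norm (complex_of_real k powr (- s / 2))) summable_on level_set z0"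
    using summable_on_reindex_bij_betw[OF level_set_enum[OF z0], of "\<lambda>k. norm (complex_of_real k powr (- s / 2))"]
    by simp
qed

text \<open>By the Poincare equation the finite products at \<open>- Y n = Z (- x / c ^ n)\<close>
  have the same value \<open>1 - Z (- x) / z0\<close> for every \<open>n\<close>. Only the factors
  vary with \<open>n\<close>, each converging to \<open>1 + x / k\<close>, and Tannery's theorem
  passes to the limit in the logarithm.\<close>

lemma log_product:
  assumes z0: "z0 \<in> {0<..<2}" and x: "0 < x"
  shows "summable (\<lambda>j. norm (ln (1 + x / from_nat_into (level_set z0) j)))"
    and "ln (1 + (- Z (- x)) / z0) = (\<Sum>j. ln (1 + x / from_nat_into (level_set z0) j))"
proof -
  obtain \<alpha> where a: "0 < \<alpha>" "\<And>n k. 0 \<le> k \<Longrightarrow> k \<le> c ^ n * kap \<Longrightarrow> \<alpha> * k \<le> c ^ n * Z (k / c ^ n)"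
    using Z_rescaled_lower by blast
  define Y where "Y n = - Z (- x / c ^ n)" for n
  have c: "0 < c ^ n" for n using scaling_pos by simp
  have Y: "x / c ^ n \<le> Y n" for n using Z_neg_ge[of "x / c ^ n"] x c[of n] by (simp add: Y_def)
  have Y0: "0 < Y n" for n using Y[of n] x c[of n] by (smt (verit) divide_pos_pos)
  have cY: "(\<lambda>n. c ^ n * Y n) \<longlonglongrightarrow> x"
    using tendsto_minus[OF Z_rescaled_tendsto[of "- x"]] by (simp add: Y_def)
  then obtain B where B: "\<And>n. \<bar>c ^ n * Y n\<bar> \<le> B" using convergent_imp_Bseq[of "\<lambda>n. c ^ n * Y n"]
    unfolding convergent_def Bseq_def real_norm_def by blast
  have Bn: "0 \<le> B" using order_trans[OF abs_ge_zero B[of 0]] .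
  define A where "A n k = ln (1 + Y n / Z (k / c ^ n))" for n k
  have lim: "(\<lambda>n. A n k) \<longlonglongrightarrow> ln (1 + x / k)" if "k \<in> level_set z0" for k
  proof -
    have k: "0 < k" using level_set_pos[OF that] .
    have "Y n / Z (k / c ^ n) = (c ^ n * Y n) / (c ^ n * Z (k / c ^ n))" for n
      using scaling_pos by simp
    moreover have "(\<lambda>n. (c ^ n * Y n) / (c ^ n * Z (k / c ^ n))) \<longlonglongrightarrow> x / k"
      using k by (intro tendsto_divide cY Z_rescaled_tendsto) simp
    ultimately have "(\<lambda>n. Y n / Z (k / c ^ n)) \<longlonglongrightarrow> x / k" by simp
    moreover have "1 + x / k \<noteq> 0" using x k by (smt (verit) divide_pos_pos)
    ultimately show ?thesis unfolding A_def by (intro tendsto_ln tendsto_add tendsto_const)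
  qed
  have bd: "norm (A n k) \<le> B / \<alpha> * k powr (- 1)" if "k \<in> level_set z0" "k \<le> c ^ n * kap" for n k
  proof -
    have k: "0 < k" using level_set_pos[OF that(1)] .
    have ge: "\<alpha> * k \<le> c ^ n * Z (k / c ^ n)" using a(2) k that(2) by simp
    have pos: "0 < \<alpha> * k" using a(1) k by simp
    hence Zp: "0 < Z (k / c ^ n)" using ge c[of n] by (smt (verit) zero_less_mult_pos)
    have q: "0 \<le> Y n / Z (k / c ^ n)" using Zp Y0[of n] by simp
    have "norm (A n k) = A n k" using q by (simp add: A_def)
    also have "\<dots> \<le> Y n / Z (k / c ^ n)" unfolding A_def using q by (rule ln_add_one_self_le_self)
    also have "\<dots> = (c ^ n * Y n) / (c ^ n * Z (k / c ^ n))" using scaling_pos by simp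
    also have "\<dots> \<le> B / (\<alpha> * k)" using B[of n] Bn Y0[of n] c[of n] ge pos by (intro frac_le) auto
    finally show ?thesis using k by (simp add: powr_minus field_simps)
  qed
  have B0: "0 \<le> B / \<alpha>" using Bn a(1) by simp
  \<comment> \<open>The logarithms are dominated by multiples of \<open>1 / k\<close>, so the
    exponent in Tannery's bound is \<open>1\<close>.\<close>
  have one: "rho < 1" using rho(2) by simp
  note T = level_set_tannery[OF z0 one lim bd B0]
  show "summable (\<lambda>j. norm (ln (1 + x / from_nat_into (level_set z0) j)))" by (rule T(1))
  have "(\<Sum>k\<in>level_set z0 \<inter> {..c ^ n * kap}. A n k) = ln (1 + (- Z (- x)) / z0)" for n
  proof -
    have pre: "0 < z" if "z \<in> preimages n z0" for z using that by (auto simp: preimages_def)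
    have "(\<Sum>k\<in>level_set z0 \<inter> {..c ^ n * kap}. A n k) = (\<Sum>z\<in>preimages n z0. ln (1 + Y n / z))"
      unfolding A_def by (rule sum.reindex_bij_betw[OF level_set_bij[OF z0]])
    also have "\<dots> = ln (\<Prod>z\<in>preimages n z0. 1 + Y n / z)"
    proof (rule ln_prod[symmetric])
      have "0 < 1 + Y n / z" if "z \<in> preimages n z0" for z
        using pre[OF that] Y0[of n] by (intro add_pos_pos divide_pos_pos) auto
      thus "1 + Y n / z \<noteq> 0" if "z \<in> preimages n z0" for z using that by (metis less_irrefl)
    qed (use preimages_card[OF z0] in blast)
    also have "(\<Prod>z\<in>preimages n z0. 1 + Y n / z) = 1 - (RR ^^ n) (- Y n) / z0"
      unfolding RR_iter_product[OF z0] by simp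
    also have "(RR ^^ n) (- Y n) = Z (- x)"
      using Z_scaling_pow[of n "- x / c ^ n"] c[of n] scaling_pos by (simp add: Y_def)
    finally show ?thesis by simp
  qed
  with T(2) show "ln (1 + (- Z (- x)) / z0) = (\<Sum>j. ln (1 + x / from_nat_into (level_set z0) j))"
    by (simp add: LIMSEQ_const_iff)
qed

end

subsection \<open>Laplace transforms\<close>

text \<open>Expanding the exponential at the centre turns the integral into a power series; the two
  integrability assumptions dominate it on the largest disc inside the strip.\<close>

lemma laplace_holomorphic:
  fixes h L :: "'a \<Rightarrow> real"
  assumes [measurable]: "h \<in> borel_measurable M" "L \<in> borel_measurable M"
    and a: "integrable M (\<lambda>x. h x * exp (- (a * L x)))" and b: "integrable M (\<lambda>x. h x * exp (- (b * L x)))"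
  shows "(\<lambda>s. \<integral>x. of_real (h x) * exp (- (s * of_real (L x))) \<partial>M) holomorphic_on {s. a < Re s \<and> Re s < b}"
    and "a \<le> Re s \<Longrightarrow> Re s \<le> b \<Longrightarrow> integrable M (\<lambda>x. of_real (h x) * exp (- (s * of_real (L x))))"
proof -
  \<comment> \<open>Dominates the integrand on the whole closed strip: the left edge decides where
    \<open>L x \<ge> 0\<close>, the right edge elsewhere.\<close>
  define G where "G x = \<bar>h x\<bar> * (exp (- (a * L x)) + exp (- (b * L x)))" for x
  have G: "integrable M G"
  proof -
    have "integrable M (\<lambda>x. \<bar>h x * exp (- (a * L x))\<bar> + \<bar>h x * exp (- (b * L x))\<bar>)"
      using a b by simp
    moreover have "G = (\<lambda>x. \<bar>h x * exp (- (a * L x))\<bar> + \<bar>h x * exp (- (b * L x))\<bar>)"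
      by (simp add: G_def abs_mult distrib_left fun_eq_iff)
    ultimately show ?thesis by simp
  qed
  have exp_le: "exp (- (u * L x) + d * \<bar>L x\<bar>) \<le> exp (- (a * L x)) + exp (- (b * L x))"
    if "a \<le> u - d" "u + d \<le> b" for u d x
  proof (cases "0 \<le> L x")
    case True
    have "a * L x \<le> (u - d) * L x" using True that by (intro mult_right_mono) auto
    hence "exp (- (u * L x) + d * \<bar>L x\<bar>) \<le> exp (- (a * L x))" using True by (simp add: algebra_simps)
    thus ?thesis by (smt (verit) exp_gt_zero)
  next
    case False
    have "b * L x \<le> (u + d) * L x" using False that by (intro mult_right_mono_neg) auto
    hence "exp (- (u * L x) + d * \<bar>L x\<bar>) \<le> exp (- (b * L x))" using False by (simp add: algebra_simps)
    thus ?thesis by (smt (verit) exp_gt_zero)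
  qed
  let ?F = "\<lambda>s. \<integral>x. of_real (h x) * exp (- (s * of_real (L x))) \<partial>M"
  show "integrable M (\<lambda>x. of_real (h x) * exp (- (s * of_real (L x))))" if "a \<le> Re s" "Re s \<le> b" for s
  proof (rule Bochner_Integration.integrable_bound[OF G])
    show "AE x in M. norm (of_real (h x) * exp (- (s * complex_of_real (L x)))) \<le> norm (G x)"
      using exp_le[of "Re s" 0] that by (auto simp: G_def norm_mult abs_mult intro!: mult_left_mono)
  qed measurable
  show "?F holomorphic_on {s. a < Re s \<and> Re s < b}"
    unfolding holomorphic_on_def
  proof
    fix s assume "s \<in> {s. a < Re s \<and> Re s < b}"
    hence s: "a < Re s" "Re s < b" by auto
    define d where "d = min (Re s - a) (b - Re s)"
    have d: "0 < d" "a \<le> Re s - d" "Re s + d \<le> b" using s by (auto simp: d_def)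
    define A where "A n x = complex_of_real (h x) * exp (- (s * of_real (L x))) * (of_real (- L x) ^ n / of_nat (fact n))" for n x
    have Am [measurable]: "A n \<in> borel_measurable M" for n unfolding A_def by measurable
    have "(\<lambda>n. (\<integral>x. A n x \<partial>M) * (w - s) ^ n) sums ?F w" if w: "w \<in> ball s d" for w
    proof -
      let ?e = "norm (w - s)"
      have e: "?e < d" using w by (simp add: dist_norm norm_minus_commute)
      have norm_sums: "(\<lambda>n. norm (A n x * (w - s) ^ n)) sums (\<bar>h x\<bar> * exp (- (Re s * L x) + ?e * \<bar>L x\<bar>))" for x
      proof -
        have "(\<lambda>n. \<bar>h x\<bar> * exp (- (Re s * L x)) * ((?e * \<bar>L x\<bar>) ^ n /\<^sub>R fact n)) sums
            (\<bar>h x\<bar> * exp (- (Re s * L x)) * exp (?e * \<bar>L x\<bar>))"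
          by (intro sums_mult exp_converges)
        moreover have "exp (- (Re s * L x)) * exp (?e * \<bar>L x\<bar>) = exp (- (Re s * L x) + ?e * \<bar>L x\<bar>)"
          by (rule exp_add[symmetric])
        moreover have "norm (A n x * (w - s) ^ n) = \<bar>h x\<bar> * exp (- (Re s * L x)) * ((?e * \<bar>L x\<bar>) ^ n /\<^sub>R fact n)" for n
          by (simp add: A_def norm_mult norm_divide norm_power power_mult_distrib norm_fact divide_inverse
              norm_inverse mult_ac)
        ultimately show ?thesis by (simp add: mult.assoc)
      qed
      have val_sums: "(\<lambda>n. A n x * (w - s) ^ n) sums (of_real (h x) * exp (- (w * of_real (L x))))" for x
      proof -
        have "(\<lambda>n. of_real (h x) * exp (- (s * of_real (L x))) * (((w - s) * of_real (- L x)) ^ n /\<^sub>R fact n)) sums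
            (of_real (h x) * exp (- (s * of_real (L x))) * exp ((w - s) * of_real (- L x)))"
          by (intro sums_mult exp_converges)
        moreover have "exp (- (s * of_real (L x))) * exp ((w - s) * of_real (- L x)) = exp (- (w * of_real (L x)))"
          by (simp add: exp_add[symmetric] algebra_simps)
        moreover have "of_real (h x) * exp (- (s * of_real (L x))) * (((w - s) * of_real (- L x)) ^ n /\<^sub>R fact n) =
            A n x * (w - s) ^ n" for n
          unfolding A_def power_mult_distrib scaleR_conv_of_real divide_inverse by (simp add: mult_ac)
        ultimately show ?thesis by (simp add: mult.assoc)
      qed
      have total: "\<bar>h x\<bar> * exp (- (Re s * L x) + ?e * \<bar>L x\<bar>) \<le> G x" for x
        unfolding G_def using exp_le[of "Re s" ?e x] d e by (intro mult_left_mono) auto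
      have part: "(\<Sum>n<N. norm (A n x * (w - s) ^ n)) \<le> G x" for N x
        using sum_le_suminf[OF sums_summable[OF norm_sums], of "{..<N}" x] sums_unique[OF norm_sums[of x]] total[of x]
        by simp
      have one: "norm (A n x * (w - s) ^ n) \<le> norm (G x)" for n x
      proof -
        have "(\<Sum>k<Suc n. norm (A k x * (w - s) ^ k)) \<le> G x" by (rule part)
        moreover have "0 \<le> (\<Sum>k<n. norm (A k x * (w - s) ^ k))" by (rule sum_nonneg) simp
        ultimately show ?thesis by simp
      qed
      have int: "integrable M (\<lambda>x. A n x * (w - s) ^ n)" for n
      proof (rule Bochner_Integration.integrable_bound[OF G])
        show "AE x in M. norm (A n x * (w - s) ^ n) \<le> norm (G x)" using one by simp
      qed measurable
      have "(\<lambda>n. \<integral>x. A n x * (w - s) ^ n \<partial>M) sums (\<integral>x. (\<Sum>n. A n x * (w - s) ^ n) \<partial>M)"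
      proof (rule sums_integral[OF int])
        show "AE x in M. summable (\<lambda>n. norm (A n x * (w - s) ^ n))"
          using sums_summable[OF norm_sums] by simp
        show "summable (\<lambda>n. \<integral>x. norm (A n x * (w - s) ^ n) \<partial>M)"
        proof (rule summableI_nonneg_bounded)
          fix N
          have "(\<Sum>n<N. \<integral>x. norm (A n x * (w - s) ^ n) \<partial>M) = (\<integral>x. (\<Sum>n<N. norm (A n x * (w - s) ^ n)) \<partial>M)"
            using int by (intro Bochner_Integration.integral_sum[symmetric]) auto
          also have "\<dots> \<le> integral\<^sup>L M G"
            using int part G by (intro integral_mono) auto
          finally show "(\<Sum>n<N. \<integral>x. norm (A n x * (w - s) ^ n) \<partial>M) \<le> integral\<^sup>L M G" .
        qed auto
      qed
      moreover have "(\<integral>x. A n x * (w - s) ^ n \<partial>M) = (\<integral>x. A n x \<partial>M) * (w - s) ^ n" for n by simp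
      moreover have "(\<Sum>n. A n x * (w - s) ^ n) = of_real (h x) * exp (- (w * of_real (L x)))" for x
        using sums_unique[OF val_sums[of x]] by simp
      ultimately show ?thesis by simp
    qed
    hence "?F holomorphic_on ball s d" by (rule power_series_holomorphic)
    hence "?F field_differentiable at s" using d(1) by (intro holomorphic_on_imp_differentiable_at) auto
    thus "?F field_differentiable at s within {s. a < Re s \<and> Re s < b}"
      by (rule field_differentiable_at_within)
  qed
qed

lemma integrable_exp_decay:
  assumes "0 < (a :: real)"
  shows "integrable lborel (\<lambda>t. indicator {0..} t * exp (- (a * t)))"
proof -
  have "integrable (density lborel (exponential_density a)) (\<lambda>_. 1 :: real)"
  proof -
    interpret prob_space "density lborel (exponential_density a)" using assms by (rule prob_space_exponential_density)
    show ?thesis by simp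
  qed
  hence "integrable lborel (\<lambda>t. exponential_density a t *\<^sub>R (1 :: real))"
    using assms by (subst (asm) integrable_density) auto
  hence "integrable lborel (\<lambda>t. (1 / a) * exponential_density a t)" by simp
  moreover have "(\<lambda>t. (1 / a) * exponential_density a t) = (\<lambda>t. indicator {0..} t * exp (- (a * t)))"
    using assms by (auto simp: fun_eq_iff exponential_density_def indicator_def mult.commute)
  ultimately show ?thesis by simp
qed

lemma integrable_exp_growth:
  assumes "0 < (a :: real)"
  shows "integrable lborel (\<lambda>t. indicator {..<0} t * exp (a * t))"
proof -
  have "integrable lborel (\<lambda>t. indicator {0..} (0 + (- 1) * t) * exp (- (a * (0 + (- 1) * t))))"
    by (rule lborel_integrable_real_affine[OF integrable_exp_decay[OF assms]]) simp
  hence "integrable lborel (\<lambda>t. indicator {..0} t * exp (a * t))"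
    by (rule back_subst[of "integrable lborel"]) (auto simp: fun_eq_iff indicator_def)
  from integrable_mult_indicator[of "{..<0::real}" lborel, OF _ this]
  have "integrable lborel (\<lambda>t. indicator {..<0} t *\<^sub>R (indicator {..0} t * exp (a * t)))" by simp
  thus ?thesis by (rule back_subst[of "integrable lborel"]) (auto simp: fun_eq_iff indicator_def)
qed

text \<open>The two halves of a bilateral Laplace transform. Under \<open>x = exp t\<close> it is
  the Mellin integral of \<open>f (ln x) * x powr (- s - 1)\<close>. For functions of exponential
  growth the half over \<open>t \<ge> 0\<close> is the one that has to be continued to the
  left.\<close>

definition lap_pos :: "(real \<Rightarrow> real) \<Rightarrow> complex \<Rightarrow> complex" where
  "lap_pos f s = (\<integral>t. of_real (indicator {0..} t * f t) * exp (- (s * of_real t)) \<partial>lborel)"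

definition lap_neg :: "(real \<Rightarrow> real) \<Rightarrow> complex \<Rightarrow> complex" where
  "lap_neg f s = (\<integral>t. of_real (indicator {..<0} t * f t) * exp (- (s * of_real t)) \<partial>lborel)"

lemma lap_pos_bound_integrable:
  fixes f :: "real \<Rightarrow> real"
  assumes [measurable]: "f \<in> borel_measurable borel"
    and f: "\<And>t. 0 \<le> t \<Longrightarrow> \<bar>f t\<bar> \<le> C * exp (b * t)" and a: "b < a"
  shows "integrable lborel (\<lambda>t. indicator {0..} t * f t * exp (- (a * t)))"
proof (rule Bochner_Integration.integrable_bound)
  show "integrable lborel (\<lambda>t. C * (indicator {0..} t * exp (- ((a - b) * t))))"
    using integrable_exp_decay[of "a - b"] a by simp
  show "AE t in lborel. norm (indicator {0..} t * f t * exp (- (a * t))) \<le>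
      norm (C * (indicator {0..} t * exp (- ((a - b) * t))))"
  proof (rule AE_I2)
    fix t :: real
    show "norm (indicator {0..} t * f t * exp (- (a * t))) \<le>
      norm (C * (indicator {0..} t * exp (- ((a - b) * t))))"
    proof (cases "0 \<le> t")
      case True
      have "\<bar>f t\<bar> * exp (- (a * t)) \<le> C * exp (b * t) * exp (- (a * t))"
        using f[OF True] by (intro mult_right_mono) auto
      also have "\<dots> = C * exp (- ((a - b) * t))" by (simp add: exp_add[symmetric] algebra_simps)
      finally show ?thesis using True f[of 0] by (simp add: abs_mult)
    qed simp
  qed
qed measurable

lemma lap_neg_bound_integrable:
  fixes f :: "real \<Rightarrow> real"
  assumes [measurable]: "f \<in> borel_measurable borel"
    and f: "\<And>t. t < 0 \<Longrightarrow> \<bar>f t\<bar> \<le> C * exp (b * t)" and a: "a < b"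
  shows "integrable lborel (\<lambda>t. indicator {..<0} t * f t * exp (- (a * t)))"
proof (rule Bochner_Integration.integrable_bound)
  show "integrable lborel (\<lambda>t. C * (indicator {..<0} t * exp ((b - a) * t)))"
    using integrable_exp_growth[of "b - a"] a by simp
  show "AE t in lborel. norm (indicator {..<0} t * f t * exp (- (a * t))) \<le>
      norm (C * (indicator {..<0} t * exp ((b - a) * t)))"
  proof (rule AE_I2)
    fix t :: real
    show "norm (indicator {..<0} t * f t * exp (- (a * t))) \<le>
      norm (C * (indicator {..<0} t * exp ((b - a) * t)))"
    proof (cases "t < 0")
      case True
      have "\<bar>f t\<bar> * exp (- (a * t)) \<le> C * exp (b * t) * exp (- (a * t))"
        using f[OF True] by (intro mult_right_mono) auto
      also have "\<dots> = C * exp ((b - a) * t)" by (simp add: exp_add[symmetric] algebra_simps)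
      also have "\<dots> \<le> \<bar>C\<bar> * exp ((b - a) * t)" by (intro mult_right_mono) auto
      finally show ?thesis using True by (simp add: abs_mult)
    qed simp
  qed
qed measurable

lemma lap_pos_properties:
  fixes f :: "real \<Rightarrow> real"
  assumes m [measurable]: "f \<in> borel_measurable borel"
    and f: "\<And>t. 0 \<le> t \<Longrightarrow> \<bar>f t\<bar> \<le> C * exp (b * t)"
  shows "lap_pos f holomorphic_on {s. b < Re s}"
    and "b < Re s \<Longrightarrow> integrable lborel (\<lambda>t. of_real (indicator {0..} t * f t) * exp (- (s * complex_of_real t)))"
proof -
  have i: "integrable lborel (\<lambda>t. indicator {0..} t * f t * exp (- (a * t)))" if "b < a" for a
    using f that by (intro lap_pos_bound_integrable[OF m])
  have hm: "(\<lambda>t. indicator {0..} t * f t) \<in> borel_measurable lborel" by measurable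
  have hol: "lap_pos f holomorphic_on {s. a < Re s \<and> Re s < a'}" if "b < a" "b < a'" for a a'
    unfolding lap_pos_def by (rule laplace_holomorphic(1)[OF hm _ i[OF that(1)] i[OF that(2)]]) simp
  show "integrable lborel (\<lambda>t. of_real (indicator {0..} t * f t) * exp (- (s * complex_of_real t)))" if "b < Re s" for s
    by (rule laplace_holomorphic(2)[OF hm _ i i, of "Re s" "Re s"]) (use that in auto)
  show "lap_pos f holomorphic_on {s. b < Re s}"
    unfolding holomorphic_on_def
  proof
    fix s assume "s \<in> {s. b < Re s}"
    hence s: "b < Re s" by simp
    let ?S = "{w. (b + Re s) / 2 < Re w \<and> Re w < Re s + 1}"
    have "open ?S" by (intro open_Collect_conj open_Collect_less continuous_intros)
    moreover have "lap_pos f holomorphic_on ?S" using s by (intro hol) auto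
    moreover have "s \<in> ?S" using s by auto
    ultimately have "lap_pos f field_differentiable at s" by (metis holomorphic_on_imp_differentiable_at)
    thus "lap_pos f field_differentiable at s within {s. b < Re s}" by (rule field_differentiable_at_within)
  qed
qed

lemma lap_neg_properties:
  fixes f :: "real \<Rightarrow> real"
  assumes m [measurable]: "f \<in> borel_measurable borel"
    and f: "\<And>t. t < 0 \<Longrightarrow> \<bar>f t\<bar> \<le> C * exp (b * t)"
  shows "lap_neg f holomorphic_on {s. Re s < b}"
    and "Re s < b \<Longrightarrow> integrable lborel (\<lambda>t. of_real (indicator {..<0} t * f t) * exp (- (s * complex_of_real t)))"
proof -
  have i: "integrable lborel (\<lambda>t. indicator {..<0} t * f t * exp (- (a * t)))" if "a < b" for a
    using f that by (intro lap_neg_bound_integrable[OF m])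
  have hm: "(\<lambda>t. indicator {..<0} t * f t) \<in> borel_measurable lborel" by measurable
  have hol: "lap_neg f holomorphic_on {s. a < Re s \<and> Re s < a'}" if "a < b" "a' < b" for a a'
    unfolding lap_neg_def by (rule laplace_holomorphic(1)[OF hm _ i[OF that(1)] i[OF that(2)]]) simp
  show "integrable lborel (\<lambda>t. of_real (indicator {..<0} t * f t) * exp (- (s * complex_of_real t)))" if "Re s < b" for s
    by (rule laplace_holomorphic(2)[OF hm _ i i, of "Re s" "Re s"]) (use that in auto)
  show "lap_neg f holomorphic_on {s. Re s < b}"
    unfolding holomorphic_on_def
  proof
    fix s assume "s \<in> {s. Re s < b}"
    hence s: "Re s < b" by simp
    let ?S = "{w. Re s - 1 < Re w \<and> Re w < (b + Re s) / 2}"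
    have "open ?S" by (intro open_Collect_conj open_Collect_less continuous_intros)
    moreover have "lap_neg f holomorphic_on ?S" using s by (intro hol) auto
    moreover have "s \<in> ?S" using s by auto
    ultimately have "lap_neg f field_differentiable at s" by (metis holomorphic_on_imp_differentiable_at)
    thus "lap_neg f field_differentiable at s within {s. Re s < b}" by (rule field_differentiable_at_within)
  qed
qed

lemma lap_compact_holomorphic:
  fixes f :: "real \<Rightarrow> real"
  assumes m [measurable]: "f \<in> borel_measurable borel" and f: "\<And>t. 0 \<le> t \<Longrightarrow> t < l \<Longrightarrow> \<bar>f t\<bar> \<le> C" and l: "0 < l"
  shows "lap_pos (\<lambda>t. indicator {0..<l} t * f t) holomorphic_on UNIV"
proof -
  have C: "0 \<le> C" using f[of 0] l by simp
  \<comment> \<open>On a bounded interval every rate \<open>b\<close>, however negative, is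
    admissible at the cost of the constant \<open>exp (\<bar>b\<bar> * l)\<close>.\<close>
  have hol: "lap_pos (\<lambda>t. indicator {0..<l} t * f t) holomorphic_on {s. b < Re s}" for b
  proof (rule lap_pos_properties(1)[where C = "C * exp (\<bar>b\<bar> * l)"])
    fix t :: real assume t: "0 \<le> t"
    show "\<bar>indicator {0..<l} t * f t\<bar> \<le> C * exp (\<bar>b\<bar> * l) * exp (b * t)"
    proof (cases "t < l")
      case True
      have "\<bar>b\<bar> * t \<le> \<bar>b\<bar> * l" using True by (intro mult_left_mono) auto
      moreover have "- (b * t) \<le> \<bar>b\<bar> * t" using t by (metis abs_ge_minus_self abs_mult abs_of_nonneg)
      ultimately have "1 \<le> exp (\<bar>b\<bar> * l + b * t)" by simp
      hence "C * 1 \<le> C * exp (\<bar>b\<bar> * l + b * t)" using C by (intro mult_left_mono)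
      thus ?thesis using f[OF t True] True t by (simp add: exp_add mult.assoc)
    qed (use C in simp)
  qed measurable
  have "lap_pos (\<lambda>t. indicator {0..<l} t * f t) field_differentiable at s" for s
  proof -
    have "open {w. Re s - 1 < Re w}" by (intro open_Collect_less continuous_intros)
    thus ?thesis using holomorphic_on_imp_differentiable_at[OF hol[of "Re s - 1"], of s] by simp
  qed
  thus ?thesis unfolding holomorphic_on_def by (auto intro: field_differentiable_at_within)
qed

lemma lap_pos_shift:
  fixes f :: "real \<Rightarrow> real"
  assumes m [measurable]: "f \<in> borel_measurable borel"
    and f: "\<And>t. 0 \<le> t \<Longrightarrow> \<bar>f t\<bar> \<le> C * exp (b * t)" and s: "b < Re s" and l: "0 < l"
  shows "lap_pos f s = lap_pos (\<lambda>t. indicator {0..<l} t * f t) s + exp (- (s * of_real l)) * lap_pos (\<lambda>t. f (t + l)) s"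
proof -
  note int = lap_pos_properties(2)[OF m f s]
  let ?e = "\<lambda>t. exp (- (s * complex_of_real t))"
  have i1: "integrable lborel (\<lambda>t. of_real (indicator {0..} t * (indicator {0..<l} t * f t)) * ?e t)"
    using integrable_mult_indicator[OF _ int, of "{0..<l}"]
    by (rule back_subst[of "integrable lborel"]) (auto simp: fun_eq_iff indicator_def)
  have i2: "integrable lborel (\<lambda>t. of_real (indicator {l..} t * f t) * ?e t)"
    using integrable_mult_indicator[OF _ int, of "{l..}"]
    by (rule back_subst[of "integrable lborel"]) (use l in \<open>auto simp: fun_eq_iff indicator_def\<close>)
  have "lap_pos f s = (\<integral>t. of_real (indicator {0..} t * (indicator {0..<l} t * f t)) * ?e t +
      of_real (indicator {l..} t * f t) * ?e t \<partial>lborel)"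
    unfolding lap_pos_def using l
    by (intro Bochner_Integration.integral_cong refl) (auto simp: indicator_def)
  also have "\<dots> = lap_pos (\<lambda>t. indicator {0..<l} t * f t) s + (\<integral>t. of_real (indicator {l..} t * f t) * ?e t \<partial>lborel)"
    unfolding lap_pos_def by (rule Bochner_Integration.integral_add[OF i1 i2])
  also have "(\<integral>t. of_real (indicator {l..} t * f t) * ?e t \<partial>lborel) =
      (\<integral>t. of_real (indicator {l..} (l + 1 * t) * f (l + 1 * t)) * ?e (l + 1 * t) \<partial>lborel)"
    by (subst lborel_integral_real_affine[where c = 1 and t = l]) simp_all
  also have "\<dots> = (\<integral>t. ?e l * (of_real (indicator {0..} t * f (t + l)) * ?e t) \<partial>lborel)"
  proof (intro Bochner_Integration.integral_cong refl)
    fix t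
    have "?e (l + 1 * t) = ?e l * ?e t" by (simp add: exp_add[symmetric] algebra_simps)
    thus "of_real (indicator {l..} (l + 1 * t) * f (l + 1 * t)) * ?e (l + 1 * t) =
        ?e l * (of_real (indicator {0..} t * f (t + l)) * ?e t)"
      by (simp add: indicator_def add.commute)
  qed
  also have "\<dots> = ?e l * lap_pos (\<lambda>t. f (t + l)) s" unfolding lap_pos_def by simp
  finally show ?thesis .
qed

text \<open>The shift relation is a linear equation for the transform:
  \<open>1 - a * exp (- s * l)\<close> times it is an entire term plus the transforms of the
  constant and of the error. The error decays like \<open>exp (- t)\<close>, so its transform is
  holomorphic for \<open>Re s > - 1\<close>. The constant is continued by the same relation with
  \<open>a = 1\<close>, as \<open>P1 / (1 - e)\<close>. The condition
  \<open>a \<le> exp (\<beta> * l)\<close> keeps the divisor nonzero for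
  \<open>Re s > \<beta>\<close>, so the agreement there is pointwise.\<close>

lemma lap_pos_meromorphic:
  fixes f :: "real \<Rightarrow> real"
  assumes m [measurable]: "f \<in> borel_measurable borel" and l: "0 < l" and be: "0 \<le> \<beta>"
    and a: "0 \<le> a" "a \<le> exp (\<beta> * l)"
    and bd: "\<And>b. \<beta> < b \<Longrightarrow> \<exists>C. \<forall>t\<ge>0. \<bar>f t\<bar> \<le> C * exp (b * t)"
    and E: "\<And>t. 0 \<le> t \<Longrightarrow> \<bar>f (t + l) - a * f t - k\<bar> \<le> D * exp (- t)"
  shows "\<exists>G. G meromorphic_on {s. - 1 < Re s} \<and> (\<forall>s. \<beta> < Re s \<longrightarrow> G s = lap_pos f s)"
proof -
  let ?one = "\<lambda>t::real. 1 :: real" and ?E = "\<lambda>t. f (t + l) - a * f t - k"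
  define P where "P = lap_pos (\<lambda>t. indicator {0..<l} t * f t)"
  define P1 where "P1 = lap_pos (\<lambda>t. indicator {0..<l} t * ?one t)"
  define EE where "EE = lap_pos ?E"
  define e where "e s = exp (- (s * complex_of_real l))" for s
  define G where "G s = (P s + e s * (of_real k * (P1 s / (1 - e s)) + EE s)) / (1 - of_real a * e s)" for s
  let ?S = "{s. - 1 < Re s}"
  have op: "open ?S" by (intro open_Collect_less continuous_intros)
  have Em [measurable]: "?E \<in> borel_measurable borel" by measurable
  obtain C1 where C1: "\<forall>t\<ge>0. \<bar>f t\<bar> \<le> C1 * exp ((\<beta> + 1) * t)" using bd[of "\<beta> + 1"] by auto
  have C1p: "0 \<le> C1" using C1[rule_format, of 0] by simp
  have fb: "\<bar>f t\<bar> \<le> C1 * exp ((\<beta> + 1) * l)" if "0 \<le> t" "t < l" for t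
  proof -
    have "\<bar>f t\<bar> \<le> C1 * exp ((\<beta> + 1) * t)" using C1 that by simp
    also have "\<dots> \<le> C1 * exp ((\<beta> + 1) * l)" using that be C1p by (intro mult_left_mono) auto
    finally show ?thesis .
  qed
  have P: "P meromorphic_on ?S" unfolding P_def
    using lap_compact_holomorphic[OF m fb l]
    by (intro analytic_on_imp_meromorphic_on, rule_tac analytic_on_subset[OF _ subset_UNIV]) (simp add: analytic_on_open)
  have P1: "P1 meromorphic_on ?S" unfolding P1_def
    using lap_compact_holomorphic[of ?one l 1] l
    by (intro analytic_on_imp_meromorphic_on, rule_tac analytic_on_subset[OF _ subset_UNIV]) (simp add: analytic_on_open)
  have EE: "EE meromorphic_on ?S" unfolding EE_def
    using lap_pos_properties(1)[OF Em, of D "- 1"] E op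
    by (intro analytic_on_imp_meromorphic_on) (simp add: analytic_on_open)
  have em: "e meromorphic_on ?S" unfolding e_def
    by (intro analytic_on_imp_meromorphic_on analytic_intros)
  have "G meromorphic_on ?S" unfolding G_def by (intro meromorphic_intros P P1 EE em)
  moreover have "G s = lap_pos f s" if s: "\<beta> < Re s" for s
  proof -
    have s0: "0 < Re s" using s be by simp
    obtain C where C: "\<forall>t\<ge>0. \<bar>f t\<bar> \<le> C * exp (((\<beta> + Re s) / 2) * t)"
      using bd[of "(\<beta> + Re s) / 2"] s by auto
    have s': "(\<beta> + Re s) / 2 < Re s" using s by simp
    have ne: "norm (e s) = exp (- (Re s * l))" by (simp add: e_def)
    have "a * exp (- (Re s * l)) \<le> exp (\<beta> * l) * exp (- (Re s * l))" using a by (intro mult_right_mono) auto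
    also have "\<dots> = exp ((\<beta> - Re s) * l)" by (simp add: exp_add[symmetric] algebra_simps)
    also have "\<dots> < 1" using s l by (simp add: mult_neg_pos)
    finally have "norm (of_real a * e s) < 1" using a by (simp add: norm_mult ne)
    hence nz: "1 - of_real a * e s \<noteq> 0" by auto
    have "norm (e s) < 1" using s0 l by (simp add: ne)
    hence nz1: "1 - e s \<noteq> 0" by auto
    let ?N = "lap_pos ?one s"
    have "?N = P1 s + e s * ?N"
      using lap_pos_shift[of ?one 1 0 s l] s0 l unfolding P1_def e_def by simp
    hence N: "?N = P1 s / (1 - e s)" using nz1 by (simp add: field_simps)
    have fC: "\<bar>f t\<bar> \<le> C * exp (((\<beta> + Re s) / 2) * t)" if "0 \<le> t" for t using C that by simp
    note i1 = lap_pos_properties(2)[OF m fC s']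
    have i2: "integrable lborel (\<lambda>t. of_real (indicator {0..} t * ?one t) * exp (- (s * complex_of_real t)))"
      using s0 by (intro lap_pos_properties(2)[of ?one 1 0]) auto
    have i3: "integrable lborel (\<lambda>t. of_real (indicator {0..} t * ?E t) * exp (- (s * complex_of_real t)))"
      using s0 E by (intro lap_pos_properties(2)[OF Em, of D "- 1"]) auto
    have "lap_pos (\<lambda>t. f (t + l)) s = (\<integral>t. of_real a * (of_real (indicator {0..} t * f t) * exp (- (s * complex_of_real t)))
        + of_real k * (of_real (indicator {0..} t * ?one t) * exp (- (s * complex_of_real t)))
        + of_real (indicator {0..} t * ?E t) * exp (- (s * complex_of_real t)) \<partial>lborel)"
      unfolding lap_pos_def
      by (intro Bochner_Integration.integral_cong refl) (simp add: algebra_simps)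
    also have "\<dots> = of_real a * lap_pos f s + of_real k * ?N + EE s"
      using i1 i2 i3 unfolding EE_def lap_pos_def by simp
    finally have sh: "lap_pos (\<lambda>t. f (t + l)) s = of_real a * lap_pos f s + of_real k * ?N + EE s" .
    have "lap_pos f s = P s + e s * lap_pos (\<lambda>t. f (t + l)) s"
      unfolding P_def e_def by (rule lap_pos_shift[OF m fC s' l])
    hence "lap_pos f s * (1 - of_real a * e s) = P s + e s * (of_real k * ?N + EE s)"
      unfolding sh by (simp add: algebra_simps)
    thus ?thesis unfolding G_def N[symmetric] using nz by (metis nonzero_mult_div_cancel_right)
  qed
  ultimately show ?thesis by blast
qed

section \<open>Logarithmic estimates and the continued transform of ln (1 + exp t)\<close>

lemma ln_one_plus_le_powr:
  fixes y b :: real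
  assumes "0 \<le> y" "0 < b" "b \<le> 1"
  shows "ln (1 + y) \<le> 1 / b * y powr b"
proof (cases "y \<le> 1")
  case True
  have "ln (1 + y) \<le> y" by (rule ln_add_one_self_le_self[OF assms(1)])
  also have "y \<le> y powr b"
    using assms True by (cases "y = 0") (auto intro: powr_mono'[of b 1 y, simplified])
  also have "y powr b \<le> 1 / b * y powr b"
    using assms mult_right_mono[of 1 "1 / b" "y powr b"] by simp
  finally show ?thesis .
next
  case False
  hence y: "1 < y" by simp
  have "ln (1 + y) \<le> ln (2 * y)" using y by simp
  also have "\<dots> = ln 2 + ln y" using y by (simp add: ln_mult)
  also have "ln y = 1 / b * ln (y powr b)" using assms y by (simp add: ln_powr)
  also have "ln 2 + 1 / b * ln (y powr b) \<le> 1 + 1 / b * (y powr b - 1)"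
    using assms y ln_2_less_1 by (intro add_mono mult_left_mono ln_le_minus_one) auto
  also have "\<dots> \<le> 1 / b * y powr b" using assms by (simp add: field_simps)
  finally show ?thesis .
qed

lemma abs_ln_quotient_le:
  fixes A B :: real
  assumes "0 < w" "w \<le> A" "w \<le> B" "\<bar>A - B\<bar> \<le> d"
  shows "\<bar>ln (A / B)\<bar> \<le> d / w"
proof -
  have *: "ln (X / Y) \<le> d / w" if "w \<le> X" "w \<le> Y" "\<bar>X - Y\<bar> \<le> d" for X Y
  proof -
    have "ln (X / Y) \<le> X / Y - 1" using that assms(1) by (intro ln_le_minus_one) auto
    also have "\<dots> = (X - Y) / Y" using that assms(1) by (simp add: field_simps)
    also have "\<dots> \<le> d / Y" using that assms(1) by (intro divide_right_mono) auto
    also have "\<dots> \<le> d / w" using that assms(1) by (intro divide_left_mono) auto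
    finally show ?thesis .
  qed
  have "ln (B / A) = - ln (A / B)" using assms by (simp add: ln_div)
  thus ?thesis using *[of A B] *[of B A] assms by (simp add: abs_le_iff abs_minus_commute)
qed

text \<open>\<open>ln (1 + x)\<close> in the variable \<open>t = ln x\<close>. The logarithm of the
  product over a level set is a sum of translates of this one function by
  \<open>ln k\<close>.\<close>

definition softplus :: "real \<Rightarrow> real" where "softplus t = ln (1 + exp t)"

lemma softplus_nonneg: "0 \<le> softplus t"
  by (simp add: softplus_def)

lemma softplus_measurable [measurable]: "softplus \<in> borel_measurable borel"
  unfolding softplus_def by measurable

lemma softplus_le: "0 < b \<Longrightarrow> b \<le> 1 \<Longrightarrow> softplus t \<le> 1 / b * exp (b * t)"
  using ln_one_plus_le_powr[of "exp t" b] by (simp add: softplus_def powr_def)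

text \<open>Growth bounds are available for rates up to \<open>1\<close>, valid on the whole line;
  on \<open>t \<ge> 0\<close> a larger rate only weakens them, which supplies every rate above
  \<open>\<beta>\<close>.\<close>

lemma exp_bound_weaken:
  assumes "\<And>b::real. \<beta> < b \<Longrightarrow> b \<le> 1 \<Longrightarrow> \<exists>C\<ge>0. \<forall>t. \<bar>f t\<bar> \<le> C * exp (b * t)" "\<beta> < 1" "\<beta> < b"
  shows "\<exists>C. \<forall>t\<ge>0. \<bar>f t\<bar> \<le> C * exp (b * t)"
proof -
  obtain C where C: "0 \<le> C" "\<forall>t. \<bar>f t\<bar> \<le> C * exp (min b 1 * t)" using assms(1)[of "min b 1"] assms(2,3) by auto
  have "\<bar>f t\<bar> \<le> C * exp (b * t)" if "0 \<le> t" for t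
  proof -
    have "min b 1 * t \<le> b * t" using that by (intro mult_right_mono) auto
    hence "C * exp (min b 1 * t) \<le> C * exp (b * t)" using C(1) by (intro mult_left_mono) auto
    thus ?thesis using C(2) by (meson order_trans)
  qed
  thus ?thesis by blast
qed

text \<open>\<open>softplus t\<close> is \<open>t\<close> up to \<open>O(exp (- t))\<close>, so a
  shift by \<open>1\<close> adds \<open>1\<close> up to such an error: the case
  \<open>a = 1\<close>, \<open>k = 1\<close>.\<close>

lemma softplus_lap_meromorphic:
  "\<exists>G. G meromorphic_on {s. - 1 < Re s} \<and> (\<forall>s. 0 < Re s \<longrightarrow> G s = lap_pos softplus s)"
proof (rule lap_pos_meromorphic[where l = 1 and a = 1 and k = 1 and D = 1])
  show "\<exists>C. \<forall>t\<ge>0. \<bar>softplus t\<bar> \<le> C * exp (b * t)" if "0 < b" for b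
  proof (rule exp_bound_weaken[OF _ _ that])
    show "\<exists>C\<ge>0. \<forall>t. \<bar>softplus t\<bar> \<le> C * exp (b * t)" if "0 < b" "b \<le> 1" for b
      using softplus_le[OF that] softplus_nonneg that by (intro exI[of _ "1 / b"]) simp
  qed simp
  fix t :: real assume t: "0 \<le> t"
  let ?u = "exp t"
  have "softplus (t + 1) - 1 * softplus t - 1 = ln ((exp (- 1) + ?u) / (1 + ?u))"
  proof -
    have "1 + exp (t + 1) = exp 1 * (exp (- 1) + ?u)"
      by (simp add: exp_add[symmetric] distrib_left add.commute)
    hence "softplus (t + 1) = 1 + ln (exp (- 1) + ?u)"
      unfolding softplus_def by (subst ln_mult_pos[symmetric, of "exp 1", simplified ln_exp]) (auto simp: add_pos_pos)
    moreover have "0 < exp (- 1) + ?u" "0 < 1 + ?u" by (simp_all add: add_pos_pos)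
    ultimately show ?thesis unfolding softplus_def by (subst ln_divide_pos) auto
  qed
  also have "\<bar>\<dots>\<bar> \<le> 1 / ?u"
    by (rule abs_ln_quotient_le) auto
  finally show "\<bar>softplus (t + 1) - 1 * softplus t - 1\<bar> \<le> 1 * exp (- t)" by (simp add: exp_minus divide_inverse)
qed auto

context self_similar_interval_asym
begin

subsection \<open>Meromorphic continuation\<close>

definition log_growth :: "real \<Rightarrow> real \<Rightarrow> real" where
  "log_growth z0 t = ln (1 + (- Z (- exp t)) / z0)"

lemma log_growth_measurable [measurable]: "log_growth z0 \<in> borel_measurable borel"
proof -
  have [measurable]: "Z \<in> borel_measurable borel" by (rule borel_measurable_continuous_onI[OF continuous_on_Z])
  show ?thesis unfolding log_growth_def by measurable
qed

lemma log_growth_sums: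
  assumes z0: "z0 \<in> {0<..<2}"
  shows "(\<lambda>j. softplus (t - ln (from_nat_into (level_set z0) j))) sums log_growth z0 t"
proof -
  let ?e = "from_nat_into (level_set z0)"
  have e: "0 < ?e j" for j using bij_betwE[OF level_set_enum[OF z0]] level_set_pos by blast
  have "softplus (t - ln (?e j)) = ln (1 + exp t / ?e j)" for j
    using e[of j] by (simp add: softplus_def exp_diff)
  thus ?thesis
    using log_product[OF z0, of "exp t"] summable_sums[OF summable_norm_cancel[OF log_product(1)[OF z0, of "exp t"]]]
    by (simp add: log_growth_def)
qed

lemma log_growth_nonneg:
  assumes z0: "z0 \<in> {0<..<2}" shows "0 \<le> log_growth z0 t"
  using sums_le[OF _ sums_zero log_growth_sums[OF z0]] softplus_nonneg by simp

lemma level_set_enum_pos: "z0 \<in> {0<..<2} \<Longrightarrow> 0 < from_nat_into (level_set z0) j"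
  using bij_betwE[OF level_set_enum] level_set_pos by blast

lemma log_growth_le:
  assumes z0: "z0 \<in> {0<..<2}" and b: "rho < b" "b \<le> 1"
  shows "\<exists>C\<ge>0. \<forall>t. \<bar>log_growth z0 t\<bar> \<le> C * exp (b * t)"
proof -
  let ?e = "from_nat_into (level_set z0)"
  have b0: "0 < b" using b rho by simp
  note sm = level_set_enum_summable[OF z0 b(1)]
  define S where "S = (\<Sum>j. ?e j powr (- b))"
  have "log_growth z0 t \<le> 1 / b * S * exp (b * t)" for t
  proof -
    have "(\<lambda>j. 1 / b * exp (b * t) * ?e j powr (- b)) sums (1 / b * exp (b * t) * S)"
      unfolding S_def by (intro sums_mult summable_sums sm)
    moreover have "softplus (t - ln (?e j)) \<le> 1 / b * exp (b * t) * ?e j powr (- b)" for j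
    proof -
      have "exp (b * (t - ln (?e j))) = exp (b * t) * ?e j powr (- b)"
        using level_set_enum_pos[OF z0, of j] by (simp add: powr_def exp_add[symmetric] algebra_simps)
      thus ?thesis using softplus_le[OF b0 b(2), of "t - ln (?e j)"] by (simp add: mult.assoc)
    qed
    ultimately have "log_growth z0 t \<le> 1 / b * exp (b * t) * S"
      by (intro sums_le[OF _ log_growth_sums[OF z0]])
    thus ?thesis by (simp add: mult_ac)
  qed
  moreover have "0 \<le> S" unfolding S_def using sm by (intro suminf_nonneg) auto
  ultimately show ?thesis using log_growth_nonneg[OF z0] b0 by (intro exI[of _ "1 / b * S"]) auto
qed

text \<open>With \<open>Y = - Z (- exp t)\<close>, scaling replaces \<open>Y\<close> by a cubic
  polynomial in \<open>Y\<close> with leading coefficient \<open>1 / (p * q)\<close>. Comparing it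
  with \<open>(1 + Y / z0)^3\<close> gives the constant \<open>z0\<^sup>2 / (p * q)\<close> and a
  relative error \<open>O(1 / Y)\<close>, where \<open>Y \<ge> exp t\<close>.\<close>

lemma log_growth_shift:
  assumes z0: "z0 \<in> {0<..<2}" and t: "0 \<le> t"
  shows "\<bar>log_growth z0 (t + ln c) - 3 * log_growth z0 t - ln (z0\<^sup>2 / (p * q))\<bar> \<le> 27 * exp (- t)"
proof -
  define Y where "Y = - Z (- exp t)"
  define w where "w = p * q"
  have w: "0 < w" "w \<le> 1"
    using pq_pos p_pos p_less_1 mult_le_one[of p q] unfolding w_def by auto
  have Yt: "exp t \<le> Y" using Z_neg_ge[of "exp t"] by (simp add: Y_def)
  have Y1: "1 \<le> Y" using Yt t by (smt (verit) one_le_exp_iff)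
  have z: "0 < z0" "z0 < 2" using z0 by auto
  define A where "A = w * z0 + Y^3 + 3 * Y\<^sup>2 + (2 + w) * Y"
  define B where "B = (z0 + Y)^3"
  have "- Z (- exp (t + ln c)) = - RR (- Y)"
    using Z_scaling[of "- exp t"] scaling_pos by (simp add: Y_def exp_add mult.commute)
  also have "\<dots> = (Y^3 + 3 * Y\<^sup>2 + (2 + w) * Y) / w"
    unfolding RR_def w_def[symmetric] minus_divide_left
    by (rule arg_cong[where f = "\<lambda>x. x / w"]) (simp add: power2_eq_square power3_eq_cube algebra_simps)
  finally have "log_growth z0 (t + ln c) = ln (1 + (Y^3 + 3 * Y\<^sup>2 + (2 + w) * Y) / w / z0)"
    unfolding log_growth_def by simp
  also have "1 + (Y^3 + 3 * Y\<^sup>2 + (2 + w) * Y) / w / z0 = A / (w * z0)"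
    unfolding A_def using w z by (simp add: field_simps)
  finally have Z1: "log_growth z0 (t + ln c) = ln (A / (w * z0))" .
  have Apos: "0 < A" unfolding A_def using w z Y1 by (intro add_pos_pos mult_pos_pos) auto
  have Bpos: "0 < B" unfolding B_def using z Y1 by simp
  have "3 * log_growth z0 t = ln ((1 + Y / z0)^3)"
    unfolding log_growth_def Y_def[symmetric] using z Y1 by (subst ln_realpow) (auto intro: add_pos_pos)
  also have "(1 + Y / z0)^3 = B / z0^3"
    unfolding B_def using z by (simp add: power_divide[symmetric] add_divide_distrib)
  finally have Z2: "3 * log_growth z0 t = ln (B / z0^3)" .
  have "log_growth z0 (t + ln c) - 3 * log_growth z0 t - ln (z0\<^sup>2 / w) = ln (A / B)"
    unfolding Z1 Z2 using Apos Bpos w z by (simp add: ln_div ln_mult ln_realpow)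
  moreover have "\<bar>ln (A / B)\<bar> \<le> (27 * Y\<^sup>2) / Y^3"
  proof (rule abs_ln_quotient_le)
    show "0 < Y ^ 3" using Y1 by simp
    show "Y ^ 3 \<le> A" unfolding A_def using w z Y1 by (simp add: add_nonneg_nonneg)
    show "Y ^ 3 \<le> B" unfolding B_def using z Y1 by (intro power_mono) auto
    have YY: "Y \<le> Y\<^sup>2" "1 \<le> Y\<^sup>2" using Y1 by (auto simp: power2_eq_square mult_le_cancel_right1 intro: order_trans)
    have z2: "z0\<^sup>2 \<le> 4" "0 \<le> z0\<^sup>2" using z power_mono[of z0 2 2] by auto
    have z3: "z0^3 \<le> 8" "0 \<le> z0^3" using z power_mono[of z0 2 3] by auto
    have wz: "0 \<le> w * z0" "w * z0 \<le> 2" using w z mult_mono[of w 1 z0 2] by auto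
    have "A - B = (3 - 3 * z0) * Y\<^sup>2 + (2 + w - 3 * z0\<^sup>2) * Y + (w * z0 - z0^3)"
      unfolding A_def B_def by (simp add: power2_eq_square power3_eq_cube algebra_simps)
    also have "\<bar>\<dots>\<bar> \<le> \<bar>3 - 3 * z0\<bar> * Y\<^sup>2 + \<bar>2 + w - 3 * z0\<^sup>2\<bar> * Y + \<bar>w * z0 - z0^3\<bar>"
      using Y1 by (intro order_trans[OF abs_triangle_ineq] add_mono) (auto simp: abs_mult intro!: order_trans[OF abs_triangle_ineq])
    \<comment> \<open>The leading cubes cancelled. \<open>z0 < 2\<close> and
      \<open>p * q \<le> 1\<close> bound the remaining coefficients by \<open>3\<close>,
      \<open>12\<close> and \<open>8\<close>, and \<open>1 \<le> Y\<close> raises every power to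
      \<open>Y\<^sup>2\<close>; the sum \<open>23\<close> is rounded up to
      \<open>27\<close>.\<close>
    also have "\<dots> \<le> 3 * Y\<^sup>2 + 12 * Y\<^sup>2 + 8 * Y\<^sup>2"
    proof (intro add_mono)
      show "\<bar>3 - 3 * z0\<bar> * Y\<^sup>2 \<le> 3 * Y\<^sup>2" using z by (intro mult_right_mono) auto
      have "\<bar>2 + w - 3 * z0\<^sup>2\<bar> \<le> 12" using z2 w by linarith
      thus "\<bar>2 + w - 3 * z0\<^sup>2\<bar> * Y \<le> 12 * Y\<^sup>2" using YY Y1 by (intro mult_mono) auto
      have "\<bar>w * z0 - z0^3\<bar> \<le> 8" using z3 wz by linarith
      thus "\<bar>w * z0 - z0^3\<bar> \<le> 8 * Y\<^sup>2" using YY by simp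
    qed
    finally show "\<bar>A - B\<bar> \<le> 27 * Y\<^sup>2" using YY(2) by simp
  qed
  moreover have "(27 * Y\<^sup>2) / Y^3 = 27 * (1 / Y)" using Y1 by (simp add: power2_eq_square power3_eq_cube)
  moreover have "1 / Y \<le> exp (- t)" using Yt Y1 by (simp add: exp_minus inverse_eq_divide frac_le)
  ultimately show ?thesis unfolding w_def by simp
qed

text \<open>The shift is \<open>l = ln c\<close> and the multiplier
  \<open>a = 3 = exp (rho * l)\<close>, so the divisor is nonzero exactly down to the abscissa
  \<open>rho\<close> where the growth bounds stop.\<close>

lemma log_growth_lap_meromorphic:
  assumes z0: "z0 \<in> {0<..<2}"
  shows "\<exists>G. G meromorphic_on {s. - 1 < Re s} \<and> (\<forall>s. rho < Re s \<longrightarrow> G s = lap_pos (log_growth z0) s)"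
proof (rule lap_pos_meromorphic[where l = "ln c" and a = 3 and k = "ln (z0\<^sup>2 / (p * q))" and D = 27])
  show "3 \<le> exp (rho * ln c)" using rho(3) scaling_pos by (simp add: powr_def)
  show "\<exists>C. \<forall>t\<ge>0. \<bar>log_growth z0 t\<bar> \<le> C * exp (b * t)" if "rho < b" for b
    using log_growth_le[OF z0] rho(2) that by (intro exp_bound_weaken) auto
qed (use log_growth_shift[OF z0] rho scaling_gt_1 in auto)

lemma lap_split:
  fixes f :: "real \<Rightarrow> real"
  assumes m [measurable]: "f \<in> borel_measurable borel"
    and bd: "\<And>b::real. \<beta> < b \<Longrightarrow> b \<le> 1 \<Longrightarrow> \<exists>C\<ge>0. \<forall>t. \<bar>f t\<bar> \<le> C * exp (b * t)"
    and s: "\<beta> < Re s" "Re s < 1"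
  shows "integrable lborel (\<lambda>t. of_real (f t) * exp (- (s * complex_of_real t)))"
    and "(\<integral>t. of_real (f t) * exp (- (s * complex_of_real t)) \<partial>lborel) = lap_neg f s + lap_pos f s"
proof -
  obtain C where C: "\<forall>t. \<bar>f t\<bar> \<le> C * exp (((\<beta> + Re s) / 2) * t)"
    using bd[of "(\<beta> + Re s) / 2"] s by auto
  obtain C' where C': "\<forall>t. \<bar>f t\<bar> \<le> C' * exp (1 * t)" using bd[of 1] s by auto
  have ip: "integrable lborel (\<lambda>t. of_real (indicator {0..} t * f t) * exp (- (s * complex_of_real t)))"
    using C s by (intro lap_pos_properties(2)[OF m, of C "(\<beta> + Re s) / 2"]) auto
  have "integrable lborel (\<lambda>t. of_real (indicator {..<0} t * f t) * exp (- (s * complex_of_real t)))"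
    using C' s by (intro lap_neg_properties(2)[OF m, of C' 1]) auto
  note i = this ip
  have eq: "(\<lambda>t. of_real (f t) * exp (- (s * complex_of_real t))) =
      (\<lambda>t. of_real (indicator {..<0} t * f t) * exp (- (s * complex_of_real t)) +
        of_real (indicator {0..} t * f t) * exp (- (s * complex_of_real t)))"
    by (auto simp: fun_eq_iff indicator_def)
  show "integrable lborel (\<lambda>t. of_real (f t) * exp (- (s * complex_of_real t)))"
    unfolding eq by (rule Bochner_Integration.integrable_add[OF i])
  show "(\<integral>t. of_real (f t) * exp (- (s * complex_of_real t)) \<partial>lborel) = lap_neg f s + lap_pos f s"
    unfolding eq lap_neg_def lap_pos_def by (rule Bochner_Integration.integral_add[OF i])
qed

lemma softplus_le': "0 < b \<Longrightarrow> b \<le> 1 \<Longrightarrow> \<exists>C\<ge>0. \<forall>t. \<bar>softplus t\<bar> \<le> C * exp (b * t)"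
  using softplus_le softplus_nonneg by (intro exI[of _ "1 / b"]) simp

text \<open>Translation by \<open>ln k\<close> multiplies the transform by
  \<open>k powr (- s)\<close>, and the sum over \<open>k\<close> may be integrated termwise. Both
  ends of the strip matter: \<open>rho < Re s\<close> for the series over the level set,
  \<open>Re s < 1\<close> for the integral at minus infinity, where \<open>softplus t\<close>
  behaves like \<open>exp t\<close>.\<close>

lemma mellin_identity:
  assumes z0: "z0 \<in> {0<..<2}" and s: "rho < Re s" "Re s < 1"
  shows "lap_neg (log_growth z0) s + lap_pos (log_growth z0) s =
    (lap_neg softplus s + lap_pos softplus s) * level_zeta z0 s"
proof -
  let ?e = "from_nat_into (level_set z0)" and ?x = "\<lambda>t. exp (- (s * complex_of_real t))"
  have s0: "0 < Re s" using s rho by simp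
  note gi = lap_split[OF softplus_measurable softplus_le' s0 s(2)]
  note hi' = lap_split(2)[OF log_growth_measurable log_growth_le[OF z0] s]
  let ?B = "lap_neg softplus s + lap_pos softplus s"
  define F where "F j t = of_real (softplus (t - ln (?e j))) * ?x t" for j t
  have Fs: "F j (ln (?e j) + 1 * t) = of_real (?e j) powr (- s) * (of_real (softplus t) * ?x t)" for j t
  proof -
    have "?x (ln (?e j) + 1 * t) = of_real (?e j) powr (- s) * ?x t"
      using level_set_enum_pos[OF z0, of j]
      by (simp add: powr_def Ln_of_real exp_add[symmetric] algebra_simps)
    thus ?thesis by (simp add: F_def)
  qed
  have Fm [measurable]: "F j \<in> borel_measurable borel" for j unfolding F_def by measurable
  have Fi: "integrable lborel (F j)" for j
  proof -
    have "integrable lborel (\<lambda>t. F j (ln (?e j) + 1 * t))" unfolding Fs using gi(1) by simp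
    thus ?thesis using lborel_integrable_real_affine_iff[of 1 "F j" "ln (?e j)"] by simp
  qed
  have FI: "integral\<^sup>L lborel (F j) = of_real (?e j) powr (- s) * ?B" for j
  proof -
    have "integral\<^sup>L lborel (F j) = (\<integral>t. F j (ln (?e j) + 1 * t) \<partial>lborel)"
      by (subst lborel_integral_real_affine[where c = 1 and t = "ln (?e j)"]) simp_all
    thus ?thesis unfolding Fs using gi(2) by simp
  qed
  have Fn: "(\<integral>t. norm (F j t) \<partial>lborel) = ?e j powr (- Re s) * (\<integral>t. norm (of_real (softplus t) * ?x t) \<partial>lborel)" for j
  proof -
    have "(\<integral>t. norm (F j t) \<partial>lborel) = (\<integral>t. norm (F j (ln (?e j) + 1 * t)) \<partial>lborel)"
      by (subst lborel_integral_real_affine[where c = 1 and t = "ln (?e j)"]) simp_all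
    moreover have "norm (complex_of_real (?e j) powr (- s)) = ?e j powr (- Re s)"
      using level_set_enum_pos[OF z0, of j] by (simp add: norm_powr_real_powr)
    ultimately show ?thesis unfolding Fs norm_mult by simp
  qed
  have "(\<lambda>j. integral\<^sup>L lborel (F j)) sums (\<integral>t. (\<Sum>j. F j t) \<partial>lborel)"
  proof (rule sums_integral[OF Fi])
    show "AE t in lborel. summable (\<lambda>j. norm (F j t))"
    proof (rule AE_I2)
      fix t
      have "summable (\<lambda>j. softplus (t - ln (?e j)) * norm (?x t))"
        using sums_summable[OF log_growth_sums[OF z0]] by (rule summable_mult2)
      thus "summable (\<lambda>j. norm (F j t))" by (simp add: F_def norm_mult softplus_nonneg)
    qed
    show "summable (\<lambda>j. \<integral>t. norm (F j t) \<partial>lborel)"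
      unfolding Fn by (rule summable_mult2[OF level_set_enum_summable[OF z0 s(1)]])
  qed
  moreover have "(\<Sum>j. F j t) = of_real (log_growth z0 t) * ?x t" for t
    unfolding F_def
    by (intro sums_unique[symmetric] sums_mult2 sums_of_real log_growth_sums[OF z0])
  ultimately have "(\<lambda>j. of_real (?e j) powr (- s) * ?B) sums (lap_neg (log_growth z0) s + lap_pos (log_growth z0) s)"
    using hi' FI by simp
  moreover have "(\<lambda>j. of_real (?e j) powr (- s) * ?B) sums (level_zeta z0 s * ?B)"
  proof -
    have "2 * rho < Re (2 * s)" using s by simp
    from summable_norm_cancel[OF R_zeta_limit(1)[OF z0 this]] have "summable (\<lambda>j. complex_of_real (?e j) powr (- s))"
      by simp
    thus ?thesis unfolding level_zeta_def by (intro sums_mult2 summable_sums)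
  qed
  ultimately show ?thesis by (metis sums_unique2 mult.commute)
qed

text \<open>A Dirichlet series is a Laplace transform over the counting measure with
  \<open>L = ln k\<close>, so the result for integrals applies on each strip to the right of
  \<open>rho\<close>.\<close>

lemma level_zeta_holomorphic:
  assumes z0: "z0 \<in> {0<..<2}"
  shows "level_zeta z0 holomorphic_on {s. rho < Re s}"
proof -
  let ?e = "from_nat_into (level_set z0)" and ?C = "count_space (UNIV :: nat set)"
  have int: "integrable ?C (\<lambda>j. 1 * exp (- (a * ln (?e j))))" if "rho < a" for a
  proof -
    have "1 * exp (- (a * ln (?e j))) = ?e j powr (- a)" for j
      using level_set_enum_pos[OF z0, of j] by (simp add: powr_def)
    thus ?thesis using level_set_enum_summable[OF z0 that] by (simp add: integrable_count_space_nat_iff)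
  qed
  define F where "F s = (\<integral>j. of_real 1 * exp (- (s * of_real (ln (?e j)))) \<partial>?C)" for s :: complex
  have eq: "level_zeta z0 s = F s" if "rho < Re s" for s
  proof -
    have "integrable ?C (\<lambda>j. of_real 1 * exp (- (s * complex_of_real (ln (?e j)))))"
      using that by (intro laplace_holomorphic(2)[OF _ _ int int, of "Re s" "Re s"]) auto
    from sums_integral_count_space_nat[OF this]
    have "(\<lambda>j. of_real 1 * exp (- (s * complex_of_real (ln (?e j))))) sums F s" by (simp only: F_def)
    moreover have "of_real 1 * exp (- (s * complex_of_real (ln (?e j)))) = of_real (?e j) powr (- s)" for j
      using level_set_enum_pos[OF z0, of j] by (simp add: powr_def Ln_of_real)
    ultimately show ?thesis by (simp add: level_zeta_def sums_iff)
  qed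
  have "F holomorphic_on {s. rho < Re s}"
    unfolding holomorphic_on_def
  proof
    fix s assume "s \<in> {s. rho < Re s}"
    hence s: "rho < Re s" by simp
    let ?S = "{w. (rho + Re s) / 2 < Re w \<and> Re w < Re s + 1}"
    have "open ?S" by (intro open_Collect_conj open_Collect_less continuous_intros)
    moreover have "F holomorphic_on ?S" unfolding F_def
      using s by (intro laplace_holomorphic(1)[OF _ _ int int]) auto
    moreover have "s \<in> ?S" using s by auto
    ultimately have "F field_differentiable at s" by (metis holomorphic_on_imp_differentiable_at)
    thus "F field_differentiable at s within {s. rho < Re s}" by (rule field_differentiable_at_within)
  qed
  thus ?thesis by (rule holomorphic_transform) (simp add: eq)
qed

text \<open>At a real point of the strip the integrand is positive. One such point suffices to keep
  the divisor in the continuation from vanishing identically.\<close>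

lemma lap_softplus_nonzero: "lap_neg softplus (1 / 2) + lap_pos softplus (1 / 2) \<noteq> 0"
proof
  assume 0: "lap_neg softplus (1 / 2) + lap_pos softplus (1 / 2) = 0"
  let ?f = "\<lambda>t. softplus t * exp (- (t / 2))"
  have eq: "of_real (softplus t) * exp (- (1 / 2 * complex_of_real t)) = complex_of_real (?f t)" for t
    by (simp add: exp_of_real[symmetric])
  have h: "0 < Re (1 / 2)" "Re (1 / 2) < 1" by simp_all
  note sp = lap_split[OF softplus_measurable softplus_le' h, unfolded eq]
  have i: "integrable lborel (\<lambda>t. complex_of_real (?f t))"
    and z: "(\<integral>t. complex_of_real (?f t) \<partial>lborel) = 0" using sp 0 by auto
  have i': "integrable lborel ?f" using i unfolding complex_of_real_integrable_eq .
  have "integral\<^sup>L lborel ?f = 0" using z unfolding integral_complex_of_real by simp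
  hence ae: "AE t in lborel. ?f t = 0" using i' softplus_nonneg by (subst (asm) integral_nonneg_eq_0_iff_AE) auto
  have "?f t \<noteq> 0" for t by (simp add: softplus_def ln_eq_zero_iff add_pos_pos)
  hence "AE t in lborel. ?f t = 0 \<longrightarrow> False" by blast
  with ae have "AE t in (lborel :: real measure). False" by (rule AE_mp)
  hence "emeasure lborel (UNIV :: real set) = 0" by (simp add: AE_iff_null null_sets_def)
  thus False by simp
qed

text \<open>On \<open>- 1 < Re s < 1\<close> the continued transforms \<open>N\<close> and
  \<open>D\<close> satisfy \<open>N = D * level_zeta z0\<close> wherever the series converges. The
  strip is connected and \<open>D\<close> is not identically zero on it, so \<open>N / D\<close> is
  meromorphic there; it is glued to the series along \<open>rho < Re s < 1\<close>.\<close>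

theorem level_zeta_meromorphic:
  assumes z0: "z0 \<in> {0<..<2}"
  shows "\<exists>G. G meromorphic_on {s. - 1 < Re s} \<and> (\<forall>s. rho < Re s \<longrightarrow> G s = level_zeta z0 s)"
proof -
  obtain GH where GH: "GH meromorphic_on {s. - 1 < Re s}" "\<And>s. rho < Re s \<Longrightarrow> GH s = lap_pos (log_growth z0) s"
    using log_growth_lap_meromorphic[OF z0] by blast
  obtain GS where GS: "GS meromorphic_on {s. - 1 < Re s}" "\<And>s. 0 < Re s \<Longrightarrow> GS s = lap_pos softplus s"
    using softplus_lap_meromorphic by blast
  let ?S = "{s. - 1 < Re s \<and> Re s < 1}"
  have op: "open ?S" by (intro open_Collect_conj open_Collect_less continuous_intros)
  have "?S = {s. - 1 < Re s} \<inter> {s. Re s < 1}" by auto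
  hence conn: "connected ?S"
    using convex_connected[OF convex_Int[OF convex_halfspace_Re_gt convex_halfspace_Re_lt]] by metis
  have neg: "lap_neg f meromorphic_on ?S"
    if f: "f \<in> borel_measurable borel" and bd: "\<exists>C\<ge>0. \<forall>t. \<bar>f t\<bar> \<le> C * exp (1 * t)" for f
  proof -
    obtain C where "\<forall>t. \<bar>f t\<bar> \<le> C * exp (1 * t)" using bd by blast
    hence "lap_neg f holomorphic_on {s. Re s < 1}" by (intro lap_neg_properties(1)[OF f]) auto
    hence "lap_neg f holomorphic_on ?S" by (rule holomorphic_on_subset) auto
    thus ?thesis using op by (intro analytic_on_imp_meromorphic_on) (simp add: analytic_on_open)
  qed
  define N where "N s = lap_neg (log_growth z0) s + GH s" for s
  define D where "D s = lap_neg softplus s + GS s" for s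
  have Nm: "N meromorphic_on ?S" unfolding N_def
    using neg[OF log_growth_measurable log_growth_le[OF z0, of 1]] rho(2)
    by (intro meromorphic_on_add meromorphic_on_subset[OF GH(1)]) auto
  have Dm: "D meromorphic_on ?S" unfolding D_def
    using neg[OF softplus_measurable softplus_le'[of 1]]
    by (intro meromorphic_on_add meromorphic_on_subset[OF GS(1)]) auto
  have ND: "N s = D s * level_zeta z0 s" if "rho < Re s" "Re s < 1" for s
    unfolding N_def D_def using mellin_identity[OF z0 that] GH(2)[OF that(1)] GS(2)[of s] that rho(1) by simp
  have avoid: "\<forall>\<^sub>\<approx>s\<in>?S. D s \<noteq> 0"
  proof -
    have "\<not> (\<forall>\<^sub>\<approx>s\<in>?S. D s = 0)"
    proof
      assume z: "\<forall>\<^sub>\<approx>s\<in>?S. D s = 0"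
      have "1 / 2 \<in> ?S" by simp
      hence ev: "\<forall>\<^sub>F s in at (1 / 2). D s = 0" using z by (simp add: eventually_cosparse_open_eq op)
      have "lap_neg softplus holomorphic_on {s. Re s < 1}"
      proof -
        obtain C where "\<forall>t. \<bar>softplus t\<bar> \<le> C * exp (1 * t)" using softplus_le'[of 1] by auto
        thus ?thesis by (intro lap_neg_properties(1)[OF softplus_measurable]) auto
      qed
      moreover have "lap_pos softplus holomorphic_on {s. 1 / 4 < Re s}"
      proof -
        obtain C where "\<forall>t. \<bar>softplus t\<bar> \<le> C * exp (1 / 4 * t)" using softplus_le'[of "1 / 4"] by auto
        thus ?thesis by (intro lap_pos_properties(1)[OF softplus_measurable]) auto
      qed
      ultimately have "(\<lambda>s. lap_neg softplus s + lap_pos softplus s) holomorphic_on {s. 1 / 4 < Re s \<and> Re s < 1}"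
        by (intro holomorphic_on_add) (auto intro: holomorphic_on_subset)
      moreover have op': "open {s. 1 / 4 < Re s \<and> Re s < 1}"
        by (intro open_Collect_conj open_Collect_less continuous_intros)
      ultimately have "continuous_on {s. 1 / 4 < Re s \<and> Re s < 1} (\<lambda>s. lap_neg softplus s + lap_pos softplus s)"
        by (intro holomorphic_on_imp_continuous_on)
      hence "isCont (\<lambda>s. lap_neg softplus s + lap_pos softplus s) (1 / 2)"
        using op' by (simp add: continuous_on_eq_continuous_at)
      hence lim: "((\<lambda>s. lap_neg softplus s + lap_pos softplus s) \<longlongrightarrow>
          lap_neg softplus (1 / 2) + lap_pos softplus (1 / 2)) (at (1 / 2))" by (simp add: isCont_def)
      have "\<forall>\<^sub>F s in at (1 / 2). s \<in> {s. 1 / 4 < Re s \<and> Re s < 1}"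
        using op' by (intro eventually_at_in_open') auto
      hence "\<forall>\<^sub>F s in at (1 / 2). lap_neg softplus s + lap_pos softplus s = 0"
        using ev by eventually_elim (use GS(2) in \<open>simp add: D_def\<close>)
      hence "((\<lambda>s. lap_neg softplus s + lap_pos softplus s) \<longlongrightarrow> 0) (at (1 / 2))" by (rule tendsto_eventually)
      hence "lap_neg softplus (1 / 2) + lap_pos softplus (1 / 2) = 0"
        by (intro tendsto_unique[OF _ lim]) simp_all
      thus False using lap_softplus_nonzero by simp
    qed
    thus ?thesis using meromorphic_imp_constant_or_avoid[OF Dm op conn, of 0] by blast
  qed
  \<comment> \<open>Taking the series wherever it converges makes the agreement pointwise; the
    quotient agrees with it only off the zeros of \<open>D\<close>, which is enough for
    meromorphy.\<close>
  define G where "G s = (if rho < Re s then level_zeta z0 s else N s / D s)" for s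
  have "G meromorphic_on {s. rho < Re s}"
  proof -
    have op2: "open {s. rho < Re s}" by (intro open_Collect_less continuous_intros)
    have "G holomorphic_on {s. rho < Re s}"
      by (rule holomorphic_transform[OF level_zeta_holomorphic[OF z0]]) (simp add: G_def)
    thus ?thesis using op2 by (intro analytic_on_imp_meromorphic_on) (simp add: analytic_on_open)
  qed
  moreover have "G meromorphic_on ?S"
  proof (subst meromorphic_on_cong')
    show "\<forall>\<^sub>\<approx>s\<in>?S. G s = N s / D s"
      using avoid eventually_in_cosparse[OF order_refl op]
      by eventually_elim (use ND in \<open>auto simp: G_def\<close>)
    show "(\<lambda>s. N s / D s) meromorphic_on ?S" by (rule meromorphic_on_divide[OF Nm Dm])
  qed simp
  ultimately have "G meromorphic_on ({s. rho < Re s} \<union> ?S)" by (rule meromorphic_on_Un)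
  moreover have "{s. - 1 < Re s} \<subseteq> {s. rho < Re s} \<union> ?S" using rho(2) by auto
  ultimately have "G meromorphic_on {s. - 1 < Re s}" by (rule meromorphic_on_subset)
  moreover have "G s = level_zeta z0 s" if "rho < Re s" for s using that by (simp add: G_def)
  ultimately show ?thesis by blast
qed

end

section \<open>Products of absolutely convergent sums and detection of power growth\<close>

lemma has_sum_times_banach:
  fixes f :: "'a \<Rightarrow> complex" and g :: "'b \<Rightarrow> complex"
  assumes f: "(f has_sum S) A" "(\<lambda>x. norm (f x)) summable_on A"
    and g: "(g has_sum T) B" "(\<lambda>x. norm (g x)) summable_on B"
  shows "((\<lambda>(x, y). f x * g y) has_sum (S * T)) (A \<times> B)"
proof -
  let ?h = "\<lambda>(x, y). f x * g y"
  have "(\<lambda>z. norm (?h z)) summable_on (A \<times> B)"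
    unfolding Infinite_Sum.abs_summable_on_Sigma_iff
  proof (intro conjI ballI)
    fix x
    show "(\<lambda>y. norm (?h (x, y))) summable_on B"
      using summable_on_cmult_right[OF g(2), of "norm (f x)"] by (simp add: norm_mult)
  next
    have "infsum (\<lambda>y. norm (?h (x, y))) B = norm (f x) * infsum (\<lambda>y. norm (g y)) B" for x
      by (simp add: norm_mult infsum_cmult_right[OF g(2)])
    thus "(\<lambda>x. norm (infsum (\<lambda>y. norm (?h (x, y))) B)) summable_on A"
      using summable_on_cmult_left[OF f(2), of "\<bar>infsum (\<lambda>y. norm (g y)) B\<bar>"] by (simp add: abs_mult)
  qed
  hence "?h summable_on (A \<times> B)" by (rule abs_summable_summable)
  moreover have "((\<lambda>y. ?h (x, y)) has_sum (f x * T)) B" for x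
    using has_sum_cmult_right[OF g(1), of "f x"] by simp
  ultimately show ?thesis by (intro has_sum_SigmaI[OF _ has_sum_cmult_left[OF f(1)]])
qed

text \<open>An equivalence, since the spectral dimension is a definite description: existence and
  uniqueness of the exponent come together. Too small an exponent makes the limit superior infinite,
  too large a one makes the limit inferior \<open>0\<close>.\<close>

lemma Liminf_Limsup_powr_iff:
  fixes f :: "real \<Rightarrow> real"
  assumes A: "0 < A" and f: "\<forall>\<^sub>F t in at_top. A * t powr a \<le> f t" "\<forall>\<^sub>F t in at_top. f t \<le> B * t powr a"
  shows "0 < Liminf at_top (\<lambda>t. ereal (f t * t powr (- b))) \<and>
    Limsup at_top (\<lambda>t. ereal (f t * t powr (- b))) < \<infinity> \<longleftrightarrow> b = a"
proof -
  have lo: "\<forall>\<^sub>F t in at_top. ereal (A * t powr (a - b)) \<le> ereal (f t * t powr (- b))"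
    using f(1) eventually_gt_at_top[of 0]
  proof eventually_elim
    case (elim t)
    have "A * t powr a * t powr (- b) \<le> f t * t powr (- b)" using elim by (intro mult_right_mono) auto
    thus ?case by (simp add: mult.assoc powr_add[symmetric])
  qed
  have up: "\<forall>\<^sub>F t in at_top. ereal (f t * t powr (- b)) \<le> ereal (B * t powr (a - b))"
    using f(2) eventually_gt_at_top[of 0]
  proof eventually_elim
    case (elim t)
    have "f t * t powr (- b) \<le> B * t powr a * t powr (- b)" using elim by (intro mult_right_mono) auto
    thus ?case by (simp add: mult.assoc powr_add[symmetric])
  qed
  have nt: "at_top \<noteq> (bot :: real filter)" by simp
  consider "b = a" | "b < a" | "a < b" by linarith
  thus ?thesis
  proof cases
    case 1
    have "\<forall>\<^sub>F t in at_top. ereal A \<le> ereal (f t * t powr (- b))"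
      using lo eventually_gt_at_top[of 0] by eventually_elim (simp add: 1)
    hence "ereal A \<le> Liminf at_top (\<lambda>t. ereal (f t * t powr (- b)))" by (rule Liminf_bounded)
    moreover have "0 < ereal A" using A by simp
    moreover have "\<forall>\<^sub>F t in at_top. ereal (f t * t powr (- b)) \<le> ereal B"
      using up eventually_gt_at_top[of 0] by eventually_elim (simp add: 1)
    hence "Limsup at_top (\<lambda>t. ereal (f t * t powr (- b))) \<le> ereal B" by (rule Limsup_bounded)
    moreover have "ereal B < \<infinity>" by simp
    ultimately show ?thesis using 1 by (meson order_less_le_trans order_le_less_trans)
  next
    case 2
    have "filterlim (\<lambda>t. exp ((a - b) * ln t)) at_top at_top" using 2
      by (intro filterlim_compose[OF exp_at_top] filterlim_tendsto_pos_mult_at_top[OF tendsto_const _ ln_at_top]) simp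
    hence "filterlim (\<lambda>t. A * exp ((a - b) * ln t)) at_top at_top"
      using A by (intro filterlim_tendsto_pos_mult_at_top[OF tendsto_const])
    moreover have "\<forall>\<^sub>F t in at_top. A * exp ((a - b) * ln t) = A * t powr (a - b)"
      using eventually_gt_at_top[of 0] by eventually_elim (simp add: powr_def)
    ultimately have "filterlim (\<lambda>t. A * t powr (a - b)) at_top at_top"
      by (rule filterlim_cong[OF refl refl, THEN iffD1, rotated])
    hence "((\<lambda>t. ereal (A * t powr (a - b))) \<longlongrightarrow> \<infinity>) at_top" by (simp add: tendsto_PInfty_eq_at_top)
    hence "Limsup at_top (\<lambda>t. ereal (A * t powr (a - b))) = \<infinity>" by (rule lim_imp_Limsup[OF nt])
    thus ?thesis using Limsup_mono[OF lo] 2 by auto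
  next
    case 3
    have "((\<lambda>t. B * t powr (a - b)) \<longlongrightarrow> B * 0) at_top"
      using 3 by (intro tendsto_mult tendsto_const tendsto_neg_powr filterlim_ident) auto
    hence "((\<lambda>t. ereal (B * t powr (a - b))) \<longlongrightarrow> 0) at_top"
      by (simp add: zero_ereal_def)
    hence "Liminf at_top (\<lambda>t. ereal (B * t powr (a - b))) = 0" by (rule lim_imp_Liminf[OF nt])
    thus ?thesis using Liminf_mono[OF up] 3 by auto
  qed
qed

context self_similar_interval_asym
begin

subsection \<open>The spectral dimension and the spectral zeta function\<close>

text \<open>The primitive points: each nonzero eigenvalue is \<open>c ^ Suc j * k\<close> for
  exactly one generation \<open>j\<close> and one generator \<open>k\<close>, by
  \<open>eigenvalues_bij\<close>.\<close>

definition generators :: "real set" where "generators = level_set (1 + q) \<union> level_set (1 - q)"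

lemma base_points: "1 + q \<in> {0<..<2}" "1 - q \<in> {0<..<2}"
  using p_pos p_less_1 by auto

lemma level_sets_disjoint: "level_set (1 + q) \<inter> level_set (1 - q) = {}"
  using p_less_1 by (auto simp: level_set_def)

lemma RR_base_points: "RR (1 + q) \<in> {0, 2}" "RR (1 - q) \<in> {0, 2}"
proof -
  have "1 + q = 1 + lo \<or> 1 + q = 1 + hi" "1 - q = lo \<or> 1 - q = hi"
    unfolding lo_def hi_def by (auto simp: min_def max_def)
  thus "RR (1 + q) \<in> {0, 2}" "RR (1 - q) \<in> {0, 2}" using RR_special by (metis insert_iff)+
qed

text \<open>\<open>RR\<close> sends both base points into its fixed points \<open>0\<close> and
  \<open>2\<close>. A scaled generator therefore never reaches a base point again, and the
  generation of an eigenvalue is unique.\<close>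

lemma Z_scaled_generator:
  assumes "k \<in> generators" shows "Z (c ^ Suc n * k) \<in> {0, 2}"
proof -
  have it: "(RR ^^ Suc n) z \<in> {0, 2}" if "RR z \<in> {0, 2}" for z
    using that RR_special(5,6) by (induction n) auto
  have "Z k = 1 + q \<or> Z k = 1 - q" using assms by (auto simp: generators_def level_set_def)
  thus ?thesis
    by (elim disjE; simp only: Z_scaling_pow it[OF RR_base_points(1)] it[OF RR_base_points(2)])
qed

lemma generators_scale_inj:
  assumes k: "k \<in> generators" "k' \<in> generators" and eq: "c ^ i * k = c ^ j * k'"
  shows "i = j \<and> k = k'"
proof -
  have cp: "0 < c" by (rule scaling_pos)
  have *: False if "k \<in> generators" "k' \<in> generators" "c ^ i * k = c ^ j * k'" "i < j" for k k' i j
  proof -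
    obtain n where n: "j = i + Suc n" using \<open>i < j\<close> less_iff_Suc_add by auto
    have "c ^ i * k = c ^ i * (c ^ Suc n * k')" using that(3) unfolding n power_add by (simp add: mult.assoc)
    hence "k = c ^ Suc n * k'" using cp by simp
    hence "Z k \<in> {0, 2}" using Z_scaled_generator[OF that(2)] by simp
    moreover have "Z k = 1 + q \<or> Z k = 1 - q" using that(1) by (auto simp: generators_def level_set_def)
    ultimately show False using p_pos p_less_1 by auto
  qed
  have "i = j" using *[OF k eq] *[OF k(2,1) eq[symmetric]] by (metis nat_neq_iff)
  thus ?thesis using eq cp by simp
qed

lemma eigenvalues_bij:
  "bij_betw (\<lambda>(j, k). c ^ Suc j * k) (UNIV \<times> generators) (nonzero_eigenvalues p)"
proof (rule bij_betw_imageI)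
  show "inj_on (\<lambda>(j, k). c ^ Suc j * k) (UNIV \<times> generators)"
  proof (rule inj_onI, clarify)
    fix i j k k' assume "k \<in> generators" "k' \<in> generators" "c ^ Suc i * k = c ^ Suc j * k'"
    from generators_scale_inj[OF this] show "i = j \<and> k = k'" by simp
  qed
  show "(\<lambda>(j, k). c ^ Suc j * k) ` (UNIV \<times> generators) = nonzero_eigenvalues p" (is "?L = ?R")
  proof (intro set_eqI iffI)
    fix x assume "x \<in> ?L"
    then obtain j k where k: "k \<in> generators" and x: "x = c ^ Suc j * k" by auto
    have "0 < k" using k level_set_pos by (auto simp: generators_def)
    moreover have "x / c ^ Suc j = k" unfolding x using scaling_pos by simp
    moreover from calculation have "x \<noteq> 0" by auto
    moreover have "Z k = 1 + q \<or> Z k = 1 - q" using k by (auto simp: generators_def level_set_def)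
    ultimately show "x \<in> ?R" unfolding nonzero_eigenvalues_eq by blast
  next
    fix x assume "x \<in> ?R"
    then obtain j where x0: "x \<noteq> 0" and j: "Z (x / c ^ Suc j) = 1 + q \<or> Z (x / c ^ Suc j) = 1 - q"
      unfolding nonzero_eigenvalues_eq by blast
    let ?k = "x / c ^ Suc j"
    \<comment> \<open>The description of the eigenvalues requires only \<open>x \<noteq> 0\<close>.
      For negative arguments \<open>Z\<close> is negative by \<open>Z_neg_ge\<close>, whereas the
      base points are positive.\<close>
    have Zp: "0 < Z ?k" using j p_pos p_less_1 by auto
    have "0 < ?k"
    proof (rule ccontr)
      assume "\<not> 0 < ?k"
      hence "- ?k \<le> - Z ?k" using Z_neg_ge[of "- ?k"] by simp
      thus False using Zp \<open>\<not> 0 < ?k\<close> by linarith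
    qed
    hence "?k \<in> generators" using j by (auto simp: generators_def level_set_def)
    moreover have "x = c ^ Suc j * ?k" using scaling_pos by simp
    ultimately show "x \<in> ?L" by (intro image_eqI[of _ _ "(j, ?k)"]) auto
  qed
qed

lemma generators_card:
  "finite (generators \<inter> {..c ^ n * kap})" "card (generators \<inter> {..c ^ n * kap}) \<le> 2 * 3 ^ n"
proof -
  have eq: "generators \<inter> {..c ^ n * kap} =
      (level_set (1 + q) \<inter> {..c ^ n * kap}) \<union> (level_set (1 - q) \<inter> {..c ^ n * kap})"
    by (auto simp: generators_def)
  note L = level_set_card[OF base_points(1), of n] level_set_card[OF base_points(2), of n]
  show "finite (generators \<inter> {..c ^ n * kap})" unfolding eq using L by blast
  show "card (generators \<inter> {..c ^ n * kap}) \<le> 2 * 3 ^ n"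
    unfolding eq by (rule order_trans[OF card_Un_le]) (unfold L(2,4), simp)
qed

text \<open>Both base points are at least \<open>lo = Z (kap / c)\<close>. Hence an eigenvalue below
  \<open>c ^ n * kap\<close> belongs to one of the first \<open>n\<close> generations.\<close>

lemma generators_ge:
  assumes "k \<in> generators" shows "kap / c \<le> k"
proof (rule ccontr)
  assume "\<not> kap / c \<le> k"
  moreover have k: "0 < k" using assms level_set_pos by (auto simp: generators_def)
  moreover have "kap / c \<le> kap" using kap(1) scaling_gt_1 by (simp add: divide_le_eq)
  ultimately have "Z k < lo" using kap(2)[of k "kap / c"] kap(4) by simp
  moreover have "lo \<le> Z k" using assms p_pos p_less_1 by (auto simp: generators_def level_set_def lo_def)
  ultimately show False by simp
qed

text \<open>Generation \<open>j\<close> contributes at most \<open>2 * 3 ^ (n - Suc j)\<close>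
  values, two level sets at a time, and these bounds add up to \<open>3 ^ n - 1\<close>.\<close>

lemma eigenvalues_below:
  "finite {x \<in> nonzero_eigenvalues p. x < c ^ n * kap}"
  "card {x \<in> nonzero_eigenvalues p. x < c ^ n * kap} \<le> 3 ^ n"
proof -
  let ?T = "SIGMA j:{..<n}. generators \<inter> {..c ^ (n - Suc j) * kap}"
  let ?h = "\<lambda>(j, k). c ^ Suc j * k"
  have cp: "0 < c" by (rule scaling_pos)
  have sub: "{x \<in> nonzero_eigenvalues p. x < c ^ n * kap} \<subseteq> ?h ` ?T"
  proof
    fix x assume "x \<in> {x \<in> nonzero_eigenvalues p. x < c ^ n * kap}"
    hence "x \<in> ?h ` (UNIV \<times> generators)" and xl: "x < c ^ n * kap"
      unfolding bij_betw_imp_surj_on[OF eigenvalues_bij] by simp_all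
    then obtain j k where k: "k \<in> generators" and x: "x = c ^ Suc j * k" by auto
    note lt = xl[unfolded x]
    have j: "j < n"
    proof (rule ccontr)
      assume "\<not> j < n"
      hence "c ^ n * kap \<le> c ^ j * kap" by (intro exhaust_mono) simp
      also have "\<dots> = c ^ Suc j * (kap / c)" using cp by simp
      also have "\<dots> \<le> c ^ Suc j * k" using generators_ge[OF k] cp by (intro mult_left_mono) auto
      finally show False using lt by simp
    qed
    hence "c ^ n = c ^ Suc j * c ^ (n - Suc j)" by (simp only: power_add[symmetric]) simp
    hence "k \<le> c ^ (n - Suc j) * kap" using lt cp by (simp add: mult.assoc)
    thus "x \<in> ?h ` ?T" using j k x by (intro image_eqI[of _ _ "(j, k)"]) auto
  qed
  have fin: "finite ?T" using generators_card by (intro finite_SigmaI) auto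
  show "finite {x \<in> nonzero_eigenvalues p. x < c ^ n * kap}" using finite_subset[OF sub] fin by blast
  have "card {x \<in> nonzero_eigenvalues p. x < c ^ n * kap} \<le> card ?T"
    using surj_card_le[OF fin sub] .
  also have "card ?T = (\<Sum>j<n. card (generators \<inter> {..c ^ (n - Suc j) * kap}))"
    using generators_card by (intro card_SigmaI) auto
  also have "\<dots> \<le> (\<Sum>j<n. 2 * 3 ^ (n - Suc j))" by (intro sum_mono generators_card)
  also have "\<dots> = (\<Sum>j<n. 2 * 3 ^ j)" by (rule sum.nat_diff_reindex)
  also have "\<dots> \<le> 3 ^ n" by (induction n) auto
  finally show "card {x \<in> nonzero_eigenvalues p. x < c ^ n * kap} \<le> 3 ^ n" .
qed

lemma eigenvalue_count_eq: "eigenvalue_count p t = real (card {x \<in> nonzero_eigenvalues p. x < t})"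
  unfolding eigenvalue_count_def using multiplicity_one by simp

lemma eigenvalue_count_le:
  assumes "t \<le> c ^ n * kap" shows "eigenvalue_count p t \<le> 3 ^ n"
proof -
  have "card {x \<in> nonzero_eigenvalues p. x < t} \<le> card {x \<in> nonzero_eigenvalues p. x < c ^ n * kap}"
    using assms by (intro card_mono eigenvalues_below) auto
  also note eigenvalues_below(2)
  finally show ?thesis unfolding eigenvalue_count_eq by (metis of_nat_le_iff of_nat_numeral of_nat_power)
qed

text \<open>The first generation over a single base point already has the right order of magnitude;
  it is the level set scaled by \<open>c\<close>.\<close>

lemma eigenvalue_count_ge:
  assumes "c ^ Suc n * kap < t" shows "3 ^ n \<le> eigenvalue_count p t"
proof -
  let ?L = "level_set (1 + q) \<inter> {..c ^ n * kap}"
  have cp: "0 < c" by (rule scaling_pos)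
  obtain N where "t \<le> c ^ N * kap" using level_set_exhaust by blast
  hence fin: "finite {x \<in> nonzero_eigenvalues p. x < t}"
    by (intro finite_subset[OF _ eigenvalues_below(1)[of N]]) auto
  have "(\<lambda>k. c * k) ` ?L \<subseteq> {x \<in> nonzero_eigenvalues p. x < t}"
  proof safe
    fix k assume k: "k \<in> level_set (1 + q)" "k \<le> c ^ n * kap"
    have "(\<lambda>(j, k). c ^ Suc j * k) (0, k) \<in> nonzero_eigenvalues p"
      using k(1) by (intro bij_betwE[OF eigenvalues_bij, rule_format]) (simp add: generators_def)
    thus "c * k \<in> nonzero_eigenvalues p" by simp
    have "c * k \<le> c * (c ^ n * kap)" using k cp by (intro mult_left_mono) auto
    thus "c * k < t" using assms by (simp add: mult.assoc)
  qed
  from card_mono[OF fin this] have "card ((\<lambda>k. c * k) ` ?L) \<le> card {x \<in> nonzero_eigenvalues p. x < t}" .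
  also have "card ((\<lambda>k. c * k) ` ?L) = 3 ^ n"
    using level_set_card(2)[OF base_points(1)] cp by (subst card_image) (auto simp: inj_on_def)
  finally show ?thesis unfolding eigenvalue_count_eq by (metis of_nat_le_iff of_nat_numeral of_nat_power)
qed

lemma eigenvalue_count_bounds:
  assumes "c * kap < t"
  shows "1 / (9 * kap powr rho) * t powr rho \<le> eigenvalue_count p t"
    and "eigenvalue_count p t \<le> 3 / kap powr rho * t powr rho"
proof -
  have cp: "0 < c" by (rule scaling_pos)
  have kp: "0 < kap powr rho" using kap(1) by simp
  have t: "0 < t" using mult_pos_pos[OF cp kap(1)] assms by linarith
  have powr: "(c ^ n * kap) powr rho = 3 ^ n * kap powr rho" for n
    using cp kap(1) by (simp add: powr_mult scaling_pow_powr)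
  \<comment> \<open>By minimality \<open>c ^ (n - 1) * kap < t\<close>, so the lower count applies
    with index \<open>n - 2\<close>. The two lost factors \<open>3\<close> are the \<open>9\<close>
    in the constant, and \<open>2 \<le> n\<close> is what the assumption on \<open>t\<close>
    secures.\<close>
  define n where "n = (LEAST n. t \<le> c ^ n * kap)"
  have n: "t \<le> c ^ n * kap" unfolding n_def using level_set_exhaust by (rule LeastI_ex)
  have "2 \<le> n"
  proof (rule ccontr)
    assume "\<not> 2 \<le> n"
    hence "c ^ n * kap \<le> c ^ 1 * kap" by (intro exhaust_mono) simp
    thus False using n assms by simp
  qed
  then obtain i where i: "n = Suc (Suc i)" using that[of "n - 2"] by linarith
  have "Suc i < n" unfolding i by simp
  hence "\<not> t \<le> c ^ Suc i * kap" unfolding n_def by (rule not_less_Least)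
  hence l: "c ^ Suc i * kap < t" by linarith
  have "t powr rho \<le> (c ^ n * kap) powr rho" using n t rho(1) by (intro powr_mono2) auto
  also have "\<dots> = 9 * 3 ^ i * kap powr rho" unfolding powr i by simp
  finally have "1 / (9 * kap powr rho) * t powr rho \<le> 3 ^ i" using kp by (simp add: divide_le_eq mult_ac)
  thus "1 / (9 * kap powr rho) * t powr rho \<le> eigenvalue_count p t"
    using eigenvalue_count_ge[OF l] by linarith
  have "3 ^ Suc i * kap powr rho \<le> t powr rho"
    unfolding powr[symmetric] using l cp kap(1) rho(1) by (intro powr_mono2) auto
  hence "3 ^ n \<le> 3 / kap powr rho * t powr rho" unfolding i using kp by (simp add: pos_le_divide_eq mult_ac)
  thus "eigenvalue_count p t \<le> 3 / kap powr rho * t powr rho"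
    using eigenvalue_count_le[OF n] by linarith
qed

lemma is_spectral_dimension_iff: "is_spectral_dimension p d \<longleftrightarrow> d = 2 * rho"
proof -
  note ev = eventually_mono[OF eventually_gt_at_top[of "c * kap"]]
  have "0 < 1 / (9 * kap powr rho)" using kap(1) by simp
  from Liminf_Limsup_powr_iff[OF this ev[OF eigenvalue_count_bounds(1)] ev[OF eigenvalue_count_bounds(2)], of "d / 2"]
  show ?thesis unfolding is_spectral_dimension_def by auto
qed

lemma spectral_dimension_eq: "spectral_dimension p = 2 * rho"
  unfolding spectral_dimension_def is_spectral_dimension_iff by simp

lemma R_zeta_eq:
  assumes "z0 \<in> {0<..<2}" "2 * rho < Re s"
  shows "R_zeta p (of_real z0) s = level_zeta z0 (s / 2)" "convergent (R_zeta_approx p (of_real z0) s)"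
  unfolding R_zeta_def using R_zeta_limit(2)[OF assms] by (rule limI, rule convergentI)

text \<open>Writing each eigenvalue as \<open>c ^ Suc j * k\<close> splits the sum into a geometric
  series in \<open>w = c powr (- s / 2)\<close> and a sum over the generators. The geometric series
  starts at the first power, so it equals \<open>w / (1 - w)\<close>.\<close>

theorem zeta_term_has_sum:
  assumes s: "2 * rho < Re s"
  shows "(zeta_term p s has_sum (of_real c powr (- s / 2) / (1 - of_real c powr (- s / 2)) *
    (level_zeta (1 + q) (s / 2) + level_zeta (1 - q) (s / 2)))) (nonzero_eigenvalues p)"
proof -
  have cp: "0 < c" by (rule scaling_pos)
  define w where "w = complex_of_real c powr (- s / 2)"
  let ?g = "\<lambda>k. complex_of_real k powr (- s / 2)"
  have "norm w = c powr (- Re s / 2)" unfolding w_def using cp by (simp add: norm_powr_real_powr)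
  also have "\<dots> < c powr 0" using s rho(1) scaling_gt_1 by (intro powr_less_mono) auto
  finally have w: "norm w < 1" using cp by simp
  have "(\<lambda>j. w * w ^ j) sums (w * (1 / (1 - w)))" by (rule sums_mult[OF geometric_sums[OF w]])
  hence ws': "(\<lambda>j. w ^ Suc j) sums (w / (1 - w))" unfolding power_Suc by (metis times_divide_eq_right mult_1_right)
  have "summable (\<lambda>j. norm w * norm w ^ j)" by (rule summable_mult[OF summable_geometric]) (simp add: w)
  hence nw: "summable (\<lambda>j. norm (w ^ Suc j))" by (simp only: norm_mult norm_power power_Suc)
  note ws = norm_summable_imp_has_sum[OF nw ws']
  have wn: "(\<lambda>j. norm (w ^ Suc j)) summable_on UNIV"
    by (rule norm_summable_imp_summable_on) (simp only: real_norm_def abs_norm_cancel nw)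
  note a = level_zeta_has_sum[OF base_points(1) s] and b = level_zeta_has_sum[OF base_points(2) s]
  have g: "(?g has_sum (level_zeta (1 + q) (s / 2) + level_zeta (1 - q) (s / 2))) generators"
    "(\<lambda>k. norm (?g k)) summable_on generators"
    unfolding generators_def
    by (rule has_sum_Un_disjoint[OF a(1) b(1) level_sets_disjoint])
       (rule summable_on_Un_disjoint[OF a(2) b(2) level_sets_disjoint])
  have "zeta_term p s (c ^ Suc j * k) = w ^ Suc j * ?g k" if k: "k \<in> generators" for j k
  proof -
    have "(\<lambda>(j, k). c ^ Suc j * k) (j, k) \<in> nonzero_eigenvalues p"
      using k by (intro bij_betwE[OF eigenvalues_bij, rule_format]) simp
    hence m1: "multiplicity_ev p (c ^ Suc j * k) = 1" using multiplicity_one by simp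
    have k0: "0 < k" using k level_set_pos by (auto simp: generators_def)
    have "complex_of_real (c ^ n) powr (- s / 2) = w ^ n" for n
    proof (induction n)
      case (Suc n)
      have "complex_of_real (c ^ Suc n) powr (- s / 2) = (of_real c * of_real (c ^ n)) powr (- s / 2)" by simp
      also have "\<dots> = w * complex_of_real (c ^ n) powr (- s / 2)"
        unfolding w_def using cp by (intro powr_times_real) (auto simp del: of_real_power)
      also have "\<dots> = w * w ^ n" unfolding Suc ..
      finally show ?case by simp
    qed simp
    hence "complex_of_real (c ^ Suc j) powr (- s / 2) = w ^ Suc j" .
    moreover have "complex_of_real (c ^ Suc j * k) powr (- s / 2) = complex_of_real (c ^ Suc j) powr (- s / 2) * ?g k"
      unfolding of_real_mult using cp k0 by (intro powr_times_real) (auto simp del: power_Suc of_real_power)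
    ultimately show ?thesis unfolding zeta_term_def m1 by (simp only: of_nat_1 mult_1_left)
  qed
  hence eq: "(\<lambda>(j, k). w ^ Suc j * ?g k) z = zeta_term p s ((\<lambda>(j, k). c ^ Suc j * k) z)"
    if "z \<in> UNIV \<times> generators" for z using that by auto
  have "((\<lambda>z. zeta_term p s ((\<lambda>(j, k). c ^ Suc j * k) z)) has_sum
      (w / (1 - w) * (level_zeta (1 + q) (s / 2) + level_zeta (1 - q) (s / 2)))) (UNIV \<times> generators)"
    by (rule has_sum_cong[THEN iffD1, OF _ has_sum_times_banach[OF ws wn g]]) (rule eq)
  thus ?thesis unfolding has_sum_reindex_bij_betw[OF eigenvalues_bij] w_def .
qed

theorem spectral_zeta_meromorphic:
  "\<exists>g. g meromorphic_on {s. - 2 < Re s} \<and> (\<forall>s. 2 * rho < Re s \<longrightarrow> g s = spectral_zeta p s)"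
proof -
  obtain G1 where G1: "G1 meromorphic_on {s. - 1 < Re s}" "\<And>s. rho < Re s \<Longrightarrow> G1 s = level_zeta (1 + q) s"
    using level_zeta_meromorphic[OF base_points(1)] by blast
  obtain G2 where G2: "G2 meromorphic_on {s. - 1 < Re s}" "\<And>s. rho < Re s \<Longrightarrow> G2 s = level_zeta (1 - q) s"
    using level_zeta_meromorphic[OF base_points(2)] by blast
  let ?S = "{s. - 2 < Re s}" and ?w = "\<lambda>s. complex_of_real c powr (- s / 2)"
  have half: "(\<lambda>s. s / 2) analytic_on ?S" by (intro analytic_intros) auto
  have m: "(\<lambda>s. G1 (s / 2)) meromorphic_on ?S" "(\<lambda>s. G2 (s / 2)) meromorphic_on ?S"
    by (rule meromorphic_on_compose[OF G1(1) half], force) (rule meromorphic_on_compose[OF G2(1) half], force)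
  have "(\<lambda>s. exp (- s / 2 * of_real (ln c))) meromorphic_on ?S"
    by (intro analytic_on_imp_meromorphic_on analytic_intros) auto
  moreover have "?w = (\<lambda>s. exp (- s / 2 * of_real (ln c)))"
    using scaling_pos by (auto simp: fun_eq_iff powr_def Ln_of_real)
  ultimately have w: "?w meromorphic_on ?S" by simp
  have "(\<lambda>s. ?w s / (1 - ?w s) * (G1 (s / 2) + G2 (s / 2))) meromorphic_on ?S"
    by (intro meromorphic_intros w m)
  moreover have "?w s / (1 - ?w s) * (G1 (s / 2) + G2 (s / 2)) = spectral_zeta p s" if s: "2 * rho < Re s" for s
    unfolding spectral_zeta_def infsumI[OF zeta_term_has_sum[OF s]] using s by (simp add: G1(2) G2(2))
  ultimately show ?thesis by blast
qed

end

theorem theorem4: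
  shows "(\<forall>p::real. 0 < p \<and> p < 1 \<and> p \<noteq> 1/2 \<longrightarrow>
            is_spectral_dimension p (spectral_dimension p) \<and>
            spectral_dimension p = R_dimension p \<and> R_dimension p < 1 \<and>
            (\<forall>s. Re s > R_dimension p \<longrightarrow>
               zeta_term p s summable_on nonzero_eigenvalues p \<and>
               convergent (R_zeta_approx p (of_real (1 + (1 - p))) s) \<and>
               convergent (R_zeta_approx p (of_real (1 - (1 - p))) s) \<and>
               spectral_zeta p s =
                 of_real (scaling p) powr (- s / 2) / (1 - of_real (scaling p) powr (- s / 2)) *
                 (R_zeta p (of_real (1 + (1 - p))) s + R_zeta p (of_real (1 - (1 - p))) s)))
         \<and> (\<exists>\<epsilon> :: real \<Rightarrow> real.
              (\<forall>p. 0 < p \<and> p < 1 \<and> p \<noteq> 1/2 \<longrightarrow>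
                 \<epsilon> p > 0 \<and>
                 (\<exists>g. g meromorphic_on {s. Re s > - \<epsilon> p} \<and>
                      (\<forall>s. Re s > R_dimension p \<longrightarrow> g s = spectral_zeta p s))) \<and>
              Liminf (at_right 0) (\<lambda>p. ereal (\<epsilon> p)) \<ge> 2 \<and>
              Liminf (at_left 1) (\<lambda>p. ereal (\<epsilon> p)) \<ge> 2)"
proof (intro conjI allI impI)
  fix p :: real assume "0 < p \<and> p < 1 \<and> p \<noteq> 1/2"
  then interpret self_similar_interval_asym p by unfold_locales auto
  show "is_spectral_dimension p (spectral_dimension p)"
    by (simp only: is_spectral_dimension_iff spectral_dimension_eq)
  show "spectral_dimension p = R_dimension p" by (simp only: spectral_dimension_eq R_dimension_eq)
  show "R_dimension p < 1" unfolding R_dimension_eq using rho(2) by simp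
  fix s :: complex assume "R_dimension p < Re s"
  hence s: "2 * rho < Re s" unfolding R_dimension_eq .
  note sum = zeta_term_has_sum[OF s]
  note R = R_zeta_eq[OF base_points(1) s] R_zeta_eq[OF base_points(2) s]
  show "zeta_term p s summable_on nonzero_eigenvalues p" using sum by (rule has_sum_imp_summable)
  show "convergent (R_zeta_approx p (of_real (1 + (1 - p))) s)" by (rule R)
  show "convergent (R_zeta_approx p (of_real (1 - (1 - p))) s)" by (rule R)
  show "spectral_zeta p s =
      of_real (scaling p) powr (- s / 2) / (1 - of_real (scaling p) powr (- s / 2)) *
      (R_zeta p (of_real (1 + (1 - p))) s + R_zeta p (of_real (1 - (1 - p))) s)"
    unfolding spectral_zeta_def R by (rule infsumI[OF sum])
next
  have ev: "0 < (2 :: real) \<and> (\<exists>g. g meromorphic_on {s. Re s > - 2} \<and>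
      (\<forall>s. Re s > R_dimension p \<longrightarrow> g s = spectral_zeta p s))" if p: "0 < p \<and> p < 1 \<and> p \<noteq> 1/2" for p :: real
  proof -
    interpret self_similar_interval_asym p using p by unfold_locales auto
    show ?thesis unfolding R_dimension_eq using spectral_zeta_meromorphic by simp
  qed
  \<comment> \<open>The same width \<open>2\<close> works for every \<open>p\<close>, so both limits
    inferior are those of a constant function.\<close>
  have "2 \<le> Liminf (at_right 0) (\<lambda>p :: real. ereal 2)" "2 \<le> Liminf (at_left 1) (\<lambda>p :: real. ereal 2)"
    by (intro Liminf_bounded always_eventually allI, simp)+
  thus "\<exists>\<epsilon> :: real \<Rightarrow> real.
      (\<forall>p. 0 < p \<and> p < 1 \<and> p \<noteq> 1/2 \<longrightarrow>
         \<epsilon> p > 0 \<and>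
         (\<exists>g. g meromorphic_on {s. Re s > - \<epsilon> p} \<and>
              (\<forall>s. Re s > R_dimension p \<longrightarrow> g s = spectral_zeta p s))) \<and>
      Liminf (at_right 0) (\<lambda>p. ereal (\<epsilon> p)) \<ge> 2 \<and>
      Liminf (at_left 1) (\<lambda>p. ereal (\<epsilon> p)) \<ge> 2"
    using ev by (intro exI[of _ "\<lambda>_. 2"]) blast
qed

end
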